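(* Let $p \ge 11$ be a prime and let $(G,T,p)$ be one of the triples \[(\mathrm{A}_5, \mathrm{PSL}(2,11), 11),\quad (\mathrm{A}_5, \mathrm{PSL}(2,29), 29),\quad (\mathrm{M}_{22}, \mathrm{M}_{23}, 23),\quad (\mathrm{A}_{p-1}, \mathrm{A}_p, p).\] Then there exists a connected $p$-valent arc-transitive Cayley graph $\Gamma$ of $G$ such that the vertex stabilizer $\mathrm{Aut}(\Gamma)_v$ is solvable for some $v \in V(\Gamma)$.
   Context: All graphs are finite, simple and undirected. A graph is arc-transitive (symmetric) if its automorphism group is transitive on ordered pairs of adjacent vertices. A graph $\Gamma$ is a Cayley graph of a group $G$ if $\mathrm{Aut}(\Gamma)$ contains a subgroup isomorphic to $G$ acting regularly on $V(\Gamma)$. $\mathrm{A}_m$ is the alternating group of degree $m$, and $\mathrm{M}_{22}, \mathrm{M}_{23}$ are Mathieu groups. *)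

theory Defs
  imports
    "Graph_Theory.Digraph_Component"
    "HOL-Combinatorics.Cycles"
    "HOL-Number_Theory.Residues"
    "HOL-Algebra.Algebra"
begin

section \<open>Groups\<close>

definition group_center :: "('a, 'b) monoid_scheme \<Rightarrow> 'a set" where
  "group_center G = {z \<in> carrier G. \<forall>x \<in> carrier G. z \<otimes>\<^bsub>G\<^esub> x = x \<otimes>\<^bsub>G\<^esub> z}"

text \<open>The tuple \<open>(a, b, c, d)\<close> is the matrix with rows \<open>(a, b)\<close> and \<open>(c, d)\<close>.\<close>

definition SL2 :: "('r, 's) ring_scheme \<Rightarrow> ('r \<times> 'r \<times> 'r \<times> 'r) monoid" where
  "SL2 R = \<lparr>carrier = {(a, b, c, d). {a, b, c, d} \<subseteq> carrier R \<and>
                        a \<otimes>\<^bsub>R\<^esub> d \<ominus>\<^bsub>R\<^esub> b \<otimes>\<^bsub>R\<^esub> c = \<one>\<^bsub>R\<^esub>},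
            mult = (\<lambda>(a, b, c, d) (a', b', c', d').
                     (a \<otimes>\<^bsub>R\<^esub> a' \<oplus>\<^bsub>R\<^esub> b \<otimes>\<^bsub>R\<^esub> c', a \<otimes>\<^bsub>R\<^esub> b' \<oplus>\<^bsub>R\<^esub> b \<otimes>\<^bsub>R\<^esub> d',
                      c \<otimes>\<^bsub>R\<^esub> a' \<oplus>\<^bsub>R\<^esub> d \<otimes>\<^bsub>R\<^esub> c', c \<otimes>\<^bsub>R\<^esub> b' \<oplus>\<^bsub>R\<^esub> d \<otimes>\<^bsub>R\<^esub> d')),
            one = (\<one>\<^bsub>R\<^esub>, \<zero>\<^bsub>R\<^esub>, \<zero>\<^bsub>R\<^esub>, \<one>\<^bsub>R\<^esub>)\<rparr>"

definition PSL2 :: "('r, 's) ring_scheme \<Rightarrow> ('r \<times> 'r \<times> 'r \<times> 'r) set monoid" where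
  "PSL2 R = SL2 R Mod group_center (SL2 R)"

lemma (in cring) group_SL2: "group (SL2 R)"
proof (rule groupI)
  fix x assume x: "x \<in> carrier (SL2 R)"
  obtain a b c d where [simp]: "x = (a, b, c, d)" by (cases x) auto
  have R: "a \<in> carrier R" "b \<in> carrier R" "c \<in> carrier R" "d \<in> carrier R"
    and det: "a \<otimes> d \<ominus> b \<otimes> c = \<one>" using x by (auto simp: SL2_def)
  have "d \<otimes> a \<oplus> \<ominus> b \<otimes> c = a \<otimes> d \<ominus> b \<otimes> c" "d \<otimes> b \<oplus> \<ominus> b \<otimes> d = \<zero>"
    "\<ominus> c \<otimes> a \<oplus> a \<otimes> c = \<zero>" "\<ominus> c \<otimes> b \<oplus> a \<otimes> d = a \<otimes> d \<ominus> b \<otimes> c"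
    "d \<otimes> a \<ominus> \<ominus> b \<otimes> \<ominus> c = a \<otimes> d \<ominus> b \<otimes> c"
    using R by algebra+
  then have "(d, \<ominus> b, \<ominus> c, a) \<otimes>\<^bsub>SL2 R\<^esub> x = \<one>\<^bsub>SL2 R\<^esub>"
    "(d, \<ominus> b, \<ominus> c, a) \<in> carrier (SL2 R)"
    using R det by (simp_all add: SL2_def)
  then show "\<exists>y \<in> carrier (SL2 R). y \<otimes>\<^bsub>SL2 R\<^esub> x = \<one>\<^bsub>SL2 R\<^esub>" by blast
next
  fix x y assume xy: "x \<in> carrier (SL2 R)" "y \<in> carrier (SL2 R)"
  obtain a b c d a' b' c' d' where [simp]: "x = (a, b, c, d)" "y = (a', b', c', d')"
    by (cases x, cases y) auto
  have R: "a \<in> carrier R" "b \<in> carrier R" "c \<in> carrier R" "d \<in> carrier R"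
    "a' \<in> carrier R" "b' \<in> carrier R" "c' \<in> carrier R" "d' \<in> carrier R"
    and det: "a \<otimes> d \<ominus> b \<otimes> c = \<one>" "a' \<otimes> d' \<ominus> b' \<otimes> c' = \<one>"
    using xy by (auto simp: SL2_def)
  have "(a \<otimes> a' \<oplus> b \<otimes> c') \<otimes> (c \<otimes> b' \<oplus> d \<otimes> d') \<ominus> (a \<otimes> b' \<oplus> b \<otimes> d') \<otimes> (c \<otimes> a' \<oplus> d \<otimes> c')
    = (a \<otimes> d \<ominus> b \<otimes> c) \<otimes> (a' \<otimes> d' \<ominus> b' \<otimes> c')"
    using R by algebra
  then show "x \<otimes>\<^bsub>SL2 R\<^esub> y \<in> carrier (SL2 R)"
    using R det by (simp add: SL2_def)
next
  fix x y z assume xyz: "x \<in> carrier (SL2 R)" "y \<in> carrier (SL2 R)" "z \<in> carrier (SL2 R)"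
  have assoc: "(a \<otimes> e \<oplus> b \<otimes> g) \<otimes> h \<oplus> (a \<otimes> f \<oplus> b \<otimes> i) \<otimes> j
      = a \<otimes> (e \<otimes> h \<oplus> f \<otimes> j) \<oplus> b \<otimes> (g \<otimes> h \<oplus> i \<otimes> j)"
    if "a \<in> carrier R" "b \<in> carrier R" "e \<in> carrier R" "f \<in> carrier R" "g \<in> carrier R"
      "h \<in> carrier R" "i \<in> carrier R" "j \<in> carrier R" for a b e f g h i j
    using that by algebra
  show "x \<otimes>\<^bsub>SL2 R\<^esub> y \<otimes>\<^bsub>SL2 R\<^esub> z = x \<otimes>\<^bsub>SL2 R\<^esub> (y \<otimes>\<^bsub>SL2 R\<^esub> z)"
    using xyz by (auto simp: SL2_def assoc)
qed (auto simp: SL2_def a_minus_def)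

lemma (in group) group_center_normal: "group_center G \<lhd> G"
proof -
  have "subgroup (group_center G) G"
  proof (rule subgroupI)
    fix z assume z: "z \<in> group_center G"
    have "inv z \<otimes> x = x \<otimes> inv z" if "x \<in> carrier G" for x
      using z that by (simp add: group_center_def)
        (metis inv_closed inv_solve_left inv_solve_right m_assoc m_closed)
    then show "inv z \<in> group_center G" using z by (simp add: group_center_def)
  next
    fix y z assume yz: "y \<in> group_center G" "z \<in> group_center G"
    have "(y \<otimes> z) \<otimes> x = x \<otimes> (y \<otimes> z)" if x: "x \<in> carrier G" for x
    proof -
      have c: "y \<in> carrier G" "z \<in> carrier G" "z \<otimes> x = x \<otimes> z" "y \<otimes> x = x \<otimes> y"
        using yz x by (simp_all add: group_center_def)
      have "(y \<otimes> z) \<otimes> x = y \<otimes> (x \<otimes> z)" using c x by (simp add: m_assoc)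
      also have "\<dots> = x \<otimes> y \<otimes> z" using c x by (simp flip: m_assoc)
      finally show ?thesis using c x by (simp add: m_assoc)
    qed
    then show "y \<otimes> z \<in> group_center G" using yz unfolding group_center_def by blast
  next
    have "\<one> \<in> group_center G" by (simp add: group_center_def)
    then show "group_center G \<noteq> {}" by blast
  qed (auto simp: group_center_def)
  then show ?thesis
  proof (rule normal_invI)
    fix x z assume x: "x \<in> carrier G" and z: "z \<in> group_center G"
    have c: "z \<in> carrier G" "x \<otimes> z = z \<otimes> x" using x z by (simp_all add: group_center_def)
    have "x \<otimes> z \<otimes> inv x = z \<otimes> (x \<otimes> inv x)" using x c by (simp only: m_assoc inv_closed)
    also have "\<dots> = z" using x c by simp
    finally show "x \<otimes> z \<otimes> inv x \<in> group_center G" using z by simp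
  qed
qed

lemma (in cring) group_PSL2: "group (PSL2 R)"
  unfolding PSL2_def
  by (intro normal.factorgroup_is_group group.group_center_normal group_SL2)

definition point_stabilizer :: "('a \<Rightarrow> 'a) monoid \<Rightarrow> 'a \<Rightarrow> ('a \<Rightarrow> 'a) monoid" where
  "point_stabilizer K v = K\<lparr>carrier := {g \<in> carrier K. g v = v}\<rparr>"

text \<open>Mathieu's generators of \<open>M\<^sub>2\<^sub>3\<close> in its 4-transitive action on 23 points.\<close>

definition M23_gen1 :: "nat \<Rightarrow> nat" where
  "M23_gen1 = cycle_of_list [1, 2, 3, 4, 5, 6, 7, 8, 9, 10, 11, 12,
                             13, 14, 15, 16, 17, 18, 19, 20, 21, 22, 23]"

definition M23_gen2 :: "nat \<Rightarrow> nat" where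
  "M23_gen2 = cycle_of_list [3, 17, 10, 7, 9] \<circ> cycle_of_list [4, 13, 14, 19, 5] \<circ>
              cycle_of_list [8, 18, 11, 12, 23] \<circ> cycle_of_list [15, 20, 22, 21, 16]"

definition M23 :: "(nat \<Rightarrow> nat) monoid" where
  "M23 = subgroup_generated (sym_group 23) {M23_gen1, M23_gen2}"

lemma M23_gens_in_carrier: "M23_gen1 \<in> carrier (sym_group 23)" "M23_gen2 \<in> carrier (sym_group 23)"
  unfolding M23_gen1_def M23_gen2_def sym_group_carrier
  by (intro permutes_compose permutes_subset[OF cycle_permutes]; simp)+

lemma group_M23: "group M23"
  unfolding M23_def by (rule group.group_subgroup_generated[OF sym_group_is_group])

definition M22 :: "(nat \<Rightarrow> nat) monoid" where
  "M22 = point_stabilizer M23 23"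


section \<open>Graphs\<close>

text \<open>
  A finite simple undirected graph is a \<^const>\<open>pair_graph\<close>: a finite vertex set with a
  symmetric irreflexive adjacency relation, which is also the set of arcs.
\<close>

definition graph_aut :: "'v pair_pre_digraph \<Rightarrow> ('v \<Rightarrow> 'v) monoid" where
  "graph_aut \<Gamma> = \<lparr>carrier = {f. f permutes pverts \<Gamma> \<and>
                     (\<forall>u \<in> pverts \<Gamma>. \<forall>v \<in> pverts \<Gamma>. (f u, f v) \<in> parcs \<Gamma> \<longleftrightarrow> (u, v) \<in> parcs \<Gamma>)},
                  mult = (\<circ>), one = id\<rparr>"

lemma group_graph_aut: "group (graph_aut \<Gamma>)"
proof (rule groupI)
  fix f assume f: "f \<in> carrier (graph_aut \<Gamma>)"
  then have p: "f permutes pverts \<Gamma>" by (simp add: graph_aut_def)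
  have "inv_into UNIV f \<in> carrier (graph_aut \<Gamma>)"
    using f permutes_in_image[OF permutes_inv[OF p]] permutes_inverses[OF p] permutes_inv[OF p]
    by (simp add: graph_aut_def) metis
  moreover have "inv_into UNIV f \<circ> f = id" using permutes_inv_o[OF p] by simp
  ultimately show "\<exists>g \<in> carrier (graph_aut \<Gamma>). g \<otimes>\<^bsub>graph_aut \<Gamma>\<^esub> f = \<one>\<^bsub>graph_aut \<Gamma>\<^esub>"
    by (auto simp: graph_aut_def)
qed (auto simp: graph_aut_def permutes_id permutes_compose permutes_in_image)

definition arc_transitive :: "'v pair_pre_digraph \<Rightarrow> bool" where
  "arc_transitive \<Gamma> \<longleftrightarrow>
     (\<forall>(u, v) \<in> parcs \<Gamma>. \<forall>(u', v') \<in> parcs \<Gamma>. \<exists>f \<in> carrier (graph_aut \<Gamma>). f u = u' \<and> f v = v')"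

definition regular_on :: "('v \<Rightarrow> 'v) set \<Rightarrow> 'v set \<Rightarrow> bool" where
  "regular_on H V \<longleftrightarrow> (\<forall>u \<in> V. \<forall>v \<in> V. \<exists>!h. h \<in> H \<and> h u = v)"

definition is_cayley_graph_of :: "'v pair_pre_digraph \<Rightarrow> ('a, 'b) monoid_scheme \<Rightarrow> bool" where
  "is_cayley_graph_of \<Gamma> G \<longleftrightarrow>
     (\<exists>H. subgroup H (graph_aut \<Gamma>) \<and> (graph_aut \<Gamma>)\<lparr>carrier := H\<rparr> \<cong> G \<and> regular_on H (pverts \<Gamma>))"

end

theory Submission
  imports Defs
begin

text \<open>
  In each case the graph has a group \<open>T\<close> of automorphisms in which \<open>G\<close> is a complement of a vertex
  stabilizer. The point is to bound the full automorphism group. In a connected graph whose vertex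
  stabilizers all act on the neighbourhood of the fixed vertex through \<open>AGL(1,p)\<close>, which is
  metabelian, the derived series of a vertex stabilizer fixes larger and larger balls, so the
  stabilizer is solvable. To force the local action into \<open>AGL(1,p)\<close>, the graph is chosen such that
  the pairs of neighbours of a vertex lying in a triangle, or in a 4-cycle with it, form a
  circulant relation modulo \<open>p\<close> that is preserved by affine maps only.

  For \<open>A\<^sub>p\<^sub>-\<^sub>1\<close> and \<open>M\<^sub>2\<^sub>2\<close> the vertices are the cosets of a \<open>p\<close>-cycle \<open>h\<close> in \<open>T\<close>, and the coset of \<open>t\<close> is
  adjacent to that of \<open>t g\<close> for an involution \<open>g\<close>. In \<open>A\<^sub>p\<close> we take \<open>g = (1 2)(3 4)\<close>: 4-cycles arise
  exactly from the conjugates of \<open>g\<close> under \<open>h\<^sup>d\<close> that commute with \<open>g\<close>, that is for \<open>d\<close> different from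
  \<open>\<plusminus>1, \<plusminus>3\<close>. In \<open>M\<^sub>2\<^sub>3\<close> we take \<open>g\<close> such that the 4-cycles occur for \<open>d = \<plusminus>6\<close> only.
  For \<open>A\<^sub>5\<close> the vertices are the nonzero vectors of \<open>GF(p)\<^sup>2\<close> modulo \<open>\<plusminus>1\<close> (for \<open>p = 11\<close>) or modulo squares
  (for \<open>p = 29\<close>), adjacent if their determinant is \<open>\<plusminus>1\<close> or a square, so that neighbourhoods are an
  11-cycle or the Paley graph; the binary icosahedral group in \<open>SL(2,p)\<close> acts regularly.
\<close>

section \<open>Solvability of vertex stabilizers\<close>

text \<open>The full automorphism group is never determined. An automorphism outside
  \<open>T\<close> is under no control except that it preserves whatever is defined from adjacency
  alone; triangles and 4-cycles are the simplest such data, and the regular group carries local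
  statements from one vertex to all. A circulant relation on Z/p is useful if only affine maps
  preserve it (\<open>difference_rigid\<close>). In a coset graph, 4-cycles through the base are
  solutions of h^d g h^k g = g h^m g h^n with k nonzero modulo p. Commuting conjugates of g give
  solutions at once; the work lies in excluding solutions for the other d, by size estimates in the
  alternating groups and by computation in M23. For A5 the scalars with s^r = 1 are divided out,
  where r = 2 for p = 11 and r = 14 for p = 29, so that (p^2 - 1)/r = 60 is the order of A5. An
  element of the binary icosahedral group fixing a vector up to such a scalar has order dividing
  gcd(120, p r) = 2 and is \<plusminus>1, whence the action modulo \<plusminus>1 is regular.\<close>

definition rel_aut :: "'v set \<Rightarrow> ('v \<times> 'v) set \<Rightarrow> ('v \<Rightarrow> 'v) \<Rightarrow> bool" where
  "rel_aut V E f \<longleftrightarrow> bij_betw f V V \<and> (\<forall>u\<in>V. \<forall>v\<in>V. (f u, f v) \<in> E \<longleftrightarrow> (u, v) \<in> E)"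

definition cyclic_labelling :: "nat \<Rightarrow> (int \<Rightarrow> 'v) \<Rightarrow> 'v set \<Rightarrow> bool" where
  "cyclic_labelling p l N \<longleftrightarrow> (\<forall>i j. l i = l j \<longleftrightarrow> int p dvd i - j) \<and> range l = N"

definition affine_on_labels :: "(int \<Rightarrow> 'v) \<Rightarrow> ('v \<Rightarrow> 'v) \<Rightarrow> bool" where
  "affine_on_labels l f \<longleftrightarrow> (\<exists>a b. \<forall>i. f (l i) = l (a * i + b))"

definition translation_on_labels :: "(int \<Rightarrow> 'v) \<Rightarrow> ('v \<Rightarrow> 'v) \<Rightarrow> bool" where
  "translation_on_labels l f \<longleftrightarrow> (\<exists>b. \<forall>i. f (l i) = l (i + b))"

text \<open>The relation c g f = f g says, without inverses, that c is the commutator of f and g.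
  Comparing slopes gives a'' a' a = a a' modulo p; slopes of injective affine maps are invertible,
  so c has slope 1.\<close>

lemma affine_commutator_translation:
  assumes "Factorial_Ring.prime p" and lab: "cyclic_labelling p l N"
    and f: "affine_on_labels l f" "inj f" and g: "affine_on_labels l g" "inj g"
    and c: "affine_on_labels l c" and cgf: "\<And>x. c (g (f x)) = f (g x)"
  shows "translation_on_labels l c"
proof -
  obtain a b where f': "\<And>i. f (l i) = l (a * i + b)" using f unfolding affine_on_labels_def by blast
  obtain a' b' where g': "\<And>i. g (l i) = l (a' * i + b')" using g unfolding affine_on_labels_def by blast
  obtain a'' b'' where c': "\<And>i. c (l i) = l (a'' * i + b'')" using c unfolding affine_on_labels_def by blast
  have lab': "l i = l j \<longleftrightarrow> int p dvd i - j" for i j using lab by (simp add: cyclic_labelling_def)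
  have P: "Factorial_Ring.prime (int p)" using assms(1) by simp
  have not1: "\<not> int p dvd 1" using P not_prime_unit by blast
  have unit: "\<not> int p dvd x" if h: "inj h" "\<And>i. h (l i) = l (x * i + y)" for h x y
  proof
    assume "int p dvd x"
    then have "h (l 1) = h (l 0)" by (simp add: h lab')
    then have "l 1 = l 0" using h(1) by (simp add: inj_def)
    then show False using not1 by (simp add: lab')
  qed
  have u: "\<not> int p dvd a" "\<not> int p dvd a'" using unit[OF f(2) f'] unit[OF g(2) g'] by auto
  have "int p dvd (a'' * (a' * (a * i + b) + b') + b'') - (a * (a' * i + b') + b)" for i
    using cgf[of "l i"] by (simp add: f' g' c' lab')
  from dvd_diff[OF this[of 1] this[of 0]]
  have "int p dvd (a'' - 1) * (a * a')" by (simp add: algebra_simps)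
  then have "int p dvd a'' - 1" using u P by (simp add: prime_dvd_mult_iff)
  then have "int p dvd (a'' - 1) * i" for i by simp
  then have "l (a'' * i + b'') = l (i + b'')" for i by (simp add: lab' left_diff_distrib)
  then show ?thesis unfolding translation_on_labels_def using c' by metis
qed

section \<open>Vertex stabilizers as groups of functions and their derived series\<close>

lemma carrier_point_stabilizer:
  "f \<in> carrier (point_stabilizer (graph_aut \<Gamma>) v) \<longleftrightarrow> f \<in> carrier (graph_aut \<Gamma>) \<and> f v = v"
  by (simp add: point_stabilizer_def)

lemma mult_point_stabilizer: "x \<otimes>\<^bsub>point_stabilizer (graph_aut \<Gamma>) v\<^esub> y = x \<circ> y"
  by (simp add: point_stabilizer_def graph_aut_def)

lemma one_point_stabilizer: "\<one>\<^bsub>point_stabilizer (graph_aut \<Gamma>) v\<^esub> = id"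
  by (simp add: point_stabilizer_def graph_aut_def)

lemma graph_aut_permutes: "f \<in> carrier (graph_aut \<Gamma>) \<Longrightarrow> f permutes pverts \<Gamma>"
  by (simp add: graph_aut_def)

lemma group_point_stabilizer: "group (point_stabilizer (graph_aut \<Gamma>) v)"
proof -
  interpret A: group "graph_aut \<Gamma>" by (rule group_graph_aut)
  have "subgroup {g \<in> carrier (graph_aut \<Gamma>). g v = v} (graph_aut \<Gamma>)"
  proof (rule A.subgroupI)
    fix a assume a: "a \<in> {g \<in> carrier (graph_aut \<Gamma>). g v = v}"
    have "inv\<^bsub>graph_aut \<Gamma>\<^esub> a \<otimes>\<^bsub>graph_aut \<Gamma>\<^esub> a = \<one>\<^bsub>graph_aut \<Gamma>\<^esub>" using a by simp
    then have "inv\<^bsub>graph_aut \<Gamma>\<^esub> a \<circ> a = id" by (simp add: graph_aut_def)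
    then have "(inv\<^bsub>graph_aut \<Gamma>\<^esub> a) v = v" using a by (metis (mono_tags, lifting) comp_apply id_apply mem_Collect_eq)
    then show "inv\<^bsub>graph_aut \<Gamma>\<^esub> a \<in> {g \<in> carrier (graph_aut \<Gamma>). g v = v}" using a by auto
  next
    fix a b assume "a \<in> {g \<in> carrier (graph_aut \<Gamma>). g v = v}" "b \<in> {g \<in> carrier (graph_aut \<Gamma>). g v = v}"
    then show "a \<otimes>\<^bsub>graph_aut \<Gamma>\<^esub> b \<in> {g \<in> carrier (graph_aut \<Gamma>). g v = v}"
      using A.m_closed[of a b] by (simp add: graph_aut_def)
  next
    have "id \<in> carrier (graph_aut \<Gamma>)" using A.one_closed by (simp add: graph_aut_def)
    then show "{g \<in> carrier (graph_aut \<Gamma>). g v = v} \<noteq> {}" by auto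
  qed auto
  then show ?thesis unfolding point_stabilizer_def by (rule A.subgroup_imp_group)
qed

lemma inv_point_stabilizer:
  assumes "f \<in> carrier (point_stabilizer (graph_aut \<Gamma>) v)"
  shows "(inv\<^bsub>point_stabilizer (graph_aut \<Gamma>) v\<^esub> f) (f x) = x"
    and "f ((inv\<^bsub>point_stabilizer (graph_aut \<Gamma>) v\<^esub> f) x) = x"
proof -
  interpret K: group "point_stabilizer (graph_aut \<Gamma>) v" by (rule group_point_stabilizer)
  from K.l_inv[OF assms] K.r_inv[OF assms]
  show "(inv\<^bsub>point_stabilizer (graph_aut \<Gamma>) v\<^esub> f) (f x) = x"
    and "f ((inv\<^bsub>point_stabilizer (graph_aut \<Gamma>) v\<^esub> f) x) = x"
    by (simp_all add: mult_point_stabilizer one_point_stabilizer fun_eq_iff)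
qed

text \<open>The local action at a vertex is metabelian, so two further steps of the derived series
  of a group fixing \<open>w\<close> fix every neighbour of \<open>w\<close>.\<close>

lemma second_derived_fixes_labels:
  fixes \<Gamma> :: "'v pair_pre_digraph" and v w :: 'v
  defines "K \<equiv> point_stabilizer (graph_aut \<Gamma>) v"
  assumes "Factorial_Ring.prime p" and lab: "cyclic_labelling p l N"
    and loc: "\<And>f. f \<in> carrier (graph_aut \<Gamma>) \<Longrightarrow> f w = w \<Longrightarrow> affine_on_labels l f"
    and D: "D \<subseteq> carrier K" "\<And>f. f \<in> D \<Longrightarrow> f w = w"
    and f: "f \<in> derived K (derived K D)"
  shows "f (l i) = l i"
proof -
  interpret K: group K unfolding K_def by (rule group_point_stabilizer)
  note inv = inv_point_stabilizer[where \<Gamma> = \<Gamma> and v = v, folded K_def]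
  note mult = mult_point_stabilizer[where \<Gamma> = \<Gamma> and v = v, folded K_def]
  note one = one_point_stabilizer[of \<Gamma> v, folded K_def]
  have aut: "f \<in> carrier (graph_aut \<Gamma>)" "inj f" if "f \<in> carrier K" for f
    using that graph_aut_permutes[THEN permutes_inj] by (auto simp: K_def carrier_point_stabilizer)
  have inv_eq: "(inv\<^bsub>K\<^esub> f) x = y" if "f \<in> carrier K" "f y = x" for f x y
    using inv(1)[OF that(1)] that(2) by metis
  \<comment> \<open>Commutators of affine maps are translations, and translations commute:
    \<open>Tr\<close> will contain the first derived group and \<open>Fx\<close> the second.\<close>
  define Tr where "Tr = {f \<in> carrier K. f w = w \<and> translation_on_labels l f}"
  have Tr: "subgroup Tr K"
  proof (rule K.subgroupI)
    fix f assume f: "f \<in> Tr"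
    then obtain b where b: "\<And>i. f (l i) = l (i + b)" by (auto simp: Tr_def translation_on_labels_def)
    have "(inv\<^bsub>K\<^esub> f) (l i) = l (i + (-b))" for i
      using f b by (intro inv_eq) (auto simp: Tr_def)
    then have "translation_on_labels l (inv\<^bsub>K\<^esub> f)" unfolding translation_on_labels_def by blast
    moreover have "(inv\<^bsub>K\<^esub> f) w = w" using f by (intro inv_eq) (auto simp: Tr_def)
    ultimately show "inv\<^bsub>K\<^esub> f \<in> Tr" using f by (simp add: Tr_def)
  next
    fix f g assume fg: "f \<in> Tr" "g \<in> Tr"
    then obtain b c where "\<And>i. f (l i) = l (i + b)" "\<And>i. g (l i) = l (i + c)"
      by (auto simp: Tr_def translation_on_labels_def)
    then have "(f \<circ> g) (l i) = l (i + (c + b))" for i by (simp add: add.assoc)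
    then have "translation_on_labels l (f \<circ> g)" unfolding translation_on_labels_def by blast
    then show "f \<otimes>\<^bsub>K\<^esub> g \<in> Tr" using fg K.m_closed[of f g] by (simp add: Tr_def mult)
  next
    have "\<one>\<^bsub>K\<^esub> \<in> Tr" using K.one_closed
      by (auto simp: Tr_def one translation_on_labels_def intro: exI[of _ 0])
    then show "Tr \<noteq> {}" by blast
  qed (auto simp: Tr_def)
  have "derived_set K D \<subseteq> Tr"
  proof
    fix c assume "c \<in> derived_set K D"
    then obtain f g where fg: "f \<in> D" "g \<in> D" and c: "c = f \<otimes>\<^bsub>K\<^esub> g \<otimes>\<^bsub>K\<^esub> inv\<^bsub>K\<^esub> f \<otimes>\<^bsub>K\<^esub> inv\<^bsub>K\<^esub> g"
      by auto
    have fg': "f \<in> carrier K" "g \<in> carrier K" using fg D by auto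
    have cgf: "c (g (f x)) = f (g x)" for x using fg' by (simp add: c mult inv)
    have cK: "c \<in> carrier K" using fg' by (simp add: c)
    have cw: "c w = w" using cgf[of w] D(2)[OF fg(1)] D(2)[OF fg(2)] by simp
    have "translation_on_labels l c"
      by (rule affine_commutator_translation[OF \<open>Factorial_Ring.prime p\<close> lab, of f g c])
        (use loc aut fg' D(2) fg cK cw cgf in auto)
    then show "c \<in> Tr" using cK cw by (simp add: Tr_def)
  qed
  then have T1: "derived K D \<subseteq> Tr"
    unfolding derived_def using K.generate_subgroup_incl Tr by blast
  define Fx where "Fx = {f \<in> carrier K. \<forall>i. f (l i) = l i}"
  have Fx: "subgroup Fx K"
  proof (rule K.subgroupI)
    fix f assume f: "f \<in> Fx"
    have "(inv\<^bsub>K\<^esub> f) (l i) = l i" for i using f by (intro inv_eq) (auto simp: Fx_def)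
    then show "inv\<^bsub>K\<^esub> f \<in> Fx" using f by (simp add: Fx_def)
  next
    fix f g assume fg: "f \<in> Fx" "g \<in> Fx"
    then show "f \<otimes>\<^bsub>K\<^esub> g \<in> Fx" using K.m_closed[of f g] by (simp add: Fx_def mult)
  next
    have "\<one>\<^bsub>K\<^esub> \<in> Fx" using K.one_closed by (auto simp: Fx_def one)
    then show "Fx \<noteq> {}" by blast
  qed (auto simp: Fx_def)
  have "derived_set K (derived K D) \<subseteq> Fx"
  proof
    fix c assume "c \<in> derived_set K (derived K D)"
    then obtain f g where fg: "f \<in> Tr" "g \<in> Tr" and c: "c = f \<otimes>\<^bsub>K\<^esub> g \<otimes>\<^bsub>K\<^esub> inv\<^bsub>K\<^esub> f \<otimes>\<^bsub>K\<^esub> inv\<^bsub>K\<^esub> g"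
      using T1 by auto
    have fg': "f \<in> carrier K" "g \<in> carrier K" using fg by (auto simp: Tr_def)
    have cgf: "c (g (f x)) = f (g x)" for x using fg' by (simp add: c mult inv)
    have cK: "c \<in> carrier K" using fg' by (simp add: c)
    obtain b b' where b: "\<And>i. f (l i) = l (i + b)" "\<And>i. g (l i) = l (i + b')"
      using fg by (auto simp: Tr_def translation_on_labels_def)
    \<comment> \<open>Evaluated at the label i - b - b', which both f g and g f send to i.\<close>
    have "c (l i) = l i" for i
      using cgf[of "l (i - b - b')"] by (simp add: b)
    then show "c \<in> Fx" using cK by (simp add: Fx_def)
  qed
  then have "derived K (derived K D) \<subseteq> Fx"
    unfolding derived_def[of K "derived K D"] using K.generate_subgroup_incl Fx by blast
  then show ?thesis using f by (auto simp: Fx_def)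
qed

text \<open>Each edge of a path from v costs two steps of the derived series: once the n-th term
  fixes w, the (n+2)-nd fixes the neighbours of w. Finitely many vertices give one bound for all,
  and automorphisms are the identity off the vertex set, so that term is trivial.\<close>

lemma solvable_point_stabilizer:
  fixes \<Gamma> :: "'v pair_pre_digraph"
  assumes "Factorial_Ring.prime p" and fin: "finite (pverts \<Gamma>)" and arcs: "parcs \<Gamma> \<subseteq> pverts \<Gamma> \<times> pverts \<Gamma>"
    and v: "v \<in> pverts \<Gamma>" and conn: "\<And>w. w \<in> pverts \<Gamma> \<Longrightarrow> (v, w) \<in> (parcs \<Gamma>)\<^sup>*"
    and loc: "\<And>w. w \<in> pverts \<Gamma> \<Longrightarrow> \<exists>l. cyclic_labelling p l (parcs \<Gamma> `` {w}) \<and>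
      (\<forall>f \<in> carrier (graph_aut \<Gamma>). f w = w \<longrightarrow> affine_on_labels l f)"
  shows "solvable (point_stabilizer (graph_aut \<Gamma>) v)"
proof -
  define K where "K = point_stabilizer (graph_aut \<Gamma>) v"
  interpret K: group K unfolding K_def by (rule group_point_stabilizer)
  define D where "D n = (derived K ^^ n) (carrier K)" for n
  have sub: "D n \<subseteq> carrier K" for n unfolding D_def by (rule K.exp_of_derived_in_carrier) simp
  have sg: "subgroup (D n) K" for n
    unfolding D_def by (rule K.exp_of_derived_is_subgroup) (rule K.subgroup_self)
  have dec: "D (Suc n) \<subseteq> D n" for n using K.derived_incl[OF order_refl sg[of n]] by (simp add: D_def)
  have anti: "D m \<subseteq> D n" if "n \<le> m" for m n using that dec by (rule lift_Suc_antimono_le[rotated])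
  have ex: "\<exists>n. \<forall>f \<in> D n. f w = w" if "(v, w) \<in> (parcs \<Gamma>)\<^sup>*" for w
    using that
  proof (induction rule: rtrancl_induct)
    case base
    show ?case using sub[of 0] by (intro exI[of _ 0]) (auto simp: K_def carrier_point_stabilizer)
  next
    case (step w u)
    then obtain n where n: "\<forall>f \<in> D n. f w = w" by blast
    have "w \<in> pverts \<Gamma>" using step arcs by auto
    then obtain l where l: "cyclic_labelling p l (parcs \<Gamma> `` {w})"
      "\<forall>f \<in> carrier (graph_aut \<Gamma>). f w = w \<longrightarrow> affine_on_labels l f" using loc by blast
    have "u \<in> range l" using l(1) step(2) by (simp add: cyclic_labelling_def)
    then obtain i where i: "u = l i" by blast
    have "f u = u" if "f \<in> D (Suc (Suc n))" for f
      using second_derived_fixes_labels[OF assms(1) l(1), where D = "D n" and v = v and w = w and f = f]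
        l(2) n sub[of n] that by (auto simp: K_def D_def i)
    then show ?case by blast
  qed
  then obtain N where N: "\<And>w. w \<in> pverts \<Gamma> \<Longrightarrow> \<forall>f \<in> D (N w). f w = w" using conn by metis
  define M where "M = Max (N ` pverts \<Gamma>)"
  have "D M = {\<one>\<^bsub>K\<^esub>}"
  proof -
    have "f = id" if f: "f \<in> D M" for f
    proof
      fix x
      show "f x = id x"
      proof (cases "x \<in> pverts \<Gamma>")
        case True
        then have "N x \<le> M" unfolding M_def using fin by simp
        then show ?thesis using anti f N[OF True] by auto
      next
        case False
        have "f permutes pverts \<Gamma>"
          using f sub[of M] by (auto simp: K_def carrier_point_stabilizer intro!: graph_aut_permutes)
        then show ?thesis using False by (simp add: permutes_not_in)
      qed
    qed
    then show ?thesis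
      using subgroup.one_closed[OF sg[of M]] by (auto simp: K_def one_point_stabilizer)
  qed
  then show ?thesis unfolding K_def[symmetric] K.solvable_iff_trivial_derived_seq D_def by blast
qed

text \<open>The graph \<open>(V, E)\<close> is pulled back along the bijection \<open>\<psi>\<close>, which intertwines left
  translation in \<open>G\<close> with automorphisms of \<open>(V, E)\<close>.\<close>

proposition ex_cayley_graph_with_solvable_stabilizer:
  fixes G :: "('a, 'm) monoid_scheme" and V :: "'v set" and l :: "int \<Rightarrow> 'v"
  assumes "group G" and p: "Factorial_Ring.prime p"
    and psi: "bij_betw \<psi> (carrier G) V" and fin: "finite V"
    and E: "E \<subseteq> V \<times> V" "sym E" "irrefl E"
    and left: "\<And>x y z. x \<in> carrier G \<Longrightarrow> y \<in> carrier G \<Longrightarrow> z \<in> carrier G \<Longrightarrow>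
      (\<psi> (x \<otimes>\<^bsub>G\<^esub> y), \<psi> (x \<otimes>\<^bsub>G\<^esub> z)) \<in> E \<longleftrightarrow> (\<psi> y, \<psi> z) \<in> E"
    and conn: "\<And>w. w \<in> V \<Longrightarrow> (\<psi> \<one>\<^bsub>G\<^esub>, w) \<in> E\<^sup>*"
    and lab: "cyclic_labelling p l (E `` {\<psi> \<one>\<^bsub>G\<^esub>})"
    and rho: "rel_aut V E \<rho>" "\<rho> (\<psi> \<one>\<^bsub>G\<^esub>) = \<psi> \<one>\<^bsub>G\<^esub>" "\<And>i. \<rho> (l i) = l (i + 1)"
    and loc: "\<And>f. rel_aut V E f \<Longrightarrow> f (\<psi> \<one>\<^bsub>G\<^esub>) = \<psi> \<one>\<^bsub>G\<^esub> \<Longrightarrow> affine_on_labels l f"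
  shows "\<exists>\<Gamma> :: 'a pair_pre_digraph.
           pair_graph \<Gamma> \<and> Digraph_Component.connected (with_proj \<Gamma>) \<and>
           (\<forall>v \<in> pverts \<Gamma>. out_degree (with_proj \<Gamma>) v = p) \<and>
           arc_transitive \<Gamma> \<and> is_cayley_graph_of \<Gamma> G \<and>
           (\<exists>v \<in> pverts \<Gamma>. solvable (point_stabilizer (graph_aut \<Gamma>) v))"
proof -
  interpret G: group G by fact
  define \<chi> where "\<chi> = inv_into (carrier G) \<psi>"
  have psiV: "\<psi> x \<in> V" if "x \<in> carrier G" for x using psi that by (auto simp: bij_betw_def)
  have chi_bij: "bij_betw \<chi> V (carrier G)" unfolding \<chi>_def by (rule bij_betw_inv_into[OF psi])
  have chiG: "\<chi> v \<in> carrier G" if "v \<in> V" for v using chi_bij that by (auto simp: bij_betw_def)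
  have chi_psi: "\<chi> (\<psi> x) = x" if "x \<in> carrier G" for x
    unfolding \<chi>_def using psi that by (simp add: bij_betw_def)
  have psi_chi: "\<psi> (\<chi> v) = v" if "v \<in> V" for v
    unfolding \<chi>_def using psi that by (simp add: bij_betw_inv_into_right)
  \<comment> \<open>The group elements themselves become the vertices, so left multiplication is the
    regular action.\<close>
  define A where "A = {(x, y). x \<in> carrier G \<and> y \<in> carrier G \<and> (\<psi> x, \<psi> y) \<in> E}"
  define \<Gamma> where "\<Gamma> = \<lparr>pverts = carrier G, parcs = A\<rparr>"
  have [simp]: "pverts \<Gamma> = carrier G" "parcs \<Gamma> = A" by (simp_all add: \<Gamma>_def)
  have A_iff: "(x, y) \<in> A \<longleftrightarrow> (\<psi> x, \<psi> y) \<in> E" if "x \<in> carrier G" "y \<in> carrier G" for x y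
    using that by (simp add: A_def)
  have finG: "finite (carrier G)" using bij_betw_finite[OF psi] fin by simp
  have A_sub: "A \<subseteq> carrier G \<times> carrier G" by (auto simp: A_def)
  have finA: "finite A" using finite_subset[OF A_sub] finG by blast
  have pg: "pair_graph \<Gamma>"
  proof
    show "finite (pverts \<Gamma>)" "finite (parcs \<Gamma>)" using finG finA by simp_all
    show "symmetric (with_proj \<Gamma>)"
      using E(2) by (auto simp: symmetric_def arcs_ends_def arc_to_ends_def sym_def A_def)
  qed (use E(3) in \<open>auto simp: A_def irrefl_def\<close>)

  \<comment> \<open>Automorphisms must fix every point outside the vertex set, hence the second
    branch.\<close>
  define L where "L x = (\<lambda>y. if y \<in> carrier G then x \<otimes>\<^bsub>G\<^esub> y else y)" for x
  have Lapp: "L x y = x \<otimes>\<^bsub>G\<^esub> y" if "y \<in> carrier G" for x y using that by (simp add: L_def)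
  have autI: "(\<lambda>y. if y \<in> carrier G then f y else y) \<in> carrier (graph_aut \<Gamma>)"
    if "bij_betw f (carrier G) (carrier G)" "\<And>y z. y \<in> carrier G \<Longrightarrow> z \<in> carrier G \<Longrightarrow>
      (\<psi> (f y), \<psi> (f z)) \<in> E \<longleftrightarrow> (\<psi> y, \<psi> z) \<in> E" for f
  proof -
    have "f y \<in> carrier G" if "y \<in> carrier G" for y using that \<open>bij_betw f _ _\<close> by (auto simp: bij_betw_def)
    moreover have "(\<lambda>y. if y \<in> carrier G then f y else y) permutes carrier G"
      by (rule bij_imp_permutes) (use that(1) in \<open>auto intro: bij_betw_cong[THEN iffD1, rotated]\<close>)
    ultimately show ?thesis using that(2) by (simp add: graph_aut_def A_iff)
  qed
  have L_aut: "L x \<in> carrier (graph_aut \<Gamma>)" if x: "x \<in> carrier G" for x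
  proof -
    have "bij_betw (\<lambda>y. x \<otimes>\<^bsub>G\<^esub> y) (carrier G) (carrier G)"
      unfolding bij_betw_def using G.inj_on_cmult[OF x] G.surj_const_mult[OF x] by simp
    then show ?thesis unfolding L_def using autI left[OF x] by blast
  qed
  have aut_mult: "f \<otimes>\<^bsub>graph_aut \<Gamma>\<^esub> g = f \<circ> g" for f g by (simp add: graph_aut_def)
  interpret Aut: group "graph_aut \<Gamma>" by (rule group_graph_aut)
  have L_mult: "L (x \<otimes>\<^bsub>G\<^esub> y) = L x \<circ> L y" if "x \<in> carrier G" "y \<in> carrier G" for x y
    using that by (auto simp: L_def fun_eq_iff G.m_assoc)
  have L_hom: "group_hom G (graph_aut \<Gamma>) L"
    by unfold_locales (auto simp: hom_def L_aut L_mult aut_mult)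
  have L_inj: "inj_on L (carrier G)"
  proof (rule inj_onI)
    fix x y assume "x \<in> carrier G" "y \<in> carrier G" "L x = L y"
    then have "L x \<one>\<^bsub>G\<^esub> = L y \<one>\<^bsub>G\<^esub>" by simp
    then show "x = y" using \<open>x \<in> carrier G\<close> \<open>y \<in> carrier G\<close> by (simp add: Lapp)
  qed
  define H where "H = L ` carrier G"
  have H_sub: "subgroup H (graph_aut \<Gamma>)"
    unfolding H_def by (rule group_hom.img_is_subgroup[OF L_hom])
  have H_iso: "(graph_aut \<Gamma>)\<lparr>carrier := H\<rparr> \<cong> G"
  proof -
    have "L \<in> iso G ((graph_aut \<Gamma>)\<lparr>carrier := H\<rparr>)"
      using L_inj by (auto simp: iso_def hom_def bij_betw_def H_def L_mult aut_mult)
    then show ?thesis using G.iso_sym by (auto simp: is_iso_def)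
  qed
  have H_reg: "regular_on H (carrier G)"
    unfolding regular_on_def
  proof (intro ballI)
    fix u v assume uv: "u \<in> carrier G" "v \<in> carrier G"
    show "\<exists>!h. h \<in> H \<and> h u = v"
    proof (rule ex1I[of _ "L (v \<otimes>\<^bsub>G\<^esub> inv\<^bsub>G\<^esub> u)"])
      show "L (v \<otimes>\<^bsub>G\<^esub> inv\<^bsub>G\<^esub> u) \<in> H \<and> L (v \<otimes>\<^bsub>G\<^esub> inv\<^bsub>G\<^esub> u) u = v"
        using uv by (simp add: H_def Lapp G.m_assoc)
      fix h assume "h \<in> H \<and> h u = v"
      then obtain x where x: "x \<in> carrier G" "h = L x" "x \<otimes>\<^bsub>G\<^esub> u = v"
        using uv by (auto simp: H_def Lapp)
      then have "v \<otimes>\<^bsub>G\<^esub> inv\<^bsub>G\<^esub> u = x" using uv by (auto simp: G.m_assoc)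
      then show "h = L (v \<otimes>\<^bsub>G\<^esub> inv\<^bsub>G\<^esub> u)" using x by simp
    qed
  qed
  have cayley: "is_cayley_graph_of \<Gamma> G"
    unfolding is_cayley_graph_of_def using H_sub H_iso H_reg by auto

  have lift_path: "(\<chi> u, \<chi> w) \<in> A\<^sup>*" if "(u, w) \<in> E\<^sup>*" for u w
    using that
  proof (induction rule: rtrancl_induct)
    case (step y z)
    then have "(\<chi> y, \<chi> z) \<in> A" using E(1) chiG psi_chi by (auto simp: A_def)
    then show ?case using step.IH by simp
  qed simp
  have A_conn1: "(\<one>\<^bsub>G\<^esub>, x) \<in> A\<^sup>*" if "x \<in> carrier G" for x
    using lift_path[OF conn[OF psiV[OF that]]] that by (simp add: chi_psi)
  have A_sym: "sym A" using E(2) by (auto simp: sym_def A_def)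
  have A_conn: "(x, y) \<in> A\<^sup>*" if "x \<in> carrier G" "y \<in> carrier G" for x y
    using A_conn1[OF that(1)] A_conn1[OF that(2)] symD[OF sym_rtrancl[OF A_sym]] rtrancl_trans by metis

  have "strongly_connected (mk_symmetric (with_proj \<Gamma>))"
  proof (rule strongly_connectedI)
    show "verts (mk_symmetric (with_proj \<Gamma>)) \<noteq> {}" by (auto simp: mk_symmetric_def)
    fix u v assume uv: "u \<in> verts (mk_symmetric (with_proj \<Gamma>))" "v \<in> verts (mk_symmetric (with_proj \<Gamma>))"
    then have uv': "u \<in> carrier G" "v \<in> carrier G" by (simp_all add: mk_symmetric_def)
    have "(u, v) \<in> rtrancl_on (carrier G) A"
      by (rule rtrancl_consistent_rtrancl_on[OF A_conn[OF uv'] uv']) (use A_sub in auto)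
    then have "(u, v) \<in> rtrancl_on (carrier G) (arcs_ends (mk_symmetric (with_proj \<Gamma>)))"
      by (rule rtrancl_on_mono[rotated 2]) (auto simp: arcs_ends_def arc_to_ends_def mk_symmetric_def)
    then show "u \<rightarrow>\<^sup>*\<^bsub>mk_symmetric (with_proj \<Gamma>)\<^esub> v"
      by (simp add: reachable_def mk_symmetric_def)
  qed
  then have connected: "Digraph_Component.connected (with_proj \<Gamma>)"
    by (simp add: Digraph_Component.connected_def)

  have lab_eq: "l i = l j \<longleftrightarrow> int p dvd i - j" for i j using lab by (simp add: cyclic_labelling_def)
  have lab_range: "range l = E `` {\<psi> \<one>\<^bsub>G\<^esub>}" using lab by (simp add: cyclic_labelling_def)
  have lV: "l i \<in> V" for i using lab_range E(1) by blast
  \<comment> \<open>Left translation by x carries the base labelling to x; local statements then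
    have to be checked at the identity only.\<close>
  define m where "m x i = x \<otimes>\<^bsub>G\<^esub> \<chi> (l i)" for x i
  have m_lab: "cyclic_labelling p (m x) (A `` {x})" if x: "x \<in> carrier G" for x
    unfolding cyclic_labelling_def
  proof (intro conjI allI)
    fix i j
    have "m x i = m x j \<longleftrightarrow> \<chi> (l i) = \<chi> (l j)" unfolding m_def using x chiG lV by simp
    also have "\<dots> \<longleftrightarrow> l i = l j" using psi_chi lV by metis
    finally show "m x i = m x j \<longleftrightarrow> int p dvd i - j" by (simp add: lab_eq)
  next
    have "(x, x \<otimes>\<^bsub>G\<^esub> y) \<in> A \<longleftrightarrow> (\<psi> \<one>\<^bsub>G\<^esub>, \<psi> y) \<in> E" if "y \<in> carrier G" for y
      using left[of x "\<one>\<^bsub>G\<^esub>" y] x that by (simp add: A_iff)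
    note * = this
    show "range (m x) = A `` {x}"
    proof (intro equalityI subsetI)
      fix z assume "z \<in> range (m x)"
      then obtain i where z: "z = x \<otimes>\<^bsub>G\<^esub> \<chi> (l i)" by (auto simp: m_def)
      have "(\<psi> \<one>\<^bsub>G\<^esub>, l i) \<in> E" using lab_range by blast
      then show "z \<in> A `` {x}" using *[of "\<chi> (l i)"] lV chiG psi_chi z by simp
    next
      fix z assume "z \<in> A `` {x}"
      then have xz: "(x, z) \<in> A" "z \<in> carrier G" using A_sub by auto
      define y where "y = inv\<^bsub>G\<^esub> x \<otimes>\<^bsub>G\<^esub> z"
      have y: "y \<in> carrier G" "z = x \<otimes>\<^bsub>G\<^esub> y" using x xz by (simp_all add: y_def G.m_assoc[symmetric])
      then have "\<psi> y \<in> range l" using * xz lab_range by auto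
      then obtain i where "\<psi> y = l i" by blast
      then have "z = m x i" using y chi_psi[of y] by (simp add: m_def)
      then show "z \<in> range (m x)" by blast
    qed
  qed
  have degree: "out_degree (with_proj \<Gamma>) x = p" if x: "x \<in> carrier G" for x
  proof -
    have "p > 0" using p prime_gt_0_nat by blast
    have "A `` {x} = m x ` {0..<int p}"
    proof -
      have "m x i = m x (i mod int p)" for i
        using m_lab[OF x] by (simp add: cyclic_labelling_def mod_eq_dvd_iff[symmetric])
      moreover have "i mod int p \<in> {0..<int p}" for i using \<open>p > 0\<close> by simp
      ultimately have "range (m x) = m x ` {0..<int p}" by blast
      then show ?thesis using m_lab[OF x] by (simp add: cyclic_labelling_def)
    qed
    moreover have "inj_on (m x) {0..<int p}"
    proof (rule inj_onI)
      fix i j assume ij: "i \<in> {0..<int p}" "j \<in> {0..<int p}" "m x i = m x j"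
      then have "int p dvd i - j" using m_lab[OF x] by (simp add: cyclic_labelling_def)
      then have "i mod int p = j mod int p" by (simp only: mod_eq_dvd_iff)
      then show "i = j" using ij by simp
    qed
    ultimately have "card (A `` {x}) = p" by (simp add: card_image)
    moreover have "out_arcs (with_proj \<Gamma>) x = Pair x ` (A `` {x})" by (auto simp: out_arcs_def)
    ultimately show ?thesis by (simp add: out_degree_def card_image inj_on_def)
  qed

  \<comment> \<open>Conjugation by \<open>\<psi>\<close> gives a map controlled on V only. This is
    why \<open>rel_aut\<close> asks for a bijection of V and not for a permutation fixing everything
    else.\<close>
  have rel_aut_conj: "rel_aut V E (\<lambda>v. \<psi> (f (\<chi> v)))" if f: "f \<in> carrier (graph_aut \<Gamma>)" for f
  proof -
    have fp: "f permutes carrier G" using f by (simp add: graph_aut_def)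
    have "bij_betw (\<psi> \<circ> (f \<circ> \<chi>)) V V"
      by (intro bij_betw_trans[OF bij_betw_trans[OF chi_bij permutes_imp_bij[OF fp]] psi])
    moreover have "(\<psi> (f (\<chi> u)), \<psi> (f (\<chi> v))) \<in> E \<longleftrightarrow> (u, v) \<in> E" if "u \<in> V" "v \<in> V" for u v
    proof -
      have "f (\<chi> u) \<in> carrier G" "f (\<chi> v) \<in> carrier G" using fp chiG that by (simp_all add: permutes_in_image)
      moreover have "(f (\<chi> u), f (\<chi> v)) \<in> A \<longleftrightarrow> (\<chi> u, \<chi> v) \<in> A"
        using f chiG that by (simp add: graph_aut_def)
      ultimately show ?thesis using A_iff chiG psi_chi that by simp
    qed
    ultimately show ?thesis by (simp add: rel_aut_def comp_def)
  qed
  have "solvable (point_stabilizer (graph_aut \<Gamma>) \<one>\<^bsub>G\<^esub>)"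
  proof (rule solvable_point_stabilizer[OF p])
    fix w assume "w \<in> pverts \<Gamma>"
    then have w: "w \<in> carrier G" by simp
    have "affine_on_labels (m w) f" if f: "f \<in> carrier (graph_aut \<Gamma>)" "f w = w" for f
    proof -
      \<comment> \<open>Conjugation by the translation by w turns an element fixing w into one
        fixing the identity, where \<open>loc\<close> applies.\<close>
      define f' where "f' = L (inv\<^bsub>G\<^esub> w) \<circ> f \<circ> L w"
      have f': "f' \<in> carrier (graph_aut \<Gamma>)"
        using Aut.m_closed[OF Aut.m_closed[OF L_aut f(1)] L_aut, of "inv\<^bsub>G\<^esub> w" w] w
        by (simp add: f'_def aut_mult)
      have "f' \<one>\<^bsub>G\<^esub> = \<one>\<^bsub>G\<^esub>" using w f by (simp add: f'_def Lapp)
      then have "affine_on_labels l (\<lambda>v. \<psi> (f' (\<chi> v)))"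
        using loc[OF rel_aut_conj[OF f']] by (simp add: chi_psi)
      then obtain a b where ab: "\<And>i. \<psi> (f' (\<chi> (l i))) = l (a * i + b)" by (auto simp: affine_on_labels_def)
      have "f (m w i) = m w (a * i + b)" for i
      proof -
        have fp: "f permutes carrier G" using f by (simp add: graph_aut_def)
        have c: "\<chi> (l i) \<in> carrier G" "f (w \<otimes>\<^bsub>G\<^esub> \<chi> (l i)) \<in> carrier G"
          using w chiG lV fp by (simp_all add: permutes_in_image)
        have "\<chi> (l (a * i + b)) = f' (\<chi> (l i))"
          using ab[of i] chi_psi[of "f' (\<chi> (l i))"] f' c by (simp add: graph_aut_def permutes_in_image)
        also have "\<dots> = inv\<^bsub>G\<^esub> w \<otimes>\<^bsub>G\<^esub> f (w \<otimes>\<^bsub>G\<^esub> \<chi> (l i))" using c w by (simp add: f'_def Lapp)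
        finally show ?thesis using c w by (simp add: m_def G.m_assoc[symmetric])
      qed
      then show ?thesis by (auto simp: affine_on_labels_def)
    qed
    then show "\<exists>l. cyclic_labelling p l (parcs \<Gamma> `` {w}) \<and>
      (\<forall>f \<in> carrier (graph_aut \<Gamma>). f w = w \<longrightarrow> affine_on_labels l f)" using m_lab[OF w] by auto
  qed (use finG A_sub A_conn1 in auto)

  moreover have "arc_transitive \<Gamma>"
  proof -
    \<comment> \<open>\<open>\<rho>\<close> rotates the neighbourhood of the identity: its powers
      move any neighbour to any other, and left translations move the initial vertex of an
      arc.\<close>
    define r where "r = (\<lambda>y. if y \<in> carrier G then \<chi> (\<rho> (\<psi> y)) else y)"
    have rhoV: "\<rho> v \<in> V" if "v \<in> V" for v using rho(1) that by (auto simp: rel_aut_def bij_betw_def)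
    have r: "r \<in> carrier (graph_aut \<Gamma>)" unfolding r_def
    proof (rule autI)
      have "bij_betw (\<chi> \<circ> (\<rho> \<circ> \<psi>)) (carrier G) (carrier G)"
        using rho(1) by (intro bij_betw_trans[OF bij_betw_trans[OF psi] chi_bij]) (auto simp: rel_aut_def)
      then show "bij_betw (\<lambda>y. \<chi> (\<rho> (\<psi> y))) (carrier G) (carrier G)" by (simp add: comp_def)
    qed (use rho(1) psiV rhoV psi_chi in \<open>simp add: rel_aut_def\<close>)
    have r1: "r \<one>\<^bsub>G\<^esub> = \<one>\<^bsub>G\<^esub>" by (simp add: r_def rho(2) chi_psi)
    have rm: "r (m \<one>\<^bsub>G\<^esub> i) = m \<one>\<^bsub>G\<^esub> (i + 1)" for i
      using chiG lV by (simp add: r_def m_def psi_chi rho(3))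
    have rot: "\<exists>f \<in> carrier (graph_aut \<Gamma>). f \<one>\<^bsub>G\<^esub> = \<one>\<^bsub>G\<^esub> \<and> (\<forall>i. f (m \<one>\<^bsub>G\<^esub> i) = m \<one>\<^bsub>G\<^esub> (i + int n))" for n
    proof (induction n)
      case 0
      show ?case using Aut.one_closed by (intro bexI[of _ id]) (auto simp: graph_aut_def)
    next
      case (Suc n)
      then obtain f where f: "f \<in> carrier (graph_aut \<Gamma>)" "f \<one>\<^bsub>G\<^esub> = \<one>\<^bsub>G\<^esub>" "\<forall>i. f (m \<one>\<^bsub>G\<^esub> i) = m \<one>\<^bsub>G\<^esub> (i + int n)" by blast
      show ?case
        using Aut.m_closed[OF r f(1)] f r1 rm
        by (intro bexI[of _ "r \<circ> f"]) (auto simp: aut_mult ac_simps)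
    qed
    have rot': "\<exists>f \<in> carrier (graph_aut \<Gamma>). f \<one>\<^bsub>G\<^esub> = \<one>\<^bsub>G\<^esub> \<and> f (m \<one>\<^bsub>G\<^esub> i) = m \<one>\<^bsub>G\<^esub> j" for i j
    proof -
      have "p > 0" using p prime_gt_0_nat by blast
      then have n: "int (nat ((j - i) mod int p)) = (j - i) mod int p" by simp
      have "int p dvd (i + (j - i) mod int p) - j"
        by (metis diff_add_eq diff_diff_eq2 dvd_minus_mod dvd_diff_commute add.commute)
      then have "m \<one>\<^bsub>G\<^esub> (i + int (nat ((j - i) mod int p))) = m \<one>\<^bsub>G\<^esub> j"
        using m_lab[of "\<one>\<^bsub>G\<^esub>"] n by (simp add: cyclic_labelling_def)
      then show ?thesis using rot[of "nat ((j - i) mod int p)"] by metis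
    qed
    show ?thesis unfolding arc_transitive_def
    proof clarify
      fix u v u' v' assume "(u, v) \<in> parcs \<Gamma>" "(u', v') \<in> parcs \<Gamma>"
      then have uv: "u \<in> carrier G" "u' \<in> carrier G" "v \<in> range (m u)" "v' \<in> range (m u')"
        using A_sub m_lab by (auto simp: cyclic_labelling_def)
      then obtain i j where ij: "v = m u i" "v' = m u' j" by blast
      obtain f where f: "f \<in> carrier (graph_aut \<Gamma>)" "f \<one>\<^bsub>G\<^esub> = \<one>\<^bsub>G\<^esub>" "f (m \<one>\<^bsub>G\<^esub> i) = m \<one>\<^bsub>G\<^esub> j"
        using rot' by blast
      have mL: "m x i = L x (m \<one>\<^bsub>G\<^esub> i)" if "x \<in> carrier G" for x i
        using that chiG lV by (simp add: m_def Lapp)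
      have m1: "m \<one>\<^bsub>G\<^esub> i \<in> carrier G" for i using chiG lV by (simp add: m_def)
      let ?f = "L u' \<circ> f \<circ> L (inv\<^bsub>G\<^esub> u)"
      have "?f \<in> carrier (graph_aut \<Gamma>)"
        using Aut.m_closed[OF Aut.m_closed[OF L_aut f(1)] L_aut, of u' "inv\<^bsub>G\<^esub> u"] uv by (simp add: aut_mult)
      moreover have "?f u = u'" using uv f by (simp add: Lapp)
      moreover have "L (inv\<^bsub>G\<^esub> u) v = m \<one>\<^bsub>G\<^esub> i"
        using uv m1[of i] by (simp add: ij mL[OF uv(1)] Lapp G.m_assoc[symmetric])
      then have "?f v = v'" using f(3) by (simp add: ij mL[OF uv(2)])
      ultimately show "\<exists>f \<in> carrier (graph_aut \<Gamma>). f u = u' \<and> f v = v'" by blast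
    qed
  qed
  ultimately show ?thesis
    using pg connected degree cayley by (intro exI[of _ \<Gamma>]) auto
qed

section \<open>Coset graphs of a cyclic subgroup\<close>

text \<open>Integer functions stand for permutations of Z/p: the first premise, read in its two
  directions, makes \<open>\<pi>\<close> well defined and injective modulo p. Representatives are
  left free.\<close>

definition difference_rigid :: "nat \<Rightarrow> (int \<Rightarrow> bool) \<Rightarrow> bool" where
  "difference_rigid p D \<longleftrightarrow> (\<forall>\<pi>. (\<forall>i j. int p dvd \<pi> i - \<pi> j \<longleftrightarrow> int p dvd i - j) \<longrightarrow>
     (\<forall>i j. D (\<pi> i - \<pi> j) \<longleftrightarrow> D (i - j)) \<longrightarrow> (\<exists>a b. \<forall>i. int p dvd \<pi> i - (a * i + b)))"

text \<open>\<open>Q\<close> is abstract because it has two instances: adjacency of neighbours of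
  the base vertex, that is triangles, and \<open>linked\<close>, that is 4-cycles.\<close>

lemma affine_on_labels_if_rigid:
  assumes lab: "cyclic_labelling p l N" and D: "difference_rigid p D"
    and f: "\<And>u. u \<in> N \<Longrightarrow> f u \<in> N" "inj_on f N"
    and Q: "\<And>u w. u \<in> N \<Longrightarrow> w \<in> N \<Longrightarrow> Q (f u) (f w) \<longleftrightarrow> Q u w"
    and QD: "\<And>i j. Q (l i) (l j) \<longleftrightarrow> D (i - j)"
  shows "affine_on_labels l f"
proof -
  have lN: "l i \<in> N" for i using lab by (auto simp: cyclic_labelling_def)
  have leq: "l i = l j \<longleftrightarrow> int p dvd i - j" for i j using lab by (simp add: cyclic_labelling_def)
  have "\<forall>i. \<exists>j. f (l i) = l j" using lab f(1)[OF lN] by (auto simp: cyclic_labelling_def)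
  then obtain \<pi> where pi: "\<And>i. f (l i) = l (\<pi> i)" by metis
  have "int p dvd \<pi> i - \<pi> j \<longleftrightarrow> int p dvd i - j" for i j
    using inj_on_eq_iff[OF f(2) lN lN, of i j] by (simp add: pi leq)
  moreover have "D (\<pi> i - \<pi> j) \<longleftrightarrow> D (i - j)" for i j
    using Q[OF lN lN, of i j] by (simp add: pi QD)
  ultimately obtain a b where "\<And>i. int p dvd \<pi> i - (a * i + b)"
    using D unfolding difference_rigid_def by blast
  then have "f (l i) = l (a * i + b)" for i by (simp add: pi leq)
  then show ?thesis by (auto simp: affine_on_labels_def)
qed

text \<open>In the following, \<open>T\<close> acts on the cosets of the cyclic group generated by \<open>h\<close>, the coset of
  \<open>t\<close> being adjacent to the coset of \<open>t g\<close>.\<close>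

locale rotary_group = group T for T (structure) +
  fixes g h :: 'a and p :: nat
  assumes prime_p: "Factorial_Ring.prime p" and finite_T: "finite (carrier T)"
    and g_closed [simp]: "g \<in> carrier T" and h_closed [simp]: "h \<in> carrier T"
    and g_square: "g \<otimes> g = \<one>"
    and h_pow_one: "h [^] (i :: int) = \<one> \<longleftrightarrow> int p dvd i"
    and core_free: "g \<otimes> h [^] (i :: int) \<otimes> g = h [^] (j :: int) \<Longrightarrow> int p dvd i"
    and generates: "carrier T = generate T {g, h}"
begin

definition pow :: "int \<Rightarrow> 'a" where "pow i = h [^] i"

lemma pow_closed [simp]: "pow i \<in> carrier T" by (simp add: pow_def)

lemma pow_add: "pow i \<otimes> pow j = pow (i + j)" by (simp add: pow_def int_pow_mult)

lemma pow_add': "x \<in> carrier T \<Longrightarrow> pow i \<otimes> (pow j \<otimes> x) = pow (i + j) \<otimes> x"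
  by (simp add: m_assoc[symmetric] pow_add)

lemma pow_0 [simp]: "pow 0 = \<one>" by (simp add: pow_def)

lemma g_square': "x \<in> carrier T \<Longrightarrow> g \<otimes> (g \<otimes> x) = x"
  by (simp add: m_assoc[symmetric] g_square)

lemma pow_eq_iff: "pow i = pow j \<longleftrightarrow> int p dvd i - j"
proof -
  have "pow i = pow j \<longleftrightarrow> pow (- j) \<otimes> pow i = pow (- j) \<otimes> pow j" by simp
  also have "\<dots> \<longleftrightarrow> pow (i - j) = \<one>" by (simp add: pow_add)
  finally show ?thesis by (simp add: pow_def h_pow_one)
qed

definition coset :: "'a \<Rightarrow> 'a set" where "coset t = range (\<lambda>i. t \<otimes> pow i)"

lemma coset_eq_iff:
  assumes "s \<in> carrier T" "t \<in> carrier T"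
  shows "coset s = coset t \<longleftrightarrow> (\<exists>i. t = s \<otimes> pow i)"
proof
  assume "coset s = coset t"
  moreover have "t \<otimes> pow 0 \<in> coset t" unfolding coset_def by blast
  ultimately show "\<exists>i. t = s \<otimes> pow i" using assms by (auto simp: coset_def)
next
  assume "\<exists>i. t = s \<otimes> pow i"
  then obtain i where t: "t = s \<otimes> pow i" by blast
  have "t \<otimes> pow j = s \<otimes> pow (i + j)" for j using assms by (simp add: t m_assoc pow_add)
  moreover have "s \<otimes> pow j = t \<otimes> pow (j - i)" for j using assms by (simp add: t m_assoc pow_add)
  ultimately show "coset s = coset t" unfolding coset_def by blast
qed

definition V :: "'a set set" where "V = coset ` carrier T"

definition E :: "('a set \<times> 'a set) set" where "E = {(coset t, coset (t \<otimes> g)) | t. t \<in> carrier T}"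

definition nb :: "int \<Rightarrow> 'a set" where "nb i = coset (pow i \<otimes> g)"

lemma coset_V [simp]: "t \<in> carrier T \<Longrightarrow> coset t \<in> V" by (simp add: V_def)

lemma edgeI: "t \<in> carrier T \<Longrightarrow> (coset t, coset (t \<otimes> g)) \<in> E"
  by (auto simp: E_def)

lemma edge_iff:
  assumes "s \<in> carrier T"
  shows "(coset s, x) \<in> E \<longleftrightarrow> (\<exists>k. x = coset (s \<otimes> pow k \<otimes> g))"
proof
  assume "(coset s, x) \<in> E"
  then obtain t where "t \<in> carrier T" "coset s = coset t" "x = coset (t \<otimes> g)" by (auto simp: E_def)
  then show "\<exists>k. x = coset (s \<otimes> pow k \<otimes> g)" using coset_eq_iff assms by blast
next
  assume "\<exists>k. x = coset (s \<otimes> pow k \<otimes> g)"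
  then obtain k where x: "x = coset (s \<otimes> pow k \<otimes> g)" by blast
  have "coset s = coset (s \<otimes> pow k)" using assms coset_eq_iff[of s "s \<otimes> pow k"] by auto
  then show "(coset s, x) \<in> E" using edgeI[of "s \<otimes> pow k"] assms x by simp
qed

lemma E_sub: "E \<subseteq> V \<times> V" by (auto simp: E_def)

lemma E_sym: "sym E"
proof (rule symI)
  fix x y assume "(x, y) \<in> E"
  then obtain t where t: "t \<in> carrier T" "x = coset t" "y = coset (t \<otimes> g)" by (auto simp: E_def)
  then have "x = coset (t \<otimes> g \<otimes> g)" by (simp add: m_assoc g_square)
  then show "(y, x) \<in> E" using edgeI[of "t \<otimes> g"] t by simp
qed

lemma not_dvd_1: "\<not> int p dvd 1"
  using prime_p by (metis int_dvd_int_iff not_prime_unit of_nat_1)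

lemma g_not_pow: "g \<noteq> pow i"
proof
  assume g: "g = pow i"
  have "g \<otimes> pow 1 \<otimes> g = pow (i + 1 + i)" unfolding g by (simp only: pow_add)
  then show False using core_free[of 1] not_dvd_1 by (metis pow_def)
qed

lemma E_irrefl: "irrefl E"
proof (rule irreflI, rule notI)
  fix x assume "(x, x) \<in> E"
  then obtain t where t: "t \<in> carrier T" "coset t = coset (t \<otimes> g)" by (auto simp: E_def)
  then obtain i where "t \<otimes> g = t \<otimes> pow i" using coset_eq_iff[of t "t \<otimes> g"] by auto
  then show False using t g_not_pow by simp
qed

text \<open>Labels i and j give the same coset iff g h^(j-i) g is a power of h. By
  \<open>core_free\<close> this happens for multiples of p only, so the valency is p and not
  smaller.\<close>

lemma nb_labelling: "cyclic_labelling p nb (E `` {coset \<one>})"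
  unfolding cyclic_labelling_def
proof (intro conjI allI)
  fix i j
  have "nb i = nb j \<longleftrightarrow> (\<exists>k. pow j \<otimes> g = pow i \<otimes> g \<otimes> pow k)"
    unfolding nb_def by (simp add: coset_eq_iff)
  also have "\<dots> \<longleftrightarrow> (\<exists>k. g \<otimes> pow (j - i) \<otimes> g = pow k)"
  proof (rule ex_cong1)
    fix k
    have "pow j \<otimes> g = pow i \<otimes> g \<otimes> pow k \<longleftrightarrow> g \<otimes> (pow (- i) \<otimes> (pow j \<otimes> g)) = g \<otimes> (pow (- i) \<otimes> (pow i \<otimes> g \<otimes> pow k))"
      by simp
    also have "\<dots> \<longleftrightarrow> g \<otimes> pow (j - i) \<otimes> g = pow k" by (simp add: m_assoc pow_add' g_square')
    finally show "pow j \<otimes> g = pow i \<otimes> g \<otimes> pow k \<longleftrightarrow> g \<otimes> pow (j - i) \<otimes> g = pow k" .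
  qed
  also have "\<dots> \<longleftrightarrow> int p dvd j - i"
  proof
    assume "\<exists>k. g \<otimes> pow (j - i) \<otimes> g = pow k"
    then show "int p dvd j - i" using core_free by (auto simp: pow_def)
  next
    assume "int p dvd j - i"
    then have "pow (j - i) = \<one>" by (simp add: pow_def h_pow_one)
    then have "g \<otimes> pow (j - i) \<otimes> g = pow 0" by (simp add: g_square)
    then show "\<exists>k. g \<otimes> pow (j - i) \<otimes> g = pow k" ..
  qed
  finally show "nb i = nb j \<longleftrightarrow> int p dvd i - j" by (simp add: dvd_diff_commute)
next
  show "range nb = E `` {coset \<one>}" by (auto simp: edge_iff nb_def)
qed

text \<open>A word in g and h traces a walk: right multiplication by a power of h stays in the
  coset, right multiplication by g crosses an edge. Connectedness thus amounts to generation of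
  T.\<close>

lemma connected_from_one:
  assumes "w \<in> V"
  shows "(coset \<one>, w) \<in> E\<^sup>*"
proof -
  have gh: "{g, h} \<subseteq> carrier T" by simp
  \<comment> \<open>The start s is arbitrary since, for a product x y, the walk of y begins at s
    x.\<close>
  have step: "(coset s, coset (s \<otimes> t)) \<in> E\<^sup>*" if "t \<in> generate T {g, h}" "s \<in> carrier T" for s t
    using that
  proof (induction arbitrary: s)
    case one
    then show ?case by simp
  next
    have g': "(coset s, coset (s \<otimes> g)) \<in> E\<^sup>*" if "s \<in> carrier T" for s
      using that by (intro r_into_rtrancl edgeI)
    have h': "coset (s \<otimes> pow i) = coset s" if "s \<in> carrier T" for s i
      using that coset_eq_iff[of s "s \<otimes> pow i"] by auto
    have hp: "coset (s \<otimes> h) = coset s" "coset (s \<otimes> inv h) = coset s" if "s \<in> carrier T" for s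
      using h'[OF that, of 1] h'[OF that, of "-1"] by (simp_all add: pow_def int_pow_neg)
    {
      case (incl x)
      then show ?case using g' hp by auto
    next
      case (inv x)
      moreover have "inv g = g" using g_square by (simp add: inv_equality)
      ultimately show ?case using g' hp by auto
    }
  next
    case (eng x y)
    have "x \<in> carrier T" "y \<in> carrier T" using eng generate_in_carrier[OF gh] by auto
    then show ?case using eng.IH(1)[of s] eng.IH(2)[of "s \<otimes> x"] eng.prems
      by (simp add: m_assoc[symmetric])
  qed
  obtain t where "t \<in> carrier T" "w = coset t" using assms by (auto simp: V_def)
  then show ?thesis using step[of t \<one>] generates one_closed by simp
qed

lemma left_image_coset:
  "x \<in> carrier T \<Longrightarrow> t \<in> carrier T \<Longrightarrow> (\<lambda>y. x \<otimes> y) ` coset t = coset (x \<otimes> t)"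
  unfolding coset_def image_image by (simp add: m_assoc)

lemma left_image_edge:
  assumes x: "x \<in> carrier T" and "s \<in> carrier T" "t \<in> carrier T"
  shows "(coset (x \<otimes> s), coset (x \<otimes> t)) \<in> E \<longleftrightarrow> (coset s, coset t) \<in> E"
proof -
  have *: "(coset (x \<otimes> s), coset (x \<otimes> t)) \<in> E"
    if st: "(coset s, coset t) \<in> E" "x \<in> carrier T" "s \<in> carrier T" "t \<in> carrier T" for x s t
  proof -
    obtain k where "coset t = coset (s \<otimes> pow k \<otimes> g)" using st(1) edge_iff[OF st(3)] by blast
    then have "coset (x \<otimes> t) = coset (x \<otimes> (s \<otimes> pow k \<otimes> g))"
      using st left_image_coset[of x t] left_image_coset[of x "s \<otimes> pow k \<otimes> g"] by simp
    then have "coset (x \<otimes> t) = coset (x \<otimes> s \<otimes> pow k \<otimes> g)" using st by (simp add: m_assoc)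
    then show ?thesis using edge_iff[of "x \<otimes> s"] st by blast
  qed
  show ?thesis
    using *[of s t x] *[of "x \<otimes> s" "x \<otimes> t" "inv x"] assms by (auto simp: m_assoc[symmetric])
qed

lemma left_image_aut:
  assumes x: "x \<in> carrier T"
  shows "rel_aut V E ((`) (\<lambda>y. x \<otimes> y))"
  unfolding rel_aut_def
proof (intro conjI ballI)
  show "bij_betw ((`) (\<lambda>y. x \<otimes> y)) V V"
  proof (rule bij_betwI[where g = "(`) (\<lambda>y. inv x \<otimes> y)"])
    show "(`) (\<lambda>y. x \<otimes> y) \<in> V \<rightarrow> V" "(`) (\<lambda>y. inv x \<otimes> y) \<in> V \<rightarrow> V"
      using x by (auto simp: V_def left_image_coset)
    fix u assume "u \<in> V"
    then obtain t where "t \<in> carrier T" "u = coset t" by (auto simp: V_def)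
    then show "(\<lambda>y. inv x \<otimes> y) ` (\<lambda>y. x \<otimes> y) ` u = u" "(\<lambda>y. x \<otimes> y) ` (\<lambda>y. inv x \<otimes> y) ` u = u"
      using x by (simp_all add: left_image_coset m_assoc[symmetric] del: image_image)
  qed
  fix u v assume "u \<in> V" "v \<in> V"
  then obtain s t where "s \<in> carrier T" "t \<in> carrier T" "u = coset s" "v = coset t" by (auto simp: V_def)
  then show "((\<lambda>y. x \<otimes> y) ` u, (\<lambda>y. x \<otimes> y) ` v) \<in> E \<longleftrightarrow> (u, v) \<in> E"
    using x by (simp add: left_image_coset left_image_edge)
qed

text \<open>\<open>four_cycle (i - j)\<close> says that \<open>nb i\<close> and \<open>nb j\<close> have a common neighbour besides the
  base vertex.\<close>

definition four_cycle :: "int \<Rightarrow> bool" where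
  "four_cycle d \<longleftrightarrow> (\<exists>k m n. \<not> int p dvd k \<and>
     pow d \<otimes> g \<otimes> pow k \<otimes> g = g \<otimes> pow m \<otimes> g \<otimes> pow n)"

definition linked :: "'a set \<Rightarrow> 'a set \<Rightarrow> bool" where
  "linked u w \<longleftrightarrow> (\<exists>x. x \<noteq> coset \<one> \<and> (u, x) \<in> E \<and> (w, x) \<in> E)"

text \<open>The neighbours of \<open>nb i\<close> are the cosets of h^i g h^k g, and such a coset is
  the base one exactly if p divides k. Equality of two of them, with h^j cancelled on the left, is
  the relation in \<open>four_cycle\<close> for d = i - j.\<close>

lemma linked_nb: "linked (nb i) (nb j) \<longleftrightarrow> four_cycle (i - j)"
proof -
  define c where "c i k = pow i \<otimes> g \<otimes> pow k \<otimes> g" for i k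
  have cT [simp]: "c i k \<in> carrier T" for i k by (simp add: c_def)
  have base: "coset (c i k) = coset \<one> \<longleftrightarrow> int p dvd k" for i k
  proof
    assume "coset (c i k) = coset \<one>"
    then obtain j where "c i k = pow j" using coset_eq_iff[of \<one> "c i k"] by auto
    then have "pow (- i) \<otimes> c i k = pow (- i) \<otimes> pow j" by simp
    then have "g \<otimes> pow k \<otimes> g = pow (j - i)" by (simp add: c_def m_assoc pow_add' pow_add)
    then show "int p dvd k" using core_free by (simp add: pow_def)
  next
    assume "int p dvd k"
    then have "pow k = \<one>" by (simp add: pow_def h_pow_one)
    then have "c i k = \<one> \<otimes> pow i" by (simp add: c_def m_assoc g_square)
    then show "coset (c i k) = coset \<one>" using coset_eq_iff[of \<one> "c i k"] by auto
  qed
  have nbE: "(nb i, x) \<in> E \<longleftrightarrow> (\<exists>k. x = coset (c i k))" for i x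
    unfolding nb_def c_def by (rule edge_iff) simp
  have eq: "coset (c j m) = coset (c i k) \<longleftrightarrow>
      (\<exists>n. pow (i - j) \<otimes> g \<otimes> pow k \<otimes> g = g \<otimes> pow m \<otimes> g \<otimes> pow n)" for i j k m
  proof -
    have "c i k = c j m \<otimes> pow n \<longleftrightarrow> pow (- j) \<otimes> c i k = pow (- j) \<otimes> (c j m \<otimes> pow n)" for n by simp
    then have "c i k = c j m \<otimes> pow n \<longleftrightarrow> pow (i - j) \<otimes> g \<otimes> pow k \<otimes> g = g \<otimes> pow m \<otimes> g \<otimes> pow n" for n
      by (simp add: c_def m_assoc pow_add')
    then show ?thesis by (simp add: coset_eq_iff)
  qed
  have "linked (nb i) (nb j) \<longleftrightarrow> (\<exists>k m. \<not> int p dvd k \<and> coset (c j m) = coset (c i k))"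
    unfolding linked_def nbE using base by metis
  then show ?thesis unfolding eq four_cycle_def by blast
qed

text \<open>The defining relation is not visibly symmetric in d; the symmetry is inherited from
  \<open>linked\<close>.\<close>

lemma four_cycle_minus: "four_cycle (- d) \<longleftrightarrow> four_cycle d"
proof -
  have "linked (nb d) (nb 0) \<longleftrightarrow> linked (nb 0) (nb d)" by (auto simp: linked_def)
  then show ?thesis by (simp add: linked_nb)
qed

lemma four_cycle_cong:
  assumes "int p dvd d - e"
  shows "four_cycle d \<longleftrightarrow> four_cycle e"
proof -
  have "pow d = pow e" using assms by (simp add: pow_eq_iff)
  then show ?thesis by (simp only: four_cycle_def)
qed

text \<open>S is a complement of the subgroup generated by h, so it acts regularly on the cosets.
  Left multiplication by h fixes the base coset and rotates its neighbours. Arbitrary automorphisms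
  are handled through \<open>linked\<close>, which they preserve.\<close>

proposition ex_cayley_graph:
  fixes G :: "('g, 'm) monoid_scheme"
  assumes "group G" and phi: "\<phi> \<in> iso G (T\<lparr>carrier := S\<rparr>)"
    and S: "subgroup S T" "\<And>t. t \<in> carrier T \<Longrightarrow> \<exists>x \<in> S. \<exists>i. t = x \<otimes> pow i"
      "\<And>i. pow i \<in> S \<Longrightarrow> pow i = \<one>"
    and rigid: "difference_rigid p four_cycle"
  shows "\<exists>\<Gamma> :: 'g pair_pre_digraph.
           pair_graph \<Gamma> \<and> Digraph_Component.connected (with_proj \<Gamma>) \<and>
           (\<forall>v \<in> pverts \<Gamma>. out_degree (with_proj \<Gamma>) v = p) \<and>
           arc_transitive \<Gamma> \<and> is_cayley_graph_of \<Gamma> G \<and>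
           (\<exists>v \<in> pverts \<Gamma>. solvable (point_stabilizer (graph_aut \<Gamma>) v))"
proof -
  interpret G: group G by fact
  have hom: "\<phi> (x \<otimes>\<^bsub>G\<^esub> y) = \<phi> x \<otimes> \<phi> y" if "x \<in> carrier G" "y \<in> carrier G" for x y
    using phi that by (auto simp: iso_def hom_def)
  have bij: "bij_betw \<phi> (carrier G) S" using phi by (simp add: iso_def)
  have phiS: "\<phi> x \<in> S" if "x \<in> carrier G" for x using bij that by (auto simp: bij_betw_def)
  have phiT: "\<phi> x \<in> carrier T" if "x \<in> carrier G" for x using phiS[OF that] S(1) subgroup.subset by blast
  have "\<phi> \<one>\<^bsub>G\<^esub> \<otimes> \<phi> \<one>\<^bsub>G\<^esub> = \<phi> \<one>\<^bsub>G\<^esub>" using hom[of "\<one>\<^bsub>G\<^esub>" "\<one>\<^bsub>G\<^esub>"] by simp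
  then have phi1: "\<phi> \<one>\<^bsub>G\<^esub> = \<one>" using phiT[of "\<one>\<^bsub>G\<^esub>"] by simp
  have "bij_betw coset S V"
  proof (rule bij_betw_imageI)
    show "inj_on coset S"
    proof (rule inj_onI)
      fix x y assume xy: "x \<in> S" "y \<in> S" "coset x = coset y"
      then have xyT: "x \<in> carrier T" "y \<in> carrier T" using S(1) subgroup.subset by blast+
      then obtain i where i: "y = x \<otimes> pow i" using xy coset_eq_iff by blast
      then have "pow i = inv x \<otimes> y" using xyT by (simp add: m_assoc[symmetric])
      then have "pow i \<in> S" using xy S(1) by (simp add: subgroup.m_closed subgroup.m_inv_closed)
      then show "x = y" using S(3) i xyT by simp
    qed
    show "coset ` S = V"
    proof (intro equalityI subsetI)
      fix v assume "v \<in> V"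
      then obtain t where t: "t \<in> carrier T" "v = coset t" by (auto simp: V_def)
      then obtain x i where x: "x \<in> S" "t = x \<otimes> pow i" using S(2) by blast
      then have "x \<in> carrier T" using S(1) subgroup.subset by blast
      then have "v = coset x" using t x coset_eq_iff[of x t] by auto
      then show "v \<in> coset ` S" using x by blast
    qed (use S(1) subgroup.subset in \<open>auto simp: V_def\<close>)
  qed
  from bij_betw_trans[OF bij this] have psi: "bij_betw (coset \<circ> \<phi>) (carrier G) V" .
  have base: "(coset \<circ> \<phi>) \<one>\<^bsub>G\<^esub> = coset \<one>" by (simp add: phi1)
  show ?thesis
  proof (rule ex_cayley_graph_with_solvable_stabilizer[where \<psi> = "coset \<circ> \<phi>" and V = V and E = E
        and l = nb and \<rho> = "(`) (\<lambda>y. h \<otimes> y)"], unfold base)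
    show "finite V" using finite_T by (simp add: V_def)
    show "((coset \<circ> \<phi>) (x \<otimes>\<^bsub>G\<^esub> y), (coset \<circ> \<phi>) (x \<otimes>\<^bsub>G\<^esub> z)) \<in> E \<longleftrightarrow> ((coset \<circ> \<phi>) y, (coset \<circ> \<phi>) z) \<in> E"
      if "x \<in> carrier G" "y \<in> carrier G" "z \<in> carrier G" for x y z
      using that by (simp add: hom left_image_edge phiT)
    have h: "pow 1 = h" by (simp add: pow_def)
    have "h \<otimes> \<one> = \<one> \<otimes> pow 1" by (simp add: h)
    then have "coset (h \<otimes> \<one>) = coset \<one>" using coset_eq_iff[of \<one> "h \<otimes> \<one>"] by auto
    then show "(\<lambda>y. h \<otimes> y) ` coset \<one> = coset \<one>" by (simp only: left_image_coset h_closed one_closed)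
    show "(\<lambda>y. h \<otimes> y) ` nb i = nb (i + 1)" for i
      unfolding nb_def using pow_add'[of g 1 i] by (simp add: left_image_coset h add.commute)
    fix f assume f: "rel_aut V E f" "f (coset \<one>) = coset \<one>"
    have fV: "f u \<in> V" if "u \<in> V" for u using f that by (auto simp: rel_aut_def bij_betw_def)
    have inj: "inj_on f V" and surj: "f ` V = V" using f by (auto simp: rel_aut_def bij_betw_def)
    have NV: "E `` {coset \<one>} \<subseteq> V" using E_sub by auto
    show "affine_on_labels nb f"
    proof (rule affine_on_labels_if_rigid[OF nb_labelling rigid _ _ _ linked_nb])
      fix u assume u: "u \<in> E `` {coset \<one>}"
      then have "u \<in> V" "(coset \<one>, u) \<in> E" using NV by auto
      then have "(f (coset \<one>), f u) \<in> E" using f(1) unfolding rel_aut_def by (meson coset_V one_closed)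
      then show "f u \<in> E `` {coset \<one>}" using f(2) by simp
    next
      fix u w assume "u \<in> E `` {coset \<one>}" "w \<in> E `` {coset \<one>}"
      then have uw: "u \<in> V" "w \<in> V" using NV by auto
      \<comment> \<open>The common neighbour is written as an image under f, which is onto V, so
        that edges can be compared before and after f.\<close>
      have "linked (f u) (f w) \<longleftrightarrow> (\<exists>x \<in> f ` V. x \<noteq> coset \<one> \<and> (f u, x) \<in> E \<and> (f w, x) \<in> E)"
        unfolding linked_def surj using E_sub by blast
      also have "\<dots> \<longleftrightarrow> (\<exists>x \<in> V. f x \<noteq> f (coset \<one>) \<and> (f u, f x) \<in> E \<and> (f w, f x) \<in> E)" using f(2) by auto
      also have "\<dots> \<longleftrightarrow> (\<exists>x \<in> V. x \<noteq> coset \<one> \<and> (u, x) \<in> E \<and> (w, x) \<in> E)"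
        using f(1) uw inj_on_eq_iff[OF inj] by (auto simp: rel_aut_def)
      also have "\<dots> \<longleftrightarrow> linked u w" unfolding linked_def using E_sub by blast
      finally show "linked (f u) (f w) \<longleftrightarrow> linked u w" .
    qed (rule inj_on_subset[OF inj NV])
  qed (use psi E_sub E_sym E_irrefl connected_from_one nb_labelling prime_p left_image_aut \<open>group G\<close> in auto)
qed

end

section \<open>Rigid circulant relations\<close>

text \<open>A walk with steps \<plusminus>b that never returns after two steps cannot turn back, so
  it keeps the direction e of its first step. As b is invertible modulo p, the multiples of b reach
  every residue.\<close>

lemma affine_if_unit_steps:
  fixes \<pi> :: "int \<Rightarrow> int"
  assumes p: "Factorial_Ring.prime p" "p > 2" and b: "\<not> int p dvd b"
    and inj: "\<And>i j. int p dvd \<pi> i - \<pi> j \<longleftrightarrow> int p dvd i - j"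
    and step: "\<And>i. int p dvd \<pi> (i + b) - \<pi> i - b \<or> int p dvd \<pi> (i + b) - \<pi> i + b"
  shows "\<exists>a c. \<forall>i. int p dvd \<pi> i - (a * i + c)"
proof -
  have P: "Factorial_Ring.prime (int p)" using p by simp
  have "\<not> int p dvd 2" using p by (auto dest: zdvd_imp_le)
  then have b2: "\<not> int p dvd 2 * b" using P b by (simp add: prime_dvd_mult_iff)
  obtain e where e: "e = 1 \<or> e = -1" "int p dvd \<pi> b - \<pi> 0 - e * b"
    using step[of 0] by (metis add_0 diff_minus_eq_add mult_1 mult_minus1)
  have walk: "int p dvd \<pi> (b * int n) - \<pi> 0 - e * (b * int n) \<and>
      int p dvd \<pi> (b * int (Suc n)) - \<pi> 0 - e * (b * int (Suc n))" for n
  proof (induction n)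
    case 0
    then show ?case using e by simp
  next
    case (Suc n)
    define x y z where xyz: "x = \<pi> (b * int n)" "y = \<pi> (b * int (Suc n))" "z = \<pi> (b * int (Suc (Suc n)))"
    have IH: "int p dvd x - \<pi> 0 - e * (b * int n)" "int p dvd y - \<pi> 0 - e * (b * int (Suc n))"
      using Suc unfolding xyz by auto
    have ne: "\<not> int p dvd z - x"
      unfolding xyz inj using b2 by (simp add: algebra_simps)
    have "int p dvd z - y - b \<or> int p dvd z - y + b"
      using step[of "b * int (Suc n)"] unfolding xyz by (simp add: algebra_simps)
    then have "int p dvd z - y - e * b \<or> int p dvd z - y + e * b" using e(1) by auto
    \<comment> \<open>A reversed step would lead back to x, against injectivity.\<close>
    moreover have "\<not> int p dvd z - y + e * b"
    proof
      assume "int p dvd z - y + e * b"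
      from dvd_diff[OF dvd_add[OF this IH(2)] IH(1)] have "int p dvd z - x" by (simp add: algebra_simps)
      then show False using ne by simp
    qed
    ultimately have "int p dvd z - y - e * b" by blast
    from dvd_add[OF this IH(2)] have "int p dvd z - \<pi> 0 - e * (b * int (Suc (Suc n)))"
      by (simp add: algebra_simps)
    then show ?case using IH(2) unfolding xyz by simp
  qed
  have "coprime b (int p)" using prime_imp_coprime[OF P b] by (simp add: coprime_commute)
  then obtain c where c: "[b * c = 1] (mod int p)" using cong_solve_coprime_int by blast
  have "int p dvd \<pi> i - (e * i + \<pi> 0)" for i
  proof -
    define n where "n = nat ((c * i) mod int p)"
    have n: "int n = (c * i) mod int p" using p by (simp add: n_def)
    have "[b * int n = b * (c * i)] (mod int p)" unfolding n by (simp add: cong_def mod_mult_right_eq)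
    moreover have "[b * (c * i) = i] (mod int p)" using cong_scalar_right[OF c, of i] by (simp add: mult.assoc)
    ultimately have bn: "int p dvd i - b * int n" by (metis cong_trans cong_sym cong_iff_dvd_diff)
    then have 1: "int p dvd \<pi> i - \<pi> (b * int n)" by (simp add: inj)
    have 2: "int p dvd \<pi> (b * int n) - \<pi> 0 - e * (b * int n)" using walk by blast
    have 3: "int p dvd e * (i - b * int n)" using bn by simp
    from dvd_diff[OF dvd_add[OF 1 2] 3]
    show ?thesis by (simp add: algebra_simps)
  qed
  then show ?thesis by blast
qed

text \<open>Steps of length b are the only related pairs, so \<open>\<pi>\<close> maps each of them
  to a step \<plusminus>b. The value of \<open>D\<close> at multiples of p is left open because it
  varies: \<open>four_cycle\<close> holds at 0, \<open>unit_residue\<close> fails there.\<close>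

lemma difference_rigid_cycle:
  assumes p: "Factorial_Ring.prime p" "p > 2" and b: "\<not> int p dvd b"
    and D: "\<And>d. \<not> int p dvd d \<Longrightarrow> D d \<longleftrightarrow> int p dvd d - b \<or> int p dvd d + b"
  shows "difference_rigid p D"
  unfolding difference_rigid_def
proof (intro allI impI)
  fix \<pi> :: "int \<Rightarrow> int"
  assume inj: "\<forall>i j. int p dvd \<pi> i - \<pi> j \<longleftrightarrow> int p dvd i - j" and pres: "\<forall>i j. D (\<pi> i - \<pi> j) \<longleftrightarrow> D (i - j)"
  show "\<exists>a c. \<forall>i. int p dvd \<pi> i - (a * i + c)"
  proof (rule affine_if_unit_steps[OF p b])
    fix i
    have "D b" using D[OF b] by simp
    then have "D (\<pi> (i + b) - \<pi> i)" using pres by simp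
    moreover have "\<not> int p dvd \<pi> (i + b) - \<pi> i" using inj b by simp
    ultimately show "int p dvd \<pi> (i + b) - \<pi> i - b \<or> int p dvd \<pi> (i + b) - \<pi> i + b" using D by blast
  qed (use inj in auto)
qed

text \<open>In the circulant graph with connection set \<open>{\<plusminus>1, \<plusminus>3}\<close>, exactly the pairs at difference \<open>\<plusminus>2\<close>
  have three common neighbours.\<close>

lemma difference_rigid_one_three:
  assumes p: "Factorial_Ring.prime p" "p \<ge> 11"
    and D: "\<And>d. \<not> int p dvd d \<Longrightarrow> D d \<longleftrightarrow>
      \<not> (int p dvd d - 1 \<or> int p dvd d + 1 \<or> int p dvd d - 3 \<or> int p dvd d + 3)"
  shows "difference_rigid p D"
  unfolding difference_rigid_def
proof (intro allI impI)
  fix \<pi> :: "int \<Rightarrow> int"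
  assume inj: "\<forall>i j. int p dvd \<pi> i - \<pi> j \<longleftrightarrow> int p dvd i - j" and pres: "\<forall>i j. D (\<pi> i - \<pi> j) \<longleftrightarrow> D (i - j)"
  \<comment> \<open>The complementary relation is preserved as well; it is sparse, so common
    neighbours can be counted.\<close>
  define S where "S d \<longleftrightarrow> int p dvd d - 1 \<or> int p dvd d + 1 \<or> int p dvd d - 3 \<or> int p dvd d + 3" for d
  have small: "\<not> int p dvd d" if "d \<noteq> 0" "\<bar>d\<bar> < 11" for d using that p dvd_imp_le_int[of d "int p"] by auto
  have S_pres: "S (\<pi> i - \<pi> j)" if "S (i - j)" "\<not> int p dvd i - j" for i j
    using that D inj pres unfolding S_def by metis
  \<comment> \<open>The numbers k1, k2, k3 are three distinct common neighbours of 0 and -d.\<close>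
  have two: "int p dvd d - 2 \<or> int p dvd d + 2"
    if nd: "\<not> int p dvd d" and k: "S k1" "S k2" "S k3" "S (k1 + d)" "S (k2 + d)" "S (k3 + d)"
      "\<not> int p dvd k1 - k2" "\<not> int p dvd k1 - k3" "\<not> int p dvd k2 - k3" for d k1 k2 k3
  proof -
    define r where "r = d mod int p"
    have "r \<noteq> 0" "0 \<le> r" using nd p by (simp_all add: r_def dvd_eq_mod_eq_0)
    moreover have "r < int p" using p by (simp add: r_def)
    ultimately have r: "0 < r" "r < int p" by simp_all
    have dr: "int p dvd d - r" by (simp add: r_def)
    have S_cong: "S x \<longleftrightarrow> S y" if "int p dvd x - y" for x y
    proof -
      have "int p dvd x + c \<longleftrightarrow> int p dvd y + c" for c
        using dvd_add_right_iff[OF that, of "y + c"] by (simp add: algebra_simps)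
      from this[of 1] this[of "-1"] this[of 3] this[of "-3"] show ?thesis by (simp add: S_def)
    qed
    define W where "W s \<longleftrightarrow> S (s + r)" for s
    have near: "int p dvd x \<longleftrightarrow> x = 0 \<or> x = int p" if "- 8 < x" "x < int p + 8" for x
    proof
      assume "int p dvd x"
      then obtain t where t: "x = int p * t" by blast
      have "t = 0 \<or> t = 1"
      proof (rule ccontr)
        assume "\<not> (t = 0 \<or> t = 1)"
        then consider "t \<ge> 2" | "t \<le> -1" by linarith
        then show False
        proof cases
          case 1
          then have "int p * 2 \<le> int p * t" by (intro mult_left_mono) auto
          then show False using t that p by linarith
        next
          case 2
          then have "int p * t \<le> int p * (-1)" by (intro mult_left_mono) auto
          then show False using t that p by linarith
        qed
      qed
      then show "x = 0 \<or> x = int p" using t by auto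
    qed auto
    \<comment> \<open>Each set lists the r for which s is a common neighbour of 0 and -r. The values
      2, 4, 6 are even and p - 2, p - 4, p - 6 odd; only 2 and p - 2 occur in three of the
      sets.\<close>
    have w: "W (-3) \<longleftrightarrow> r \<in> {2, 4, 6}" "W (-1) \<longleftrightarrow> r \<in> {2, 4, int p - 2}"
      "W 1 \<longleftrightarrow> r \<in> {2, int p - 4, int p - 2}" "W 3 \<longleftrightarrow> r \<in> {int p - 6, int p - 4, int p - 2}"
      unfolding W_def S_def using r p by (auto simp: near)
    have val: "\<exists>s \<in> {-3, -1, 1, 3}. int p dvd k - s \<and> W s" if "S k" "S (k + d)" for k
    proof -
      have "W s" if "int p dvd k - s" for s
      proof -
        have "int p dvd (k + d) - (s + r)" using dvd_add[OF that dr] by (simp add: algebra_simps)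
        then show ?thesis unfolding W_def using S_cong \<open>S (k + d)\<close> by blast
      qed
      then show ?thesis using \<open>S k\<close> unfolding S_def by force
    qed
    obtain s1 s2 s3 where s: "s1 \<in> {-3, -1, 1, 3}" "s2 \<in> {-3, -1, 1, 3}" "s3 \<in> {-3, -1, 1, 3}"
      "int p dvd k1 - s1" "int p dvd k2 - s2" "int p dvd k3 - s3" "W s1" "W s2" "W s3"
      using val[OF k(1,4)] val[OF k(2,5)] val[OF k(3,6)] by blast
    have "s1 \<noteq> s2" "s1 \<noteq> s3" "s2 \<noteq> s3"
      using k(7-9) s(4-6) by (metis diff_diff_eq2 diff_add_cancel dvd_diff)+
    then have "r = 2 \<or> r = int p - 2"
      using s(1-3,7-9) w p by auto
    then show ?thesis
    proof
      assume "r = int p - 2"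
      then have "(d - r) + int p = d + 2" by simp
      moreover have "int p dvd (d - r) + int p" using dr by (intro dvd_add) simp_all
      ultimately show ?thesis by metis
    qed (use dr in simp)
  qed
  show "\<exists>a c. \<forall>i. int p dvd \<pi> i - (a * i + c)"
  proof (rule affine_if_unit_steps[OF p(1), of 2])
    fix i
    \<comment> \<open>The points i - 1, i + 1 and i + 3 are the common neighbours of i and i + 2.
      Their images are measured from the image of i + 2, as in \<open>two\<close>.\<close>
    let ?k = "\<lambda>s. \<pi> (i + s) - \<pi> (i + 2)"
    have k: "S (?k s)" "S (?k s + (\<pi> (i + 2) - \<pi> i))" if "s \<in> {-1, 1, 3}" for s
    proof -
      have "S (s - 2)" "S s" using that by (auto simp: S_def)
      moreover have "s - 2 \<noteq> 0" "\<bar>s - 2\<bar> < 11" "s \<noteq> 0" "\<bar>s\<bar> < 11" using that by auto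
      then have "\<not> int p dvd s - 2" "\<not> int p dvd s" using small by blast+
      ultimately show "S (?k s)" "S (?k s + (\<pi> (i + 2) - \<pi> i))"
        using S_pres[of "i + s" "i + 2"] S_pres[of "i + s" i] by (simp_all add: algebra_simps)
    qed
    have ne: "\<not> int p dvd ?k s - ?k t" if "s \<noteq> t" "s \<in> {-1, 1, 3}" "t \<in> {-1, 1, 3}" for s t
    proof -
      have "\<not> int p dvd s - t" using that by (intro small) auto
      then show ?thesis using inj by simp
    qed
    have "\<not> int p dvd \<pi> (i + 2) - \<pi> i" using inj small[of 2] by simp
    from two[OF this k(1)[of "-1"] k(1)[of 1] k(1)[of 3] k(2)[of "-1"] k(2)[of 1] k(2)[of 3]
        ne[of "-1" 1] ne[of "-1" 3] ne[of 1 3]]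
    show "int p dvd \<pi> (i + 2) - \<pi> i - 2 \<or> int p dvd \<pi> (i + 2) - \<pi> i + 2" by simp
  qed (use inj p small[of 2] in auto)
qed

section \<open>The Paley graph on 29 points, squares being recognised by Euler's criterion\<close>

definition square29 :: "int \<Rightarrow> bool" where "square29 d \<longleftrightarrow> d ^ 14 mod 29 = 1"

lemma square29_mod: "square29 (d mod 29) \<longleftrightarrow> square29 d"
  unfolding square29_def by (simp add: power_mod)

lemma square29_mult: "square29 s \<Longrightarrow> square29 (s * d) \<longleftrightarrow> square29 d"
  unfolding square29_def power_mult_distrib by (metis mod_mult_left_eq mult_1)

definition paley_row :: "bool list" where
  "paley_row =
    [False, True, False, False, True, True, True, True, False, True,
     False, False, False, True, False, False, True, False, False, False,
     True, False, True, True, True, True, False, False, True]"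

text \<open>Squaring the colours is essential. The Paley graph is strongly regular, so iterated
  plain sums would stay in the span of the initial colouring, its neighbour sums and the constants,
  which cannot separate all points.\<close>

definition refine_colours :: "int list \<Rightarrow> int list" where
  "refine_colours ks =
     map (\<lambda>i. sum_list (map2 (\<lambda>b k. if b then k * k else 0) paley_row (rotate i ks))) [0..<29]"

lemma paley_row_nth: "s < 29 \<Longrightarrow> paley_row ! s \<longleftrightarrow> square29 (int s)"
proof -
  have "\<forall>s \<in> set [0..<29]. paley_row ! s \<longleftrightarrow> square29 (int s)" by code_simp
  then show "s < 29 \<Longrightarrow> paley_row ! s \<longleftrightarrow> square29 (int s)" by simp
qed

text \<open>Colour refinement of the Paley graph on 29 points, after individualising \<open>0\<close> and \<open>1\<close>,
  reaches the discrete partition in four rounds.\<close>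

lemma refine_colours_discrete:
  "distinct (refine_colours (refine_colours (refine_colours (refine_colours (1 # 2 # replicate 27 0)))))"
  by code_simp

definition invariant_colouring :: "(int \<Rightarrow> int) \<Rightarrow> int list \<Rightarrow> bool" where
  "invariant_colouring \<pi> ks \<longleftrightarrow>
     length ks = 29 \<and> (\<forall>i. ks ! nat (\<pi> i mod 29) = ks ! nat (i mod 29))"

text \<open>\<open>\<pi>\<close> respects the colours and the square differences, so the sum over
  the neighbours of \<open>\<pi> i\<close> is the sum over those of i, reindexed by
  \<open>\<pi>\<close>.\<close>

lemma invariant_refine_colours:
  assumes inj: "\<And>i j. 29 dvd \<pi> i - \<pi> j \<longleftrightarrow> 29 dvd i - j"
    and pres: "\<And>i j. square29 (\<pi> i - \<pi> j) \<longleftrightarrow> square29 (i - j)"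
    and ks: "invariant_colouring \<pi> ks"
  shows "invariant_colouring \<pi> (refine_colours ks)"
proof -
  define \<kappa> where "\<kappa> x = ks ! nat (x mod 29)" for x
  have kappa: "\<kappa> (\<pi> i) = \<kappa> i" "\<kappa> (i mod 29) = \<kappa> i" for i
    using ks by (simp_all add: invariant_colouring_def \<kappa>_def)
  have len: "length ks = 29" using ks by (simp add: invariant_colouring_def)
  have row_len: "length paley_row = 29" by (simp add: paley_row_def)
  define F where "F i = (\<Sum>x\<in>{0..<29}. if square29 (x - i) then \<kappa> x * \<kappa> x else 0)" for i
  have val: "refine_colours ks ! nat (i mod 29) = F i" for i
  proof -
    define r where "r = nat (i mod 29)"
    have r: "r < 29" "int r = i mod 29" by (simp_all add: r_def)
    have "refine_colours ks ! r = (\<Sum>s\<in>{0..<29}. if paley_row ! s then (rotate r ks ! s) * (rotate r ks ! s) else 0)"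
    proof -
      have "refine_colours ks ! r = sum_list (map2 (\<lambda>b k. if b then k * k else 0) paley_row (rotate ([0..<29] ! r) ks))"
        unfolding refine_colours_def using r by (subst nth_map) simp_all
      also have "[0..<29] ! r = r" using r by (subst nth_upt) simp_all
      finally show ?thesis by (simp add: sum_list_sum_nth len row_len)
    qed
    also have "\<dots> = (\<Sum>s\<in>{0..<29}. if square29 (int s) then \<kappa> (int s + i) * \<kappa> (int s + i) else 0)"
    proof (rule sum.cong)
      fix s :: nat assume "s \<in> {0..<29}"
      then have s: "s < 29" by simp
      have "rotate r ks ! s = ks ! ((r + s) mod 29)" using s len by (simp add: nth_rotate)
      also have "(r + s) mod 29 = nat ((int s + i) mod 29)"
      proof -
        have "int ((r + s) mod 29) = (i mod 29 + int s) mod 29" by (simp add: zmod_int r(2)[symmetric])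
        also have "\<dots> = (int s + i) mod 29" by (metis mod_add_left_eq add.commute)
        finally show ?thesis by (metis nat_int)
      qed
      finally have "rotate r ks ! s = \<kappa> (int s + i)" by (simp add: \<kappa>_def)
      then show "(if paley_row ! s then (rotate r ks ! s) * (rotate r ks ! s) else 0) =
          (if square29 (int s) then \<kappa> (int s + i) * \<kappa> (int s + i) else 0)"
        using paley_row_nth[OF s] by simp
    qed simp
    also have "\<dots> = F i" unfolding F_def
    proof (rule sum.reindex_bij_witness[where i = "\<lambda>x. nat ((x - i) mod 29)" and j = "\<lambda>s. (int s + i) mod 29"])
      fix s :: nat assume "s \<in> {0..<29}"
      then show "nat (((int s + i) mod 29 - i) mod 29) = s" by (simp add: mod_diff_left_eq)
      have "square29 ((int s + i) mod 29 - i) \<longleftrightarrow> square29 (int s)"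
        using square29_mod[of "(int s + i) mod 29 - i"] square29_mod[of "int s"] by (simp add: mod_diff_left_eq)
      then show "(if square29 ((int s + i) mod 29 - i) then \<kappa> ((int s + i) mod 29) * \<kappa> ((int s + i) mod 29) else 0) =
          (if square29 (int s) then \<kappa> (int s + i) * \<kappa> (int s + i) else 0)" by (simp add: kappa(2))
    next
      fix x :: int assume "x \<in> {0..<29}"
      then show "(int (nat ((x - i) mod 29)) + i) mod 29 = x" by (simp add: mod_add_left_eq)
    qed (auto simp: nat_less_iff)
    finally show ?thesis by (simp add: r_def)
  qed
  have "F (\<pi> i) = F i" for i
  proof -
    have "inj_on (\<lambda>y. \<pi> y mod 29) {0..<29}"
    proof (rule inj_onI)
      fix x y assume xy: "x \<in> {0..<29}" "y \<in> {0..<29}" "\<pi> x mod 29 = \<pi> y mod 29"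
      then have "29 dvd x - y" by (simp add: mod_eq_dvd_iff inj)
      then have "x mod 29 = y mod 29" by (simp only: mod_eq_dvd_iff)
      then show "x = y" using xy by simp
    qed
    moreover have "(\<lambda>y. \<pi> y mod 29) ` {0..<29} \<subseteq> {0..<29}" by auto
    ultimately have bij: "bij_betw (\<lambda>y. \<pi> y mod 29) {0..<29} {0..<29}"
      by (simp add: bij_betw_def endo_inj_surj)
    have "F (\<pi> i) = (\<Sum>y\<in>{0..<29}. if square29 (\<pi> y mod 29 - \<pi> i) then \<kappa> (\<pi> y mod 29) * \<kappa> (\<pi> y mod 29) else 0)"
      unfolding F_def by (rule sum.reindex_bij_betw[OF bij, symmetric])
    also have "\<dots> = F i" unfolding F_def
    proof (rule sum.cong)
      fix y
      have "square29 (\<pi> y mod 29 - \<pi> i) \<longleftrightarrow> square29 (\<pi> y - \<pi> i)"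
        by (metis square29_mod mod_diff_left_eq)
      then show "(if square29 (\<pi> y mod 29 - \<pi> i) then \<kappa> (\<pi> y mod 29) * \<kappa> (\<pi> y mod 29) else 0) =
          (if square29 (y - i) then \<kappa> y * \<kappa> y else 0)" by (simp add: pres kappa)
    qed simp
    finally show ?thesis .
  qed
  then show ?thesis by (simp add: invariant_colouring_def val) (simp add: refine_colours_def)
qed

text \<open>The slope s is a square because 1 is one. Dividing it out and shifting yields a map
  \<open>\<sigma>\<close> that fixes 0 and 1 and still preserves square differences. It preserves
  all refined colourings; as the last one is discrete, \<open>\<sigma>\<close> is the identity
  modulo 29.\<close>

lemma difference_rigid_square29: "difference_rigid 29 square29"
  unfolding difference_rigid_def
proof (intro allI impI)
  fix \<pi> :: "int \<Rightarrow> int"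
  assume "\<forall>i j. int 29 dvd \<pi> i - \<pi> j \<longleftrightarrow> int 29 dvd i - j" and pres: "\<forall>i j. square29 (\<pi> i - \<pi> j) \<longleftrightarrow> square29 (i - j)"
  then have inj: "29 dvd \<pi> i - \<pi> j \<longleftrightarrow> 29 dvd i - j" for i j by simp
  define s where "s = \<pi> 1 - \<pi> 0"
  have s: "square29 s" using pres by (simp add: s_def) (simp add: square29_def)
  \<comment> \<open>As s^14 = 1 modulo 29, this is the inverse of s.\<close>
  define t where "t = s ^ 13"
  have st: "(s * t) mod 29 = 1" using s by (simp add: t_def square29_def flip: power_Suc)
  have t: "square29 t"
  proof -
    have "t ^ 14 = (s ^ 14) ^ 13" by (simp add: t_def flip: power_mult)
    then have "t ^ 14 mod 29 = (s ^ 14 mod 29) ^ 13 mod 29" by (simp add: power_mod)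
    then show ?thesis using s by (simp add: square29_def)
  qed
  have nt: "\<not> 29 dvd t"
  proof
    assume "29 dvd t"
    then have "(s * t) mod 29 = 0" by simp
    then show False using st by simp
  qed
  have p29: "Factorial_Ring.prime (29 :: int)" by simp
  define \<sigma> where "\<sigma> i = t * (\<pi> i - \<pi> 0)" for i
  have sigma_diff: "\<sigma> i - \<sigma> j = t * (\<pi> i - \<pi> j)" for i j by (simp add: \<sigma>_def algebra_simps)
  have inj': "29 dvd \<sigma> i - \<sigma> j \<longleftrightarrow> 29 dvd i - j" for i j
    unfolding sigma_diff using nt p29 by (simp add: prime_dvd_mult_iff inj)
  have pres': "square29 (\<sigma> i - \<sigma> j) \<longleftrightarrow> square29 (i - j)" for i j
    unfolding sigma_diff using square29_mult[OF t] pres by simp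
  have fix0: "\<sigma> 0 mod 29 = 0" "\<sigma> 1 mod 29 = 1" using st by (simp_all add: \<sigma>_def s_def mult.commute)
  let ?ks = "1 # 2 # replicate 27 0 :: int list"
  have base: "invariant_colouring \<sigma> ?ks"
  proof -
    have "?ks ! nat (\<sigma> i mod 29) = ?ks ! nat (i mod 29)" for i
    proof -
      have e: "\<sigma> i mod 29 = j mod 29 \<longleftrightarrow> i mod 29 = k mod 29" if "\<sigma> k mod 29 = j mod 29" for j k
        using inj'[of i k] that by (metis mod_eq_dvd_iff)
      have ks: "?ks ! nat x = (if x = 0 then 1 else if x = 1 then 2 else 0)" if "0 \<le> x" "x < 29" for x
        using that by (auto simp: nth_Cons' nat_eq_iff)
      show ?thesis using e[of 0 0] e[of 1 1] fix0 by (simp add: ks)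
    qed
    then show ?thesis by (simp add: invariant_colouring_def)
  qed
  define ks where "ks = refine_colours (refine_colours (refine_colours (refine_colours ?ks)))"
  have ks: "invariant_colouring \<sigma> ks"
    unfolding ks_def by (intro invariant_refine_colours[OF inj' pres'] base)
  have "\<sigma> i mod 29 = i mod 29" for i
  proof -
    have "nat (\<sigma> i mod 29) = nat (i mod 29)"
      using ks refine_colours_discrete[folded ks_def]
      by (simp add: invariant_colouring_def) (metis nth_eq_iff_index_eq nat_less_iff pos_mod_bound pos_mod_sign of_nat_numeral zero_less_numeral)
    then show ?thesis by (simp add: eq_nat_nat_iff)
  qed
  then have si: "29 dvd \<sigma> i - i" for i by (simp add: mod_eq_dvd_iff)
  have "29 dvd \<pi> i - (s * i + \<pi> 0)" for i
  proof -
    have "29 dvd 1 - s * t" using st by (metis dvd_minus_mod dvd_diff_commute)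
    then have "29 dvd (1 - s * t) * (\<pi> i - \<pi> 0)" by simp
    moreover have "29 dvd s * (\<sigma> i - i)" using si by simp
    ultimately have "29 dvd (1 - s * t) * (\<pi> i - \<pi> 0) + s * (\<sigma> i - i)" by (rule dvd_add)
    then show ?thesis by (simp add: \<sigma>_def algebra_simps)
  qed
  then show "\<exists>a b. \<forall>i. int 29 dvd \<pi> i - (a * i + b)" by auto
qed

section \<open>Alternating groups of prime degree\<close>

text \<open>Permutations act on the points 1, ..., p, but cycles and displacements are computed with
  residues starting at 0; hence the successor.\<close>

definition pt :: "nat \<Rightarrow> int \<Rightarrow> nat" where "pt p i = Suc (nat (i mod int p))"

lemma pt_eq_iff: "p > 0 \<Longrightarrow> pt p i = pt p j \<longleftrightarrow> int p dvd i - j"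
  by (simp add: pt_def eq_nat_nat_iff mod_eq_dvd_iff)

lemma range_pt:
  assumes "p > 0"
  shows "range (pt p) = {1..p}"
proof (intro equalityI subsetI)
  fix x assume "x \<in> {1..p}"
  then have "x = pt p (int x - 1)" using assms by (auto simp: pt_def)
  then show "x \<in> range (pt p)" by blast
qed (use assms in \<open>auto simp: pt_def nat_less_iff Suc_le_eq\<close>)

lemma cycle_of_list_nth:
  assumes "distinct cs" "i < length cs"
  shows "cycle_of_list cs (cs ! i) = cs ! (Suc i mod length cs)"
proof -
  have "map (cycle_of_list cs) cs = rotate1 cs" using cyclic_rotation[OF assms(1), of 1] by simp
  then have "cycle_of_list cs (cs ! i) = rotate1 cs ! i" using assms(2) by (metis nth_map)
  then show ?thesis using assms(2) by (simp add: nth_rotate1)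
qed

lemma evenperm_cycle_of_list:
  assumes "distinct cs" "cs \<noteq> []"
  shows "evenperm (cycle_of_list cs) \<longleftrightarrow> odd (length cs)"
  using assms
proof (induction cs rule: cycle_of_list.induct)
  case (1 i j cs)
  have "evenperm (cycle_of_list (i # j # cs)) \<longleftrightarrow>
      (evenperm (transpose i j) \<longleftrightarrow> evenperm (cycle_of_list (j # cs)))"
    unfolding cycle_of_list.simps by (rule evenperm_comp[OF permutation_swap_id permutation_of_cycle])
  also have "\<dots> \<longleftrightarrow> odd (length (i # j # cs))" using 1 by (simp add: evenperm_swap)
  finally show ?case .
qed auto

abbreviation full_cycle :: "nat \<Rightarrow> nat \<Rightarrow> nat" where
  "full_cycle p \<equiv> cycle_of_list [1..<Suc p]"

lemma full_cycle_pt: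
  assumes "p > 0"
  shows "full_cycle p (pt p i) = pt p (i + 1)"
proof -
  let ?n = "nat (i mod int p)"
  have n: "?n < p" using assms by (simp add: nat_less_iff)
  have nth: "[1..<Suc p] ! k = Suc k" if "k < p" for k using that by (simp add: nth_upt del: upt_Suc)
  have "full_cycle p ([1..<Suc p] ! ?n) = [1..<Suc p] ! (Suc ?n mod p)"
    using cycle_of_list_nth[of "[1..<Suc p]" ?n] n by (simp del: upt_Suc)
  moreover have "Suc ?n mod p = nat ((i + 1) mod int p)"
  proof -
    have "int (Suc ?n mod p) = (i mod int p + 1) mod int p"
      using assms by (simp add: of_nat_mod add.commute)
    then show ?thesis by (simp add: mod_add_left_eq nat_eq_iff)
  qed
  ultimately show ?thesis using nth n assms by (simp add: pt_def nat_less_iff del: upt_Suc)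
qed

lemma permutes_ext_pt:
  assumes "p > 0" "f permutes {1..p}" "f' permutes {1..p}" "\<And>i. f (pt p i) = f' (pt p i)"
  shows "f = f'"
proof
  fix x
  show "f x = f' x"
  proof (cases "x \<in> {1..p}")
    case True
    then obtain i where "x = pt p i" using range_pt[OF assms(1)] by blast
    then show ?thesis using assms(4) by simp
  next
    case False
    then show ?thesis using assms(2,3) by (simp add: permutes_not_in)
  qed
qed

text \<open>Common frame for \<open>alt_group p\<close> and \<open>M23\<close>. The function
  \<open>\<gamma>\<close> lifts the involution to residues, so that relations between g and powers
  of h become congruences; \<open>core\<close> is core-freeness of the cyclic subgroup in this
  form.\<close>

locale permutation_group_with_cycle = group T for T :: "(nat \<Rightarrow> nat) monoid" (structure) +
  fixes p :: nat and h g :: "nat \<Rightarrow> nat" and \<gamma> :: "int \<Rightarrow> int"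
  assumes p_prime: "Factorial_Ring.prime p"
    and T_permutes: "\<And>f. f \<in> carrier T \<Longrightarrow> f permutes {1..p}"
    and T_mult: "mult T = (\<circ>)" and T_one: "\<one> = id"
    and h_in: "h \<in> carrier T" and h_pt: "\<And>i. h (pt p i) = pt p (i + 1)"
    and g_in: "g \<in> carrier T" and g_pt: "\<And>i. g (pt p i) = pt p (\<gamma> i)"
    and g_invol: "g \<circ> g = id"
    and core: "\<And>i j. (\<And>x. int p dvd \<gamma> (\<gamma> x + i) - (x + j)) \<Longrightarrow> int p dvd i"
    and gen: "carrier T = generate T {g, h}"
begin

lemma p_pos: "p > 0" using p_prime prime_gt_0_nat by blast

lemmas ext_pt = permutes_ext_pt[OF p_pos]

lemma h_pow_pt: "(h [^] (k :: int)) (pt p i) = pt p (i + k)"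
proof -
  have nat_pow: "(h [^] n) (pt p i) = pt p (i + int n)" for n :: nat and i
  proof (induction n arbitrary: i)
    case 0
    then show ?case by (simp add: T_one)
  next
    case (Suc n)
    have "h [^] Suc n = h [^] n \<circ> h" by (simp add: T_mult)
    then show ?case using Suc by (simp add: h_pt ac_simps)
  qed
  show ?thesis
  proof (cases k rule: int_cases2)
    case (nonneg n)
    then show ?thesis using nat_pow[of n i] by (simp add: int_pow_int)
  next
    case (nonpos n)
    have "h [^] k = inv (h [^] n)" using h_in by (simp add: nonpos int_pow_neg_int)
    then have "h [^] k \<circ> h [^] n = id" using h_in l_inv[of "h [^] n"] by (simp add: T_mult T_one)
    then have "(h [^] k) ((h [^] n) (pt p (i + k))) = pt p (i + k)" by (metis comp_apply id_apply)
    then show ?thesis by (simp add: nat_pow nonpos)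
  qed
qed

lemma h_pow_permutes: "h [^] (k :: int) permutes {1..p}"
  using T_permutes h_in by simp

sublocale rotary_group T g h p
proof
  show "Factorial_Ring.prime p" by (rule p_prime)
  show "finite (carrier T)"
    using finite_subset[of "carrier T" "{f. f permutes {1..p}}"] T_permutes finite_permutations by blast
  show "g \<in> carrier T" "h \<in> carrier T" by (fact g_in h_in)+
  show "g \<otimes> g = \<one>" by (simp add: T_mult T_one g_invol)
  fix i :: int
  show "h [^] i = \<one> \<longleftrightarrow> int p dvd i"
  proof
    assume "h [^] i = \<one>"
    then have "pt p (0 + i) = pt p 0" using h_pow_pt[of i 0] by (simp add: T_one)
    then show "int p dvd i" using p_pos by (simp add: pt_eq_iff)
  next
    assume "int p dvd i"
    then show "h [^] i = \<one>"
      using p_pos by (intro ext_pt[OF h_pow_permutes T_permutes[OF one_closed]])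
        (simp add: T_one h_pow_pt pt_eq_iff)
  qed
  fix j :: int
  assume eq: "g \<otimes> h [^] i \<otimes> g = h [^] j"
  have "(g \<circ> h [^] i \<circ> g) (pt p x) = (h [^] j) (pt p x)" for x using eq by (simp add: T_mult)
  then have "int p dvd \<gamma> (\<gamma> x + i) - (x + j)" for x using p_pos by (simp add: g_pt h_pow_pt pt_eq_iff)
  then show "int p dvd i" by (rule core)
qed (rule gen)

lemma pow_pt: "pow k (pt p i) = pt p (i + k)" by (simp add: pow_def h_pow_pt)

lemma four_cycle_iff:
  "four_cycle d \<longleftrightarrow> (\<exists>k m n. \<not> int p dvd k \<and>
     (\<forall>x. int p dvd \<gamma> (\<gamma> x + k) + d - \<gamma> (\<gamma> (x + n) + m)))"
proof -
  have "pow d \<otimes> g \<otimes> pow k \<otimes> g = g \<otimes> pow m \<otimes> g \<otimes> pow n \<longleftrightarrow>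
     (\<forall>x. int p dvd \<gamma> (\<gamma> x + k) + d - \<gamma> (\<gamma> (x + n) + m))" (is "?l = ?r \<longleftrightarrow> _") for k m n
  proof -
    have lr: "?l permutes {1..p}" "?r permutes {1..p}" by (rule T_permutes, simp)+
    have "?l = ?r \<longleftrightarrow> (\<forall>x. ?l (pt p x) = ?r (pt p x))" using ext_pt[OF lr] by auto
    then show ?thesis using p_pos by (simp add: T_mult pow_pt g_pt pt_eq_iff)
  qed
  then show ?thesis unfolding four_cycle_def by simp
qed

text \<open>The cycle h acts regularly on the points, so a point stabilizer is a complement of the
  subgroup it generates: a power of h corrects any t to fix p, and no nontrivial power fixes a
  point.\<close>

proposition ex_cayley_graph_of_stabilizer:
  fixes G :: "('g, 'm) monoid_scheme"
  assumes "group G" and iso: "G \<cong> T\<lparr>carrier := {t \<in> carrier T. t p = p}\<rparr>"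
    and rigid: "difference_rigid p four_cycle"
  shows "\<exists>\<Gamma> :: 'g pair_pre_digraph.
           pair_graph \<Gamma> \<and> Digraph_Component.connected (with_proj \<Gamma>) \<and>
           (\<forall>v \<in> pverts \<Gamma>. out_degree (with_proj \<Gamma>) v = p) \<and>
           arc_transitive \<Gamma> \<and> is_cayley_graph_of \<Gamma> G \<and>
           (\<exists>v \<in> pverts \<Gamma>. solvable (point_stabilizer (graph_aut \<Gamma>) v))"
proof -
  let ?S = "{t \<in> carrier T. t p = p}"
  obtain \<phi> where phi: "\<phi> \<in> iso G (T\<lparr>carrier := ?S\<rparr>)" using iso by (auto simp: is_iso_def)
  \<comment> \<open>Residue 0 is the point 1, so the last point has residue -1; this explains the
    exponent j + 1 below.\<close>
  have last: "p = pt p (-1)" using p_pos by (simp add: pt_def zmod_minus1)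
  have inv_p: "(inv t) x = y" if "t \<in> carrier T" "t y = x" for t x y
  proof -
    have "inv t \<circ> t = id" using l_inv[OF that(1)] by (simp add: T_mult T_one)
    then show ?thesis using that(2) by (metis comp_apply id_apply)
  qed
  show ?thesis
  proof (rule ex_cayley_graph[OF \<open>group G\<close> phi _ _ _ rigid])
    show "subgroup ?S T"
    proof (rule subgroupI)
      have "id \<in> ?S" using one_closed by (simp add: T_one)
      then show "?S \<noteq> {}" by blast
      fix a assume "a \<in> ?S"
      then show "inv a \<in> ?S" using inv_p by auto
      fix b assume "b \<in> ?S"
      then show "a \<otimes> b \<in> ?S" using \<open>a \<in> ?S\<close> m_closed[of a b] by (simp add: T_mult)
    qed auto
    fix t assume t: "t \<in> carrier T"
    have "inv t permutes {1..p}" using t by (intro T_permutes) simp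
    then have "(inv t) p \<in> {1..p}" using permutes_in_image[of "inv t" "{1..p}" p] p_pos by auto
    then have "(inv t) p \<in> range (pt p)" using range_pt[OF p_pos] by blast
    then obtain j where j: "(inv t) p = pt p j" by blast
    define x where "x = t \<otimes> pow (j + 1)"
    have "t \<circ> inv t = id" using r_inv[OF t] by (simp add: T_mult T_one)
    then have "t ((inv t) p) = p" by (metis comp_apply id_apply)
    then have "x p = p" using j by (subst (asm) j, subst last, simp add: x_def T_mult pow_pt)
    moreover have "t = x \<otimes> pow (- (j + 1))" using t by (simp add: x_def m_assoc pow_add)
    moreover have "x \<in> carrier T" using t by (simp add: x_def)
    ultimately show "\<exists>x \<in> ?S. \<exists>i. t = x \<otimes> pow i" by blast
  next
    fix i assume "pow i \<in> ?S"
    then have "pow i (pt p (-1)) = pt p (-1)" using last by simp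
    then have "int p dvd i" using p_pos by (simp add: pow_pt pt_eq_iff)
    then show "pow i = \<one>" by (simp add: pow_def h_pow_one)
  qed
qed

end

section \<open>Even permutations and 3-cycles of consecutive points\<close>

lemma transpose_commute_disjoint:
  assumes "{a, b} \<inter> {c, d} = {}"
  shows "transpose a b \<circ> transpose c d = transpose c d \<circ> transpose a b"
  using assms by (auto simp: fun_eq_iff transpose_def)

text \<open>The square of a 3-cycle is its inverse.\<close>

lemma transpose_braid:
  assumes "a \<noteq> b" "b \<noteq> c" "a \<noteq> c"
  shows "transpose a b \<circ> transpose b c \<circ> (transpose a b \<circ> transpose b c) = transpose b c \<circ> transpose a b"
  using assms by (auto simp: fun_eq_iff transpose_def)

text \<open>An even permutation is reduced to one with smaller support by moving the image of the largest
  point upwards with consecutive 3-cycles.\<close>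

lemma even_permutation_in_3cycle_closed_set:
  fixes K :: "(nat \<Rightarrow> nat) set"
  defines "c \<equiv> \<lambda>j. transpose j (Suc j) \<circ> transpose (Suc j) (Suc (Suc j))"
  assumes "id \<in> K"
    and cancel: "\<And>j f. 1 \<le> j \<Longrightarrow> j + 2 \<le> n \<Longrightarrow> c j \<circ> f \<in> K \<Longrightarrow> f \<in> K"
    and f: "f permutes {1..m}" "evenperm f" "m \<le> n"
  shows "f \<in> K"
  using f
proof (induction m arbitrary: f)
  case 0
  then have "f = id" by simp
  then show ?case using \<open>id \<in> K\<close> by (simp only:)
next
  case (Suc m)
  have c_permutes: "c j permutes {1..Suc m}" if "1 \<le> j" "j + 2 \<le> Suc m" for j
    unfolding c_def using that by (intro permutes_compose permutes_swap_id) auto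
  have c_even: "evenperm (c j)" for j
    unfolding c_def by (simp add: evenperm_comp permutation_swap_id evenperm_swap)
  have c_up: "c j j = Suc j" "c j (Suc j) = Suc (Suc j)" for j by (auto simp: c_def transpose_def)
  from Suc.prems(1,2) show ?case
  proof (induction "Suc m - f (Suc m)" arbitrary: f rule: less_induct)
    case less
    have img: "f (Suc m) \<in> {1..Suc m}" using permutes_in_image[OF less.prems(1), of "Suc m"] by auto
    have step: "f \<in> K" if j: "1 \<le> j" "j + 2 \<le> Suc m" and up: "c j (f (Suc m)) = Suc (f (Suc m))"
        and lt: "f (Suc m) < Suc m" for j
    proof -
      have "c j \<circ> f \<in> K"
      proof (rule less.hyps)
        show "Suc m - (c j \<circ> f) (Suc m) < Suc m - f (Suc m)" using up lt by simp
        show "c j \<circ> f permutes {1..Suc m}" using c_permutes[OF j] less.prems(1) by (rule permutes_compose[rotated])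
        have "permutation (c j)" "permutation f"
          using c_permutes[OF j] less.prems(1) permutation_permutes by blast+
        then show "evenperm (c j \<circ> f)" using less.prems(2) c_even by (simp add: evenperm_comp)
      qed
      then show ?thesis using cancel j Suc.prems(3) by auto
    qed
    consider "f (Suc m) = Suc m" | "f (Suc m) + 1 \<le> m" | "f (Suc m) = m" "m \<ge> 2" | "f (Suc m) = m" "m = 1"
      using img by fastforce
    then show ?case
    proof cases
      case 1
      then have "f permutes {1..m}"
        using less.prems(1) permutes_superset[of f "{1..Suc m}" "{1..m}"] by (auto simp: le_Suc_eq)
      then show ?thesis using Suc.IH less.prems(2) Suc.prems(3) by simp
    next
      case 2
      then show ?thesis using step[of "f (Suc m)"] img c_up by auto
    next
      case 3
      \<comment> \<open>The 3-cycle starting at m would involve m + 2 and leave the range. The one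
        starting at m - 1 moves its middle point m to m + 1.\<close>
      then obtain k where "m = Suc k" by (cases m) auto
      then show ?thesis using step[of k] 3 c_up by auto
    next
      case 4
      \<comment> \<open>What remains is the transposition of 1 and 2, which is odd.\<close>
      then have fp: "f permutes {1, 2}" and f2: "f 2 = 1"
        using less.prems(1) by (simp_all add: numeral_2_eq_2 atLeastAtMost_insertL[symmetric])
      have "f 1 \<in> {1, 2}" using permutes_in_image[OF fp, of 1] by simp
      moreover have "f 1 \<noteq> f 2" using permutes_inj[OF fp] by (simp add: inj_eq)
      ultimately have f1: "f 1 = 2" using f2 by auto
      have "f = transpose 1 2"
      proof
        fix x show "f x = transpose 1 2 x"
          using f1 f2 permutes_not_in[OF fp, of x] by (cases "x \<in> {1, 2}") (auto simp: transpose_def)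
      qed
      then show ?thesis using less.prems(2) by (simp add: evenperm_swap)
    qed
  qed
qed

section \<open>The alternating group of degree p with its p-cycle and a double transposition\<close>

locale alternating_rotation =
  fixes p :: nat
  assumes prime_p: "Factorial_Ring.prime p" and p11: "p \<ge> 11"
begin

lemma p_pos: "p > 0" using p11 by simp

lemma small: "\<not> int p dvd d" if "d \<noteq> 0" "\<bar>d\<bar> < 11" for d
  using that p11 dvd_imp_le_int[of d "int p"] by auto

lemma small_zero: "int p dvd d \<Longrightarrow> \<bar>d\<bar> < 11 \<Longrightarrow> d = 0" using small by blast

lemma nd: "\<not> int p dvd 2" "\<not> int p dvd 3" "\<not> int p dvd 4" "\<not> int p dvd 5" "\<not> int p dvd 6" "p \<noteq> Suc 0"
  using p11 by (simp_all add: small)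

definition h :: "nat \<Rightarrow> nat" where "h = full_cycle p"

definition A :: "int \<Rightarrow> nat \<Rightarrow> nat" where "A i = transpose (pt p i) (pt p (i + 1))"

definition g :: "nat \<Rightarrow> nat" where "g = A 0 \<circ> A 2"

text \<open>The displacement of a residue under g. Being at most 1 in absolute value, a few
  displacements sum to less than 11 \<le> p, so congruences between them turn into equations by
  \<open>small_zero\<close>.\<close>

definition \<delta> :: "int \<Rightarrow> int" where
  "\<delta> i = (if int p dvd i \<or> int p dvd i - 2 then 1 else if int p dvd i - 1 \<or> int p dvd i - 3 then -1 else 0)"

lemma h_pt: "h (pt p i) = pt p (i + 1)" unfolding h_def using p_pos by (rule full_cycle_pt)

lemma pt_eq: "pt p i = pt p j \<longleftrightarrow> int p dvd i - j" using p_pos by (rule pt_eq_iff)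

lemma g_pt: "g (pt p i) = pt p (i + \<delta> i)"
proof -
  have excl: "\<not> int p dvd i - b" if "int p dvd i - a" "a \<noteq> b" "\<bar>b - a\<bar> < 11" for a b
  proof
    assume "int p dvd i - b"
    from dvd_diff[OF that(1) this] have "int p dvd b - a" by simp
    then show False using small[of "b - a"] that by simp
  qed
  have g_val: "g (pt p 0) = pt p 1" "g (pt p 1) = pt p 0" "g (pt p 2) = pt p 3" "g (pt p 3) = pt p 2"
    by (simp_all add: g_def A_def transpose_def pt_eq nd)
  consider "int p dvd i - 0" | "int p dvd i - 1" | "int p dvd i - 2" | "int p dvd i - 3"
    | "\<not> int p dvd i - 0" "\<not> int p dvd i - 1" "\<not> int p dvd i - 2" "\<not> int p dvd i - 3" by blast
  then show ?thesis
  proof cases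
    case 1
    then have "pt p i = pt p 0" "pt p (i + 1) = pt p 1" by (simp_all add: pt_eq)
    moreover have "\<delta> i = 1" using 1 by (simp add: \<delta>_def)
    ultimately show ?thesis using g_val by metis
  next
    case 2
    then have "pt p i = pt p 1" "pt p (i + - 1) = pt p 0" by (simp_all add: pt_eq)
    moreover have "\<delta> i = -1" using 2 excl[of 1 0] excl[of 1 2] by (simp add: \<delta>_def)
    ultimately show ?thesis using g_val by metis
  next
    case 3
    then have "pt p i = pt p 2" "pt p (i + 1) = pt p 3" by (simp_all add: pt_eq)
    moreover have "\<delta> i = 1" using 3 by (simp add: \<delta>_def)
    ultimately show ?thesis using g_val by metis
  next
    case 4
    then have "pt p i = pt p 3" "pt p (i + - 1) = pt p 2" by (simp_all add: pt_eq)
    moreover have "\<delta> i = -1" using 4 excl[of 3 0] excl[of 3 2] by (simp add: \<delta>_def)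
    ultimately show ?thesis using g_val by metis
  next
    case 5
    then have "\<delta> i = 0" by (simp add: \<delta>_def)
    moreover have "pt p i \<noteq> pt p 0" "pt p i \<noteq> pt p 1" "pt p i \<noteq> pt p 2" "pt p i \<noteq> pt p 3"
      using 5 by (simp_all add: pt_eq)
    ultimately show ?thesis by (simp add: g_def A_def transpose_def)
  qed
qed

lemma delta_range: "\<bar>\<delta> i\<bar> \<le> 1" by (simp add: \<delta>_def)

lemma delta_pos: "\<delta> i = 1 \<Longrightarrow> int p dvd i \<or> int p dvd i - 2" by (auto simp: \<delta>_def split: if_splits)

lemma delta_neg: "\<delta> i = -1 \<Longrightarrow> int p dvd i - 1 \<or> int p dvd i - 3" by (auto simp: \<delta>_def split: if_splits)

lemma delta_values: "\<delta> 0 = 1" "\<delta> 1 = -1" "\<delta> 2 = 1" "\<delta> 3 = -1" "\<delta> 4 = 0" "\<delta> (-1) = 0"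
  using small[of 1] small[of "-1"] small[of 2] small[of "-2"] small[of 3] small[of "-3"] small[of 4] small[of "-4"]
  by (simp_all add: \<delta>_def)

text \<open>Of the residues 0, 2 moved up and 1, 3 moved down, only 0 and 3 are three apart.\<close>

lemma delta_up_down:
  assumes "\<delta> i = 1" "\<delta> (i + 3) = -1"
  shows "int p dvd i"
proof (rule ccontr)
  assume "\<not> int p dvd i"
  then have "int p dvd i - 2" "int p dvd (i + 3) - 1"
    using delta_pos[OF assms(1)] delta_neg[OF assms(2)] by auto
  from dvd_diff[OF this(2,1)] have "int p dvd 4" by simp
  then show False using small[of 4] by simp
qed

text \<open>g swaps 0 with 1 and 2 with 3, whereas a power of h preserves differences. If g h^i g =
  h^j, then the displacements at i and i + 3 must be the extreme ones, 1 and -1.\<close>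

lemma core:
  assumes "\<And>x. int p dvd (x + \<delta> x + i + \<delta> (x + \<delta> x + i)) - (x + j)"
  shows "int p dvd i"
proof -
  have "int p dvd 1 + i + \<delta> (1 + i) - j" "int p dvd i + \<delta> i - (1 + j)"
    "int p dvd 3 + i + \<delta> (3 + i) - (2 + j)" "int p dvd 2 + i + \<delta> (2 + i) - (3 + j)"
    using assms[of 0] assms[of 1] assms[of 2] assms[of 3] by (simp_all add: delta_values)
  note d = this
  from dvd_diff[OF d(1,2)] dvd_diff[OF d(3,4)]
  have E: "int p dvd 2 + \<delta> (1 + i) - \<delta> i" "int p dvd 2 + \<delta> (3 + i) - \<delta> (2 + i)"
    by (simp_all add: algebra_simps)
  note r = delta_range[of "1 + i"] delta_range[of i] delta_range[of "3 + i"] delta_range[of "2 + i"]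
  have "2 + \<delta> (1 + i) - \<delta> i = 0" by (rule small_zero[OF E(1)]) (use r in linarith)
  moreover have "2 + \<delta> (3 + i) - \<delta> (2 + i) = 0" by (rule small_zero[OF E(2)]) (use r in linarith)
  ultimately have "\<delta> i = 1" "\<delta> (3 + i) = -1" using r by linarith+
  then show ?thesis using delta_up_down[of i] by (simp add: add.commute)
qed

lemma A_commute:
  assumes "\<not> int p dvd i - j - 1" "\<not> int p dvd i - j + 1"
  shows "A i \<circ> A j = A j \<circ> A i"
proof (cases "int p dvd i - j")
  case True
  then have "pt p i = pt p j" "pt p (i + 1) = pt p (j + 1)" by (simp_all add: pt_eq)
  then have "A i = A j" by (simp add: A_def)
  then show ?thesis by simp
next
  case False
  have "pt p i \<noteq> pt p j" "pt p i \<noteq> pt p (j + 1)" "pt p (i + 1) \<noteq> pt p j" "pt p (i + 1) \<noteq> pt p (j + 1)"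
    using False assms by (simp_all add: pt_eq algebra_simps)
  then show ?thesis unfolding A_def by (intro transpose_commute_disjoint) auto
qed

lemma A_invol: "A i \<circ> A i = id" by (simp add: A_def)

lemma A_permutes: "A i permutes {1..p}"
  unfolding A_def using range_pt[OF p_pos] by (intro permutes_swap_id) auto

lemma pt_neq_Suc: "pt p i \<noteq> pt p (i + 1)" using small[of "-1"] by (simp add: pt_eq)

lemma A_even2: "evenperm (A i \<circ> A j)"
  unfolding A_def using pt_neq_Suc
  by (simp add: evenperm_comp permutation_swap_id evenperm_swap)

lemma h_alt: "h \<in> carrier (alt_group p)"
proof -
  have "odd p" using prime_p p11 prime_odd_nat[of p] by simp
  then have "evenperm h" unfolding h_def
    using evenperm_cycle_of_list[of "[1..<Suc p]"] p_pos by (simp del: upt_Suc)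
  moreover have "h permutes {1..p}"
    unfolding h_def using cycle_permutes[of "[1..<Suc p]"] by (simp add: atLeastLessThanSuc_atLeastAtMost del: upt_Suc)
  ultimately show ?thesis by (simp add: alt_group_carrier)
qed

lemma g_alt: "g \<in> carrier (alt_group p)"
  unfolding g_def using A_even2 A_permutes by (simp add: alt_group_carrier permutes_compose)

lemma g_invol: "g \<circ> g = id"
proof -
  have c: "A 0 \<circ> A 2 = A 2 \<circ> A 0" by (rule A_commute; simp add: nd)
  have "g \<circ> g = A 0 \<circ> (A 2 \<circ> A 2) \<circ> A 0" unfolding g_def by (metis c comp_assoc)
  then show ?thesis by (simp add: A_invol)
qed

lemma h_A: "h \<circ> A i = A (i + 1) \<circ> h"
proof -
  have "bij h" using h_alt permutes_bij alt_group_carrier by blast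
  then have "h \<circ> transpose (pt p i) (pt p (i + 1)) = transpose (h (pt p i)) (h (pt p (i + 1))) \<circ> h"
    by (auto simp: fun_eq_iff transpose_def bij_def inj_eq)
  then show ?thesis by (simp add: A_def h_pt)
qed

sublocale grp: group "alt_group p" by (rule alt_group_is_group)

text \<open>The product of g and its conjugate under h^3 is A 0 A 2 A 3 A 5. Squaring cancels A 0
  and A 5, which commute with all factors, and leaves the square of A 2 A 3, a 3-cycle of
  consecutive points. Its conjugates under h are all the consecutive 3-cycles.\<close>

lemma generates: "carrier (alt_group p) = generate (alt_group p) {g, h}"
proof -
  define K where "K = generate (alt_group p) {g, h}"
  have gh: "{g, h} \<subseteq> carrier (alt_group p)" using g_alt h_alt by simp
  have K: "subgroup K (alt_group p)" unfolding K_def by (rule grp.generate_is_subgroup[OF gh])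
  have K_sub: "K \<subseteq> carrier (alt_group p)" using K subgroup.subset by blast
  have K_comp: "x \<circ> y \<in> K" if "x \<in> K" "y \<in> K" for x y
    using subgroup.m_closed[OF K that] by (simp add: alt_group_mult)
  have K_inv: "\<exists>y \<in> K. y \<circ> x = id \<and> x \<circ> y = id" if "x \<in> K" for x
    using subgroup.m_inv_closed[OF K that] grp.l_inv[of x] grp.r_inv[of x] that K_sub
    by (metis alt_group_mult alt_group_one subsetD)
  have gK: "g \<in> K" and hK: "h \<in> K" unfolding K_def by (auto intro: generate.incl)
  have conj: "A (i + 1) \<circ> A (j + 1) \<in> K" if "A i \<circ> A j \<in> K" for i j
  proof -
    obtain h' where h': "h' \<in> K" "h \<circ> h' = id" using K_inv[OF hK] by blast
    have "h \<circ> (A i \<circ> A j) \<circ> h' = A (i + 1) \<circ> A (j + 1) \<circ> (h \<circ> h')"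
      by (metis h_A comp_assoc)
    then show ?thesis using K_comp[OF K_comp[OF hK that] h'(1)] h'(2) by simp
  qed
  have "A 0 \<circ> A 2 \<in> K" using gK by (simp add: g_def)
  from conj[OF conj[OF conj[OF this]]] have "A 3 \<circ> A 5 \<in> K" by simp
  then have X: "A 0 \<circ> A 2 \<circ> (A 3 \<circ> A 5) \<in> K" using K_comp gK by (simp add: g_def)
  have c: "A 0 \<circ> A 2 = A 2 \<circ> A 0" "A 0 \<circ> A 3 = A 3 \<circ> A 0" "A 0 \<circ> A 5 = A 5 \<circ> A 0"
    "A 5 \<circ> A 2 = A 2 \<circ> A 5" "A 5 \<circ> A 3 = A 3 \<circ> A 5"
    by (rule A_commute; simp add: nd)+
  have c': "A 0 (A 2 x) = A 2 (A 0 x)" "A 0 (A 3 x) = A 3 (A 0 x)" "A 0 (A 5 x) = A 5 (A 0 x)"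
    "A 5 (A 2 x) = A 2 (A 5 x)" "A 5 (A 3 x) = A 3 (A 5 x)" for x
    using c by (metis comp_apply)+
  have i': "A i (A i x) = x" for i x using A_invol by (metis comp_apply id_apply)
  have "A 0 \<circ> A 2 \<circ> (A 3 \<circ> A 5) \<circ> (A 0 \<circ> A 2 \<circ> (A 3 \<circ> A 5)) = A 2 \<circ> A 3 \<circ> (A 2 \<circ> A 3)"
    by (rule ext) (simp add: c' i')
  also have "\<dots> = A 3 \<circ> A 2"
  proof -
    have "pt p 2 \<noteq> pt p 3" "pt p 3 \<noteq> pt p 4" "pt p 2 \<noteq> pt p 4"
      using small[of "-1"] small[of "-2"] by (simp_all add: pt_eq)
    then show ?thesis using transpose_braid[of "pt p 2" "pt p 3" "pt p 4"] by (simp add: A_def)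
  qed
  finally have "A 3 \<circ> A 2 \<in> K" using K_comp[OF X X] by simp
  note c32_base = this
  have c32: "A (3 + int n) \<circ> A (2 + int n) \<in> K" for n
  proof (induction n)
    case 0
    show ?case using c32_base by (simp only: of_nat_0 add_0_right)
  next
    case (Suc n)
    have e: "3 + int (Suc n) = 3 + int n + 1" "2 + int (Suc n) = 2 + int n + 1" by simp_all
    show ?case unfolding e by (rule conj[OF Suc])
  qed
  have c_all: "A (i + 1) \<circ> A i \<in> K" for i
  proof -
    define n where "n = nat ((i - 2) mod int p)"
    have n: "int n = (i - 2) mod int p" using p_pos by (simp add: n_def)
    have "int p dvd (i - 2) - int n" unfolding n by (rule dvd_minus_mod)
    then have d: "int p dvd - ((i - 2) - int n)" by (simp only: dvd_minus_iff)
    have "pt p (2 + int n) = pt p i" "pt p (2 + int n + 1) = pt p (i + 1)"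
      "pt p (3 + int n) = pt p (i + 1)" "pt p (3 + int n + 1) = pt p (i + 1 + 1)"
      using d by (simp_all add: pt_eq algebra_simps)
    then have "A (2 + int n) = A i" "A (3 + int n) = A (i + 1)" by (simp_all only: A_def)
    then show ?thesis using c32[of n] by (simp only:)
  qed
  have "f \<in> K" if f: "f \<in> carrier (alt_group p)" for f
  proof (rule even_permutation_in_3cycle_closed_set[of K p f p])
    show "id \<in> K" using subgroup.one_closed[OF K] by (simp add: alt_group_one)
    fix j f assume j: "1 \<le> j" "j + 2 \<le> p"
      and cf: "transpose j (Suc j) \<circ> transpose (Suc j) (Suc (Suc j)) \<circ> f \<in> K"
    define i where "i = int j - 1"
    have "pt p i = j" "pt p (i + 1) = Suc j" "pt p (i + 1 + 1) = Suc (Suc j)"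
      using j by (simp_all add: pt_def i_def nat_add_distrib)
    then have cA: "transpose j (Suc j) \<circ> transpose (Suc j) (Suc (Suc j)) = A i \<circ> A (i + 1)" by (simp add: A_def)
    have "(A (i + 1) \<circ> A i) \<circ> (A i \<circ> A (i + 1) \<circ> f) = f" by (rule ext) (simp add: i')
    then show "f \<in> K" using K_comp[OF c_all cf[unfolded cA]] by metis
  qed (use f in \<open>auto simp: alt_group_carrier\<close>)
  then show ?thesis using K_sub unfolding K_def by blast
qed

sublocale permutation_group_with_cycle "alt_group p" p h g "\<lambda>i. i + \<delta> i"
proof
  show "Factorial_Ring.prime p" by (rule prime_p)
  show "f permutes {1..p}" if "f \<in> carrier (alt_group p)" for f using that by (simp add: alt_group_carrier)
  show "mult (alt_group p) = (\<circ>)" "\<one>\<^bsub>alt_group p\<^esub> = id" by (rule alt_group_mult alt_group_one)+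
  show "h \<in> carrier (alt_group p)" "g \<in> carrier (alt_group p)" by (rule h_alt g_alt)+
  show "h (pt p i) = pt p (i + 1)" "g (pt p i) = pt p (i + \<delta> i)" for i by (rule h_pt g_pt)+
  show "g \<circ> g = id" by (rule g_invol)
  show "int p dvd i" if "\<And>x. int p dvd x + \<delta> x + i + \<delta> (x + \<delta> x + i) - (x + j)" for i j
    using that by (rule core)
  show "carrier (alt_group p) = generate (alt_group p) {g, h}" by (rule generates)
qed

text \<open>Both sides of the relation are inverted and applied at g x. For small x the values of g
  h^d g are explicit, and a single unknown displacement remains on each side; the original form has
  two on the right.\<close>

lemma reversed_relation:
  assumes "\<And>x. pow (- d) (g (pow k (g x))) = g (pow m (g (pow n x)))"
  shows "int p dvd x + \<delta> x + d + \<delta> (x + \<delta> x + d) - k + \<delta> (x + \<delta> x + d + \<delta> (x + \<delta> x + d) - k)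
      - (x - m + \<delta> (x - m) - n)"
proof -
  have gg: "g (g y) = y" for y using g_invol by (metis comp_apply id_apply)
  have pp: "pow i (pow j y) = pow (i + j) y" for i j y using pow_add[of i j] by (metis T_mult comp_apply)
  have p0: "pow 0 y = y" for y by (simp add: T_one)
  define y where "y = g (pow (- k) (g (pow d (g (pt p x)))))"
  have "pow (- d) (g (pow k (g y))) = g (pt p x)" by (simp add: y_def gg pp p0 T_one)
  then have "g (pt p x) = g (pow m (g (pow n y)))" using assms by simp
  then have "pt p x = pow m (g (pow n y))" by (metis gg)
  then have "g (pow (- m) (pt p x)) = pow n y" by (simp add: pp p0 gg T_one)
  then have "pow (- n) (g (pow (- m) (pt p x))) = y" by (simp add: pp p0 T_one)
  then have "pt p (x - m + \<delta> (x - m) - n) =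
      pt p (x + \<delta> x + d + \<delta> (x + \<delta> x + d) - k + \<delta> (x + \<delta> x + d + \<delta> (x + \<delta> x + d) - k))"
    by (simp add: y_def pow_pt g_pt)
  then show ?thesis by (metis pt_eq)
qed

text \<open>At 0 and 1 the element g h g takes the values 3 and 0. Eliminating n leaves 4 plus four
  signed displacements, of absolute value below 11, so the sum vanishes and every displacement is
  extreme; by \<open>delta_up_down\<close> this makes k a multiple of p.\<close>

lemma not_four_cycle_1: "\<not> four_cycle 1"
proof
  assume "four_cycle 1"
  then have "four_cycle (- 1)" by (simp only: four_cycle_minus)
  then obtain k m n where k: "\<not> int p dvd k" and rel: "\<And>x. pow (- 1) (g (pow k (g x))) = g (pow m (g (pow n x)))"
    unfolding four_cycle_def by (metis T_mult comp_apply)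
  have rel': "int p dvd x + \<delta> x + 1 + \<delta> (x + \<delta> x + 1) - k + \<delta> (x + \<delta> x + 1 + \<delta> (x + \<delta> x + 1) - k)
      - (x - m + \<delta> (x - m) - n)" for x
    using reversed_relation[OF rel, of x] by simp
  have "int p dvd (3 - k + \<delta> (3 - k)) - (- m + \<delta> (- m) - n)"
    "int p dvd (- k + \<delta> (- k)) - (1 - m + \<delta> (1 - m) - n)"
    using rel'[of 0] rel'[of 1] by (simp_all add: delta_values)
  from dvd_diff[OF this] have E: "int p dvd 4 + \<delta> (3 - k) - \<delta> (- k) - \<delta> (- m) + \<delta> (1 - m)"
    by (simp add: algebra_simps)
  note r = delta_range[of "3 - k"] delta_range[of "- k"] delta_range[of "- m"] delta_range[of "1 - m"]
  have "4 + \<delta> (3 - k) - \<delta> (- k) - \<delta> (- m) + \<delta> (1 - m) = 0"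
    by (rule small_zero[OF E]) (use r in linarith)
  then have "\<delta> (- k) = 1" "\<delta> (3 - k) = -1" using r by linarith+
  then show False using delta_up_down[of "- k"] k by simp
qed

text \<open>The same elimination at -1, 0 and 1, where g h^3 g takes the values 3, 4 and 2. Unless g
  moves 2 - k up, it must move both 3 - k and 4 - k down, but no two consecutive residues are moved
  down. If it moves 2 - k up, then k = 2, against the second equation.\<close>

lemma not_four_cycle_3: "\<not> four_cycle 3"
proof
  assume "four_cycle 3"
  then have "four_cycle (- 3)" by (simp only: four_cycle_minus)
  then obtain k m n where k: "\<not> int p dvd k" and rel: "\<And>x. pow (- 3) (g (pow k (g x))) = g (pow m (g (pow n x)))"
    unfolding four_cycle_def by (metis T_mult comp_apply)
  have rel': "int p dvd x + \<delta> x + 3 + \<delta> (x + \<delta> x + 3) - k + \<delta> (x + \<delta> x + 3 + \<delta> (x + \<delta> x + 3) - k)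
      - (x - m + \<delta> (x - m) - n)" for x
    using reversed_relation[OF rel, of x] by simp
  have "int p dvd (3 - k + \<delta> (3 - k)) - (-1 - m + \<delta> (-1 - m) - n)"
    "int p dvd (4 - k + \<delta> (4 - k)) - (- m + \<delta> (- m) - n)"
    "int p dvd (2 - k + \<delta> (2 - k)) - (1 - m + \<delta> (1 - m) - n)"
    using rel'[of "-1"] rel'[of 0] rel'[of 1] by (simp_all add: delta_values)
  note d = this
  from dvd_diff[OF d(1,3)] dvd_diff[OF d(2,3)]
  have E: "int p dvd 3 + \<delta> (3 - k) - \<delta> (2 - k) - \<delta> (-1 - m) + \<delta> (1 - m)"
    "int p dvd 3 + \<delta> (4 - k) - \<delta> (2 - k) - \<delta> (- m) + \<delta> (1 - m)"
    by (simp_all add: algebra_simps)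
  note r = delta_range[of "3 - k"] delta_range[of "2 - k"] delta_range[of "4 - k"]
    delta_range[of "- m"] delta_range[of "-1 - m"] delta_range[of "1 - m"]
  have eq: "3 + \<delta> (3 - k) - \<delta> (2 - k) - \<delta> (-1 - m) + \<delta> (1 - m) = 0"
    "3 + \<delta> (4 - k) - \<delta> (2 - k) - \<delta> (- m) + \<delta> (1 - m) = 0"
    by (rule small_zero[OF E(1)], use r in linarith) (rule small_zero[OF E(2)], use r in linarith)
  have two_neg: "\<not> (\<delta> (3 - k) = -1 \<and> \<delta> (4 - k) = -1)"
  proof
    assume "\<delta> (3 - k) = -1 \<and> \<delta> (4 - k) = -1"
    then have "int p dvd 2 - k \<or> int p dvd - k" "int p dvd 3 - k \<or> int p dvd 1 - k"
      using delta_neg[of "3 - k"] delta_neg[of "4 - k"] by auto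
    then have "int p dvd (3 - k) - (2 - k) \<or> int p dvd (1 - k) - (2 - k) \<or>
        int p dvd (3 - k) - (- k) \<or> int p dvd (1 - k) - (- k)"
      using dvd_diff by blast
    then show False using nd by simp
  qed
  show False
  proof (cases "\<delta> (2 - k) = 1")
    case True
    then have "int p dvd 2 - k" using delta_pos[OF True] k by auto
    then have "int p dvd (4 - k) - 2" by simp
    then have "\<delta> (4 - k) = 1" by (simp only: \<delta>_def) simp
    then show False using eq(2) True r by linarith
  next
    case False
    then have "\<delta> (2 - k) \<le> 0" using r by linarith
    then have "\<delta> (3 - k) = -1" "\<delta> (4 - k) = -1" using eq r by linarith+
    then show False using two_neg by blast
  qed
qed

lemma pow_A: "pow d (A i x) = A (i + d) (pow d x)"
proof -
  have "pow d permutes {1..p}" by (rule T_permutes) simp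
  then have "inj (pow d)" by (rule permutes_inj)
  then have "pow d (transpose a b x) = transpose (pow d a) (pow d b) (pow d x)" for a b
    by (auto simp: transpose_def inj_eq)
  then have "pow d (A i x) = transpose (pow d (pt p i)) (pow d (pt p (i + 1))) (pow d x)" by (simp only: A_def)
  moreover have "pow d (pt p i) = pt p (i + d)" "pow d (pt p (i + 1)) = pt p (i + d + 1)"
    by (simp_all add: pow_pt ac_simps)
  ultimately show ?thesis by (simp only: A_def)
qed

text \<open>The conjugate of g under h^d is A d A (2 + d), whose factors commute with A 0 and A 2.
  That it commutes with g is the relation for k = n = -d and m = d.\<close>

lemma four_cycle_if_commuting:
  assumes "\<not> int p dvd d" "\<not> int p dvd d - 1" "\<not> int p dvd d + 1" "\<not> int p dvd d - 3" "\<not> int p dvd d + 3"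
  shows "four_cycle d"
proof -
  have "A d \<circ> A 0 = A 0 \<circ> A d" "A d \<circ> A 2 = A 2 \<circ> A d"
    "A (2 + d) \<circ> A 0 = A 0 \<circ> A (2 + d)" "A (2 + d) \<circ> A 2 = A 2 \<circ> A (2 + d)"
    by (rule A_commute; use assms in \<open>simp add: algebra_simps\<close>)+
  then have c: "A d (A 0 x) = A 0 (A d x)" "A d (A 2 x) = A 2 (A d x)"
    "A (2 + d) (A 0 x) = A 0 (A (2 + d) x)" "A (2 + d) (A 2 x) = A 2 (A (2 + d) x)" for x
    by (metis comp_apply)+
  have inv: "pow d (pow (- d) x) = x" for x
    using pow_add[of d "- d"] by (simp add: T_mult T_one) (metis comp_apply id_apply)
  have "pow d \<otimes>\<^bsub>alt_group p\<^esub> g \<otimes>\<^bsub>alt_group p\<^esub> pow (- d) \<otimes>\<^bsub>alt_group p\<^esub> g =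
      g \<otimes>\<^bsub>alt_group p\<^esub> pow d \<otimes>\<^bsub>alt_group p\<^esub> g \<otimes>\<^bsub>alt_group p\<^esub> pow (- d)"
    unfolding T_mult by (rule ext) (simp add: g_def pow_A inv c)
  moreover have "\<not> int p dvd - d" using assms(1) by simp
  ultimately show ?thesis unfolding four_cycle_def by blast
qed

lemma rigid: "difference_rigid p four_cycle"
proof (rule difference_rigid_one_three[OF prime_p p11])
  fix d assume d: "\<not> int p dvd d"
  show "four_cycle d \<longleftrightarrow> \<not> (int p dvd d - 1 \<or> int p dvd d + 1 \<or> int p dvd d - 3 \<or> int p dvd d + 3)"
  proof
    assume "four_cycle d"
    then show "\<not> (int p dvd d - 1 \<or> int p dvd d + 1 \<or> int p dvd d - 3 \<or> int p dvd d + 3)"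
      using four_cycle_cong[of d 1] four_cycle_cong[of d 3] four_cycle_cong[of d "-1"] four_cycle_cong[of d "-3"]
        not_four_cycle_1 not_four_cycle_3 four_cycle_minus[of 1] four_cycle_minus[of 3] by auto
  qed (use d four_cycle_if_commuting in blast)
qed

text \<open>Equality, and not just isomorphism, holds because permutations are functions on all
  natural numbers that are the identity off their domain.\<close>

lemma alt_group_pred_eq_stabilizer:
  "alt_group (p - 1) = (alt_group p)\<lparr>carrier := {t \<in> carrier (alt_group p). t p = p}\<rparr>"
proof -
  have "t permutes {1..p} \<and> t p = p \<longleftrightarrow> t permutes {1..p - 1}" for t
  proof
    assume t: "t permutes {1..p} \<and> t p = p"
    have "x = p" if "x \<in> {1..p} - {1..p - 1}" for x using that by auto
    then show "t permutes {1..p - 1}" using t permutes_superset[of t "{1..p}" "{1..p - 1}"] by blast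
  next
    assume t: "t permutes {1..p - 1}"
    then have "t p = p" using p_pos by (intro permutes_not_in[OF t]) auto
    moreover have "t permutes {1..p}" by (rule permutes_subset[OF t]) auto
    ultimately show "t permutes {1..p} \<and> t p = p" by blast
  qed
  then have "{t. t permutes {1..p - 1} \<and> evenperm t} = {t \<in> carrier (alt_group p). t p = p}"
    unfolding alt_group_carrier by blast
  then show ?thesis by (simp add: alt_group_def sym_group_def)
qed

end

section \<open>The Mathieu group of degree 23\<close>

text \<open>Periodic extension of a table to all integers; entry i of a table belongs to the point i
  + 1, as in \<open>pt\<close>.\<close>

definition tab23 :: "int list \<Rightarrow> int \<Rightarrow> int" where "tab23 L i = L ! nat (i mod 23)"

definition M23_involution_table :: "int list" where
  "M23_involution_table =
    [0, 3, 5, 1, 4, 2, 10, 21, 8, 15, 6, 11,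
     16, 13, 14, 9, 12, 17, 22, 20, 19, 7, 18]"

definition M23_gen2_table :: "int list" where
  "M23_gen2_table =
    [0, 1, 16, 12, 3, 5, 8, 17, 2, 6, 11, 22,
     13, 18, 19, 14, 9, 10, 4, 21, 15, 20, 7]"

abbreviation "M23_\<gamma> \<equiv> tab23 M23_involution_table"

abbreviation "M23_\<kappa> \<equiv> tab23 M23_gen2_table"

text \<open>The involution and the words expressing it and the second generator through each other were
  found by a computer search over the 165 involution classes modulo conjugation by the 23-cycle.\<close>

definition M23_involution :: "nat \<Rightarrow> nat" where
  "M23_involution = (M23_gen2 \<circ> M23_gen2 \<circ> M23_gen1 ^^ 9) ^^ 4"

lemma M23_gen1_eq: "M23_gen1 = full_cycle 23"
  unfolding M23_gen1_def by (rule arg_cong[of _ _ cycle_of_list]) code_simp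

lemma M23_gen1_pt: "M23_gen1 (pt 23 i) = pt 23 (i + 1)"
  unfolding M23_gen1_eq by (rule full_cycle_pt) simp

lemma pt_mod23: "pt 23 (i mod 23) = pt 23 i"
  by (simp add: pt_def)

lemma tab23_mod: "tab23 L (i mod 23) = tab23 L i"
  by (simp add: tab23_def)

lemma residue23_cases: "i mod (23 :: int) \<in> set [0..22]"
proof -
  have "0 \<le> i mod 23" "i mod 23 < 23" by simp_all
  then have "i mod 23 \<le> 22" by linarith
  then show ?thesis by simp
qed

lemma M23_gen2_pt: "M23_gen2 (pt 23 i) = pt 23 (M23_\<kappa> i)"
proof -
  have "M23_gen2 (pt 23 i) = pt 23 (M23_\<kappa> i)" if "i \<in> set [0..22]" for i
  proof -
    have "i \<in> {0, 1, 2, 3, 4, 5, 6, 7, 8, 9, 10, 11, 12, 13, 14, 15, 16, 17, 18, 19, 20, 21, 22}" using that by (simp add: upto_rec1)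
    then show ?thesis
      by (elim insertE emptyE) (simp_all add: M23_gen2_def pt_def tab23_def M23_gen2_table_def transpose_def)
  qed
  from this[OF residue23_cases] show ?thesis by (simp only: pt_mod23 tab23_mod)
qed

lemma M23_involution_word:
  "\<forall>i \<in> set [0..22]. let f = (\<lambda>i. M23_\<kappa> (M23_\<kappa> (i + 9))) in f (f (f (f i))) = M23_\<gamma> i"
  by code_simp

lemma M23_involution_pt: "M23_involution (pt 23 i) = pt 23 (M23_\<gamma> i)"
proof -
  define f where "f i = M23_\<kappa> (M23_\<kappa> (i + 9))" for i
  have h9: "(M23_gen1 ^^ n) (pt 23 i) = pt 23 (i + int n)" for n i
    by (induction n) (simp_all add: M23_gen1_pt ac_simps)
  define F where "F = M23_gen2 \<circ> M23_gen2 \<circ> M23_gen1 ^^ 9"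
  have step: "F (pt 23 i) = pt 23 (f i)" for i
    using h9[of 9 i] by (simp add: F_def M23_gen2_pt f_def)
  have "(F ^^ n) (pt 23 i) = pt 23 ((f ^^ n) i)" for n i
    by (induction n) (simp_all add: step)
  from this[of 4] have "M23_involution (pt 23 i) = pt 23 (f (f (f (f i))))" for i
    unfolding M23_involution_def F_def[symmetric] by (simp add: numeral_eq_Suc)
  moreover have "f (f (f (f i))) = M23_\<gamma> i" for i
  proof -
    have "f (f (f (f (i mod 23)))) = M23_\<gamma> (i mod 23)"
      using M23_involution_word residue23_cases[of i] unfolding f_def Let_def by blast
    moreover have "f (i mod 23) = f i" unfolding f_def by (simp add: tab23_def mod_add_left_eq)
    ultimately show ?thesis by (simp only: tab23_mod)
  qed
  ultimately show ?thesis by simp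
qed

text \<open>The shifts are powers of the 23-cycle, 22 being its inverse; the word shows that the
  involution and the cycle recover the second generator.\<close>

lemma M23_gen2_word:
  "\<forall>i \<in> set [0..22]. (M23_\<gamma> (M23_\<gamma> (M23_\<gamma> (M23_\<gamma> (i + 19) + 1) + 1) + 22) + 2) mod 23 = M23_\<kappa> i"
  by code_simp

lemma M23_involution_table_involutive: "\<forall>i \<in> set [0..22]. M23_\<gamma> (M23_\<gamma> i) = i"
  by code_simp

section \<open>Relations between the involution of M23 and powers of the 23-cycle\<close>

definition row23 :: "int \<Rightarrow> int list" where
  "row23 k = map (\<lambda>x. M23_\<gamma> (M23_\<gamma> x + k)) [0..22]"

text \<open>Composing a permutation with powers of h adds a constant to its values or rotates its
  arguments. Cyclic differences are insensitive to the former, so h^d g h^k g = g h^m g h^n becomes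
  an equality of difference lists up to rotation by n, with d eliminated.\<close>

definition differences23 :: "int list \<Rightarrow> int list" where
  "differences23 vs = map2 (\<lambda>v w. (w - v) mod 23) vs (tl vs @ [hd vs])"

text \<open>Three consecutive differences a, b, c are fingerprint enough. Where they recur, the
  offset v - u is the exponent d; the value 0 comes from trivial coincidences and 17 is -6.\<close>

fun scan23 :: "int \<Rightarrow> int \<Rightarrow> int \<Rightarrow> int \<Rightarrow> int list \<Rightarrow> int list \<Rightarrow> bool" where
  "scan23 u a b c (v # vs) (x # y # z # es) =
     ((if x = a then if y = b then if z = c then (v - u) mod 23 \<in> {0, 6, 17} else True else True else True) \<and>
      scan23 u a b c vs (y # z # es))"
| "scan23 u a b c _ _ = True"

text \<open>The two appended entries let the window of three differences wrap around.\<close>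

definition compare23 :: "int list \<Rightarrow> int list \<Rightarrow> int list \<Rightarrow> int list \<Rightarrow> bool" where
  "compare23 us ds vs es = scan23 (us ! 0) (ds ! 0) (ds ! 1) (ds ! 2) vs (es @ take 2 es)"

text \<open>The tail drops k = 0, which \<open>four_cycle\<close> excludes. The first conjunct is
  for core-freeness: if g h^k g were a power of h, all its differences would be 1.\<close>

lemma M23_no_four_cycles_computation:
  "let rows = map (\<lambda>k. let r = row23 k in (r, differences23 r)) [0..22] in
     \<forall>(us, ds) \<in> set (tl rows). \<not> (ds ! 0 = 1 \<and> ds ! 1 = 1) \<and> (\<forall>(vs, es) \<in> set rows. compare23 us ds vs es)"
  by code_simp

lemma M23_rows:
  assumes "k \<in> set [1..22]"
  shows "\<not> (differences23 (row23 k) ! 0 = 1 \<and> differences23 (row23 k) ! 1 = 1)"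
    and "m \<in> set [0..22] \<Longrightarrow> compare23 (row23 k) (differences23 (row23 k)) (row23 m) (differences23 (row23 m))"
proof -
  have split: "[0..22::int] = 0 # [1..22]" by (simp add: upto_rec1)
  have k: "(row23 k, differences23 (row23 k)) \<in> set (tl (map (\<lambda>k. let r = row23 k in (r, differences23 r)) [0..22]))"
    using assms unfolding split by (simp add: Let_def)
  note c = M23_no_four_cycles_computation[unfolded Let_def[of "map _ _"]]
  show "\<not> (differences23 (row23 k) ! 0 = 1 \<and> differences23 (row23 k) ! 1 = 1)"
    using bspec[OF c k] by simp
  show "compare23 (row23 k) (differences23 (row23 k)) (row23 m) (differences23 (row23 m))" if "m \<in> set [0..22]"
  proof -
    have "(row23 m, differences23 (row23 m)) \<in> set (map (\<lambda>k. let r = row23 k in (r, differences23 r)) [0..22])"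
      using that by (simp add: Let_def)
    then show ?thesis using bspec[OF c k] by auto
  qed
qed

lemma row23_nth: "0 \<le> x \<Longrightarrow> x < 23 \<Longrightarrow> row23 k ! nat x = M23_\<gamma> (M23_\<gamma> x + k)"
  unfolding row23_def by (subst nth_map) (auto simp: nth_upto)

lemma length_row23: "length (row23 k) = 23" by (simp add: row23_def)

lemma length_differences23: "vs \<noteq> [] \<Longrightarrow> length (differences23 vs) = length vs"
  by (simp add: differences23_def)

lemma differences23_nth:
  assumes "x < length vs"
  shows "differences23 vs ! x = (vs ! (Suc x mod length vs) - vs ! x) mod 23"
proof -
  have "(tl vs @ [hd vs]) ! x = rotate1 vs ! x" using assms by (cases vs) auto
  then show ?thesis using assms by (simp add: differences23_def nth_rotate1)
qed

lemma scan23D: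
  assumes "scan23 u a b c vs es" "n < length vs" "n + 2 < length es" "es ! n = a" "es ! (n + 1) = b" "es ! (n + 2) = c"
  shows "(vs ! n - u) mod 23 \<in> {0, 6, 17}"
  using assms
proof (induction u a b c vs es arbitrary: n rule: scan23.induct)
  case (1 u a b c v vs x y z es)
  show ?case
  proof (cases n)
    case 0
    then show ?thesis using 1(2,5-7) by simp
  next
    case (Suc n')
    then show ?thesis using 1(1)[of n'] 1(2-7) by simp
  qed
qed auto

lemma row23_mod_nth: "row23 (j mod 23) ! nat (x mod 23) = M23_\<gamma> (M23_\<gamma> x + j)"
  by (simp add: row23_nth tab23_mod) (simp add: tab23_def mod_add_right_eq)

lemma differences23_row_nth:
  "differences23 (row23 (j mod 23)) ! nat (x mod 23) =
     (M23_\<gamma> (M23_\<gamma> (x + 1) + j) - M23_\<gamma> (M23_\<gamma> x + j)) mod 23"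
proof -
  have "int (Suc (nat (x mod 23)) mod 23) = (x mod 23 + 1) mod 23" by (simp add: zmod_int add.commute)
  also have "\<dots> = (x + 1) mod 23" by (rule mod_add_left_eq)
  finally have "Suc (nat (x mod 23)) mod 23 = nat ((x + 1) mod 23)" by (metis nat_int)
  moreover have "nat (x mod 23) < length (row23 (j mod 23))" by (simp add: length_row23 nat_less_iff)
  ultimately show ?thesis using differences23_nth by (simp only: length_row23 row23_mod_nth)
qed

lemma not_dvd_23_mod: "\<not> 23 dvd k \<Longrightarrow> k mod 23 \<in> set [1..22]" for k :: int
  using residue23_cases[of k] by (simp add: dvd_eq_mod_eq_0)

lemma M23_\<gamma>_core:
  assumes "\<And>x. 23 dvd M23_\<gamma> (M23_\<gamma> x + i) - (x + j)"
  shows "23 dvd i"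
proof (rule ccontr)
  assume i: "\<not> 23 dvd i"
  have "differences23 (row23 (i mod 23)) ! nat (x mod 23) = 1" for x
  proof -
    have "23 dvd (M23_\<gamma> (M23_\<gamma> (x + 1) + i) - (x + 1 + j)) - (M23_\<gamma> (M23_\<gamma> x + i) - (x + j))"
      by (intro dvd_diff assms)
    then have "23 dvd (M23_\<gamma> (M23_\<gamma> (x + 1) + i) - M23_\<gamma> (M23_\<gamma> x + i)) - 1" by (simp add: algebra_simps)
    then have "(M23_\<gamma> (M23_\<gamma> (x + 1) + i) - M23_\<gamma> (M23_\<gamma> x + i)) mod 23 = 1 mod 23" by (simp only: mod_eq_dvd_iff)
    then show ?thesis by (simp add: differences23_row_nth)
  qed
  from this[of 0] this[of 1] show False using M23_rows(1)[OF not_dvd_23_mod[OF i]] by simp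
qed

lemma M23_\<gamma>_relation:
  assumes k: "\<not> 23 dvd k" and rel: "\<And>x. 23 dvd M23_\<gamma> (M23_\<gamma> x + k) + d - M23_\<gamma> (M23_\<gamma> (x + n) + m)"
  shows "d mod 23 \<in> {0, 6, 17}"
proof -
  define k' m' n' where kmn: "k' = k mod 23" "m' = m mod 23" "n' = nat (n mod 23)"
  have n': "int n' = n mod 23" "n' < 23" by (simp_all add: kmn nat_less_iff)
  have k': "k' \<in> set [1..22]" unfolding kmn by (rule not_dvd_23_mod[OF k])
  have m': "m' \<in> set [0..22]" unfolding kmn by (rule residue23_cases)
  have eq: "differences23 (row23 k') ! nat (x mod 23) = differences23 (row23 m') ! nat ((x + n) mod 23)" for x
  proof -
    define R S where "R x = M23_\<gamma> (M23_\<gamma> x + k)" and "S x = M23_\<gamma> (M23_\<gamma> x + m)" for x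
    have "23 dvd (R (x + 1) + d - S (x + 1 + n)) - (R x + d - S (x + n))"
      unfolding R_def S_def by (intro dvd_diff rel)
    then have "23 dvd (R (x + 1) - R x) - (S (x + n + 1) - S (x + n))" by (simp add: algebra_simps)
    then have "(R (x + 1) - R x) mod 23 = (S (x + n + 1) - S (x + n)) mod 23" by (simp only: mod_eq_dvd_iff)
    then show ?thesis unfolding kmn differences23_row_nth R_def S_def .
  qed
  let ?ds = "differences23 (row23 k')" and ?es = "differences23 (row23 m')"
  let ?fs = "?es @ take 2 ?es"
  have len: "length ?es = 23" by (subst length_differences23) (use length_row23[of m'] in auto)
  have fs: "?fs ! (n' + j) = ?ds ! j" if "j < 3" for j
  proof -
    have "?fs ! (n' + j) = ?es ! ((n' + j) mod 23)"
    proof (cases "n' + j < 23")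
      case True
      then show ?thesis by (simp add: nth_append len)
    next
      case False
      then have "(n' + j) mod 23 = n' + j - 23" "n' + j - 23 < 2" using n' that by (auto simp: mod_if)
      then show ?thesis using False by (simp add: nth_append len)
    qed
    also have "(n' + j) mod 23 = nat ((int j + n) mod 23)"
    proof -
      have "int ((n' + j) mod 23) = (int j + n mod 23) mod 23" by (simp add: zmod_int n' add.commute)
      also have "\<dots> = (int j + n) mod 23" by (rule mod_add_right_eq)
      finally show ?thesis by (metis nat_int)
    qed
    also have "?es ! \<dots> = ?ds ! j" using eq[of "int j"] that by simp
    finally show ?thesis .
  qed
  have "(row23 m' ! n' - row23 k' ! 0) mod 23 \<in> {0, 6, 17}"
  proof (rule scan23D)
    show "scan23 (row23 k' ! 0) (?ds ! 0) (?ds ! 1) (?ds ! 2) (row23 m') ?fs"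
      using M23_rows(2)[OF k' m'] by (simp only: compare23_def)
  qed (use n' fs[of 0] fs[of 1] fs[of 2] len length_row23[of m'] in auto)
  moreover have "23 dvd row23 k' ! 0 + d - row23 m' ! n'"
    using rel[of 0] row23_mod_nth[of k 0] row23_mod_nth[of m n] by (simp add: kmn)
  then have "d mod 23 = (row23 m' ! n' - row23 k' ! 0) mod 23"
    unfolding mod_eq_dvd_iff by (simp add: algebra_simps)
  ultimately show ?thesis by simp
qed

section \<open>M23 as a permutation group generated by the involution and the 23-cycle\<close>

lemma mult_M23: "mult M23 = (\<circ>)" and one_M23: "\<one>\<^bsub>M23\<^esub> = id"
  by (simp_all add: M23_def subgroup_generated_def sym_group_def)

lemma carrier_M23: "carrier M23 = generate (sym_group 23) {M23_gen1, M23_gen2}"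
proof -
  have "carrier (sym_group 23) \<inter> {M23_gen1, M23_gen2} = {M23_gen1, M23_gen2}" using M23_gens_in_carrier by auto
  then show ?thesis by (simp add: M23_def carrier_subgroup_generated)
qed

lemma M23_permutes: "f \<in> carrier M23 \<Longrightarrow> f permutes {1..23}"
  using group.generate_in_carrier[OF sym_group_is_group, of "{M23_gen1, M23_gen2}" 23] M23_gens_in_carrier
  unfolding carrier_M23 sym_group_carrier[symmetric] by blast

lemma subgroup_M23_funpow:
  assumes "subgroup K M23" "f \<in> K"
  shows "f ^^ n \<in> K"
proof (induction n)
  case 0
  then show ?case using subgroup.one_closed[OF assms(1)] by (simp only: one_M23 funpow.simps)
next
  case (Suc n)
  then show ?case using subgroup.m_closed[OF assms Suc] by (simp only: mult_M23 funpow.simps)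
qed

lemma M23_gens_in_M23: "M23_gen1 \<in> carrier M23" "M23_gen2 \<in> carrier M23"
  unfolding carrier_M23 by (auto intro: generate.incl)

lemma M23_involution_in_M23: "M23_involution \<in> carrier M23"
proof -
  interpret group M23 by (rule group_M23)
  note fp = subgroup_M23_funpow[OF subgroup_self]
  have comp: "x \<circ> y \<in> carrier M23" if "x \<in> carrier M23" "y \<in> carrier M23" for x y
    using m_closed[OF that] by (simp only: mult_M23)
  show ?thesis unfolding M23_involution_def by (intro fp comp M23_gens_in_M23)
qed

lemma M23_generated: "carrier M23 = generate M23 {M23_involution, M23_gen1}"
proof -
  interpret group M23 by (rule group_M23)
  define K where "K = generate M23 {M23_involution, M23_gen1}"
  have sub: "{M23_involution, M23_gen1} \<subseteq> carrier M23" using M23_involution_in_M23 M23_gens_in_M23 by auto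
  have K: "subgroup K M23" unfolding K_def by (rule generate_is_subgroup[OF sub])
  have gK: "M23_involution \<in> K" and hK: "M23_gen1 \<in> K" unfolding K_def by (auto intro: generate.incl)
  have comp: "x \<circ> y \<in> K" if "x \<in> K" "y \<in> K" for x y
    using subgroup.m_closed[OF K that] by (simp only: mult_M23)
  define W where "W = M23_gen1 ^^ 2 \<circ> (M23_involution \<circ> (M23_gen1 ^^ 22 \<circ> (M23_involution \<circ> (M23_gen1 ^^ 1 \<circ>
    (M23_involution \<circ> (M23_gen1 ^^ 1 \<circ> (M23_involution \<circ> M23_gen1 ^^ 19)))))))"
  have WK: "W \<in> K" unfolding W_def by (intro comp gK subgroup_M23_funpow[OF K hK])
  have hn: "(M23_gen1 ^^ n) (pt 23 i) = pt 23 (i + int n)" for n i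
    by (induction n) (simp_all add: M23_gen1_pt ac_simps)
  have "M23_gen2 = W"
  proof (rule permutes_ext_pt)
    show "M23_gen2 permutes {1..23}" "W permutes {1..23}"
      using M23_gens_in_M23 WK subgroup.subset[OF K] M23_permutes by blast+
    fix i
    let ?w = "\<lambda>i. M23_\<gamma> (M23_\<gamma> (M23_\<gamma> (M23_\<gamma> (i + 19) + 1) + 1) + 22) + 2"
    have "W (pt 23 i) = pt 23 (?w i)"
      unfolding W_def comp_apply hn M23_involution_pt by simp
    also have "\<dots> = pt 23 (?w i mod 23)" by (simp only: pt_mod23)
    also have "?w i mod 23 = ?w (i mod 23) mod 23"
    proof -
      have "M23_\<gamma> (i mod 23 + 19) = M23_\<gamma> (i + 19)" by (simp add: tab23_def mod_add_left_eq)
      then show ?thesis by (simp only:)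
    qed
    also have "\<dots> = M23_\<kappa> (i mod 23)" using M23_gen2_word residue23_cases[of i] by blast
    finally show "M23_gen2 (pt 23 i) = W (pt 23 i)" by (simp only: M23_gen2_pt tab23_mod)
  qed simp
  then have "{M23_gen1, M23_gen2} \<subseteq> K" using WK hK by blast
  \<comment> \<open>K is generated inside \<open>M23\<close>, while \<open>M23\<close> is generated
    inside the symmetric group; the two are compared in the latter.\<close>
  moreover have "subgroup K (sym_group 23)"
  proof (rule group.incl_subgroup[OF sym_group_is_group])
    show "subgroup (carrier M23) (sym_group 23)"
      unfolding carrier_M23
      by (rule group.generate_is_subgroup[OF sym_group_is_group]) (use M23_gens_in_carrier in auto)
    have "(sym_group 23)\<lparr>carrier := carrier M23\<rparr> = M23"
      by (simp add: M23_def subgroup_generated_def)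
    then show "subgroup K ((sym_group 23)\<lparr>carrier := carrier M23\<rparr>)" using K by simp
  qed
  ultimately have "carrier M23 \<subseteq> K"
    unfolding carrier_M23 by (rule group.generate_subgroup_incl[OF sym_group_is_group])
  then show ?thesis using subgroup.subset[OF K] unfolding K_def by blast
qed

interpretation M23: permutation_group_with_cycle M23 23 M23_gen1 M23_involution M23_\<gamma>
proof (rule permutation_group_with_cycle.intro[OF group_M23], unfold_locales)
  show "Factorial_Ring.prime (23 :: nat)" by simp
  show "mult M23 = (\<circ>)" "\<one>\<^bsub>M23\<^esub> = id" by (rule mult_M23 one_M23)+
  show "M23_gen1 (pt 23 i) = pt 23 (i + 1)" "M23_involution (pt 23 i) = pt 23 (M23_\<gamma> i)" for i
    by (rule M23_gen1_pt M23_involution_pt)+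
  show "M23_involution \<circ> M23_involution = id"
  proof (rule permutes_ext_pt)
    show "M23_involution \<circ> M23_involution permutes {1..23}"
      by (intro permutes_compose M23_permutes M23_involution_in_M23)
    fix i
    have "M23_\<gamma> (M23_\<gamma> i) = i mod 23"
      using M23_involution_table_involutive residue23_cases[of i] by (metis tab23_mod)
    then show "(M23_involution \<circ> M23_involution) (pt 23 i) = id (pt 23 i)"
      by (simp add: M23_involution_pt pt_mod23)
  qed (simp_all add: permutes_id)
  show "int 23 dvd i" if "\<And>x. int 23 dvd M23_\<gamma> (M23_\<gamma> x + i) - (x + j)" for i j
    using M23_\<gamma>_core[of i j] that by simp
qed (use M23_permutes M23_gens_in_M23 M23_involution_in_M23 M23_generated in blast)+

text \<open>The relation for k = n = 6 and m = d = 17 = -6: the involution commutes with its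
  conjugate under the sixth power of the 23-cycle.\<close>

lemma M23_four_cycle_witness:
  "\<forall>x \<in> set [0..22]. (M23_\<gamma> (M23_\<gamma> x + 6) + 17 - M23_\<gamma> (M23_\<gamma> (x + 6) + 17)) mod 23 = 0"
  by code_simp

lemma M23_rigid: "difference_rigid 23 M23.four_cycle"
proof (rule difference_rigid_cycle[where b = 6])
  have "23 dvd M23_\<gamma> (M23_\<gamma> x + 6) + 17 - M23_\<gamma> (M23_\<gamma> (x + 6) + 17)" for x
  proof -
    have "M23_\<gamma> (x mod 23 + 6) = M23_\<gamma> (x + 6)" by (simp add: tab23_def mod_add_left_eq)
    then show ?thesis using M23_four_cycle_witness residue23_cases[of x]
      by (metis dvd_eq_mod_eq_0 tab23_mod)
  qed
  then have "\<not> int 23 dvd 6 \<and> (\<forall>x. int 23 dvd M23_\<gamma> (M23_\<gamma> x + 6) + 17 - M23_\<gamma> (M23_\<gamma> (x + 6) + 17))" by simp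
  then have w: "M23.four_cycle 17" unfolding M23.four_cycle_iff by blast
  fix d :: int assume d: "\<not> int 23 dvd d"
  show "M23.four_cycle d \<longleftrightarrow> int 23 dvd d - 6 \<or> int 23 dvd d + 6"
  proof
    assume "M23.four_cycle d"
    then have "d mod 23 \<in> {0, 6, 17}" unfolding M23.four_cycle_iff using M23_\<gamma>_relation by auto
    then have "d mod 23 = 6 mod 23 \<or> d mod 23 = (- 6) mod 23" using d by (auto simp: dvd_eq_mod_eq_0)
    then show "int 23 dvd d - 6 \<or> int 23 dvd d + 6" unfolding mod_eq_dvd_iff by simp
  next
    have shift: "int 23 dvd d + 6 \<longleftrightarrow> int 23 dvd d - 17" "int 23 dvd d - 6 \<longleftrightarrow> int 23 dvd d - (- 17)"
      by presburger+
    assume "int 23 dvd d - 6 \<or> int 23 dvd d + 6"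
    then show "M23.four_cycle d"
      using M23.four_cycle_cong[of d 17] M23.four_cycle_cong[of d "- 17"] M23.four_cycle_minus[of 17] w shift by blast
  qed
qed simp_all

section \<open>The alternating group of degree 5\<close>

text \<open>Permutations in one-line notation. Positions in this list will number the
  vertices.\<close>

definition A5_elements :: "nat list list" where
  "A5_elements =
    [[1, 2, 3, 4, 5], [2, 1, 4, 3, 5], [3, 2, 5, 4, 1], [2, 3, 4, 5, 1],
     [4, 1, 5, 3, 2], [5, 2, 1, 4, 3], [1, 4, 3, 5, 2], [2, 5, 4, 1, 3],
     [4, 3, 1, 5, 2], [5, 1, 2, 3, 4], [3, 4, 5, 1, 2], [1, 5, 3, 2, 4],
     [3, 4, 2, 5, 1], [4, 5, 3, 1, 2], [1, 3, 2, 5, 4], [4, 3, 5, 2, 1],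
     [5, 4, 1, 3, 2], [3, 1, 5, 2, 4], [5, 4, 2, 1, 3], [3, 5, 4, 2, 1],
     [2, 4, 1, 5, 3], [3, 5, 2, 1, 4], [4, 5, 1, 2, 3], [5, 3, 2, 4, 1],
     [4, 2, 5, 1, 3], [5, 3, 1, 2, 4], [1, 4, 2, 3, 5], [5, 1, 4, 2, 3],
     [2, 4, 3, 1, 5], [4, 1, 3, 2, 5], [1, 5, 2, 4, 3], [4, 2, 1, 3, 5],
     [2, 3, 1, 4, 5], [5, 2, 3, 1, 4], [1, 3, 4, 2, 5], [2, 4, 5, 3, 1],
     [3, 2, 4, 1, 5], [2, 5, 1, 3, 4], [3, 1, 2, 4, 5], [4, 2, 3, 5, 1],
     [2, 5, 3, 4, 1], [1, 2, 5, 3, 4], [1, 3, 5, 4, 2], [5, 2, 4, 3, 1],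
     [2, 1, 3, 5, 4], [3, 1, 4, 5, 2], [1, 5, 4, 3, 2], [2, 1, 5, 4, 3],
     [3, 2, 1, 5, 4], [3, 5, 1, 4, 2], [5, 1, 3, 4, 2], [1, 2, 4, 5, 3],
     [2, 3, 5, 1, 4], [5, 3, 4, 1, 2], [4, 1, 2, 5, 3], [4, 5, 2, 3, 1],
     [1, 4, 5, 2, 3], [5, 4, 3, 2, 1], [4, 3, 2, 1, 5], [3, 4, 1, 2, 5]]"

text \<open>Left multiplication by (1 2)(3 4) on list positions; \<open>A5_left2\<close> belongs to
  (1 3 5). The same two tables later describe matrices acting on vectors.\<close>

definition A5_left1 :: "nat list" where
  "A5_left1 =
    [1, 0, 4, 6, 2, 9, 3, 11, 12, 5, 15, 7, 8, 19, 20,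
     10, 23, 24, 25, 13, 14, 22, 21, 16, 17, 18, 32, 33, 34, 36,
     37, 38, 26, 27, 28, 42, 29, 30, 31, 45, 46, 47, 35, 50, 51,
     39, 40, 41, 54, 55, 43, 44, 56, 57, 48, 49, 52, 53, 59, 58]"

definition A5_left2 :: "nat list" where
  "A5_left2 =
    [2, 3, 5, 7, 8, 0, 10, 1, 13, 14, 16, 17, 18, 4, 21,
     22, 6, 25, 26, 27, 28, 9, 29, 30, 31, 11, 12, 34, 35, 15,
     38, 39, 40, 41, 19, 20, 43, 44, 23, 24, 47, 48, 49, 51, 52,
     53, 45, 32, 33, 50, 42, 36, 37, 46, 58, 54, 59, 56, 55, 57]"

definition word_perm :: "nat list \<Rightarrow> nat \<Rightarrow> nat" where
  "word_perm w k = (if 1 \<le> k \<and> k \<le> length w then w ! (k - 1) else k)"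

definition compose_words :: "nat list \<Rightarrow> nat list \<Rightarrow> nat list" where
  "compose_words w w' = map (\<lambda>k. w ! (k - 1)) w'"

text \<open>The 60 elements are listed in the order of a breadth-first search from the identity, using
  left multiplication by \<open>(1 2)(3 4)\<close> and \<open>(1 3 5)\<close>.\<close>

lemma A5_elements_computation:
  "length A5_elements = 60 \<and> distinct A5_elements \<and> A5_elements ! 0 = [1, 2, 3, 4, 5] \<and>
   (\<forall>w \<in> set A5_elements. length w = 5 \<and> (\<forall>k \<in> set w. 1 \<le> k \<and> k \<le> 5))"
  by code_simp

lemma A5_left_computation:
  "length A5_left1 = 60 \<and> length A5_left2 = 60 \<and> (\<forall>v \<in> set A5_left1. v < 60) \<and> (\<forall>v \<in> set A5_left2. v < 60) \<and>
   map ((!) A5_elements) A5_left1 = map (compose_words [2, 1, 4, 3, 5]) A5_elements \<and>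
   map ((!) A5_elements) A5_left2 = map (compose_words [3, 2, 5, 4, 1]) A5_elements"
  by code_simp

text \<open>Predecessors in the search tree, starting with that of position 1 because the root 0 has
  none.\<close>

definition A5_parents :: "nat list" where
  "A5_parents =
    [0, 0, 1, 2, 2, 3, 3, 4, 5, 6, 7, 8, 8, 9, 10,
     10, 11, 12, 13, 14, 14, 15, 16, 17, 17, 18, 19, 20, 22, 23,
     24, 26, 27, 27, 28, 29, 30, 30, 31, 32, 33, 35, 36, 37, 39,
     40, 40, 41, 42, 43, 43, 44, 45, 48, 49, 52, 53, 54, 56]"

lemma A5_reach_computation:
  "length A5_parents = 59 \<and>
   (\<forall>(i, j) \<in> set (zip [1..<60] A5_parents). j < i \<and> (A5_left1 ! j = i \<or> A5_left2 ! j = i))"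
  by code_simp

definition A5_elt :: "nat \<Rightarrow> nat \<Rightarrow> nat" where "A5_elt v = word_perm (A5_elements ! v)"

lemma word_perm_compose:
  assumes "length w = 5" "length w' = 5" "\<forall>k \<in> set w'. 1 \<le> k \<and> k \<le> 5"
  shows "word_perm (compose_words w w') = word_perm w \<circ> word_perm w'"
proof
  fix k
  have "1 \<le> w' ! (k - 1)" "w' ! (k - 1) \<le> 5" if "1 \<le> k" "k \<le> 5"
    using assms that nth_mem[of "k - 1" w'] by auto
  then show "word_perm (compose_words w w') k = (word_perm w \<circ> word_perm w') k"
    using assms by (auto simp: word_perm_def compose_words_def)
qed

lemma A5_elt_facts:
  assumes "v < 60"
  shows "length (A5_elements ! v) = 5" "\<forall>k \<in> set (A5_elements ! v). 1 \<le> k \<and> k \<le> 5"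
proof -
  have "A5_elements ! v \<in> set A5_elements" using assms A5_elements_computation by (metis nth_mem)
  then show "length (A5_elements ! v) = 5" "\<forall>k \<in> set (A5_elements ! v). 1 \<le> k \<and> k \<le> 5"
    using A5_elements_computation by blast+
qed

lemma A5_left:
  assumes "v < 60"
  shows "A5_left1 ! v < 60" "A5_left2 ! v < 60"
    "A5_elt (A5_left1 ! v) = word_perm [2, 1, 4, 3, 5] \<circ> A5_elt v"
    "A5_elt (A5_left2 ! v) = word_perm [3, 2, 5, 4, 1] \<circ> A5_elt v"
proof -
  note c = A5_left_computation
  have len: "v < length A5_left1" "v < length A5_left2" "v < length A5_elements"
    using c A5_elements_computation assms by simp_all
  show "A5_left1 ! v < 60" "A5_left2 ! v < 60" using c assms by simp_all
  have "map ((!) A5_elements) A5_left1 ! v = map (compose_words [2, 1, 4, 3, 5]) A5_elements ! v"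
    "map ((!) A5_elements) A5_left2 ! v = map (compose_words [3, 2, 5, 4, 1]) A5_elements ! v"
    using c by (simp_all only:)
  then have "A5_elements ! (A5_left1 ! v) = compose_words [2, 1, 4, 3, 5] (A5_elements ! v)"
    "A5_elements ! (A5_left2 ! v) = compose_words [3, 2, 5, 4, 1] (A5_elements ! v)"
    using len by (simp_all only: nth_map)
  then show "A5_elt (A5_left1 ! v) = word_perm [2, 1, 4, 3, 5] \<circ> A5_elt v"
    "A5_elt (A5_left2 ! v) = word_perm [3, 2, 5, 4, 1] \<circ> A5_elt v"
    unfolding A5_elt_def
    by (simp_all add: word_perm_compose[OF _ A5_elt_facts[OF assms]])
qed

lemma A5_gens:
  "word_perm [2, 1, 4, 3, 5] \<in> carrier (alt_group 5)" "word_perm [3, 2, 5, 4, 1] \<in> carrier (alt_group 5)"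
proof -
  have wp: "word_perm w = f"
    if "length w = 5" "\<forall>k \<in> {1, 2, 3, 4, 5}. w ! (k - 1) = f k" "\<And>k. k \<notin> {1, 2, 3, 4, 5} \<Longrightarrow> f k = k" for w f
  proof
    fix k :: nat
    have "1 \<le> k \<and> k \<le> 5 \<longleftrightarrow> k \<in> {1, 2, 3, 4, 5}" by auto
    then show "word_perm w k = f k" using that by (cases "k \<in> {1, 2, 3, 4, 5}") (simp_all only: word_perm_def if_True if_False simp_thms)
  qed
  have 1: "word_perm [2, 1, 4, 3, 5] = transpose 1 2 \<circ> transpose 3 4"
    by (rule wp) (auto simp: transpose_def)
  have 2: "word_perm [3, 2, 5, 4, 1] = transpose 1 3 \<circ> transpose 3 5"
    by (rule wp) (auto simp: transpose_def)
  have e: "evenperm (transpose a b \<circ> transpose c d)" if "a \<noteq> b" "c \<noteq> d" for a b c d :: nat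
    using that by (simp only: evenperm_comp[OF permutation_swap_id permutation_swap_id] evenperm_swap)
  have p: "transpose a b \<circ> transpose c d permutes {1..5}" if "{a, b, c, d} \<subseteq> {1..5}" for a b c d :: nat
    using that by (intro permutes_compose permutes_swap_id) auto
  show "word_perm [2, 1, 4, 3, 5] \<in> carrier (alt_group 5)" "word_perm [3, 2, 5, 4, 1] \<in> carrier (alt_group 5)"
    unfolding 1 2 alt_group_carrier by (intro conjI e p; simp)+
qed

text \<open>Amounts to induction over words in the two generators: predecessors have smaller
  numbers, so the search tree reaches every position.\<close>

lemma A5_induct:
  assumes "v < 60" "P 0" "\<And>v. v < 60 \<Longrightarrow> P v \<Longrightarrow> P (A5_left1 ! v)" "\<And>v. v < 60 \<Longrightarrow> P v \<Longrightarrow> P (A5_left2 ! v)"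
  shows "P v"
  using assms(1)
proof (induction v rule: less_induct)
  case (less v)
  show ?case
  proof (cases "v = 0")
    case False
    then have v: "v - 1 < length [1..<60]" "v - 1 < length A5_parents" "[1..<60] ! (v - 1) = v"
      using less.prems A5_reach_computation by (auto simp: nth_upt)
    have "(v, A5_parents ! (v - 1)) \<in> set (zip [1..<60] A5_parents)"
      using nth_mem[of "v - 1" "zip [1..<60] A5_parents"] v by (simp only: nth_zip length_zip min_less_iff_conj)
    then obtain j where "j < v" "A5_left1 ! j = v \<or> A5_left2 ! j = v"
      using A5_reach_computation by blast
    then show ?thesis using less assms(3,4)[of j] by auto
  qed (use assms(2) in simp)
qed

lemma A5_elt_0: "A5_elt 0 = id"
proof
  fix k show "A5_elt 0 k = id k"
    using A5_elements_computation
    by (cases "k = 0 \<or> k > 5") (auto simp: A5_elt_def word_perm_def less_Suc_eq numeral_eq_Suc not_less le_Suc_eq)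
qed

lemma A5_elt_in:
  assumes "v < 60"
  shows "A5_elt v \<in> carrier (alt_group 5)"
proof -
  interpret group "alt_group 5" by (rule alt_group_is_group)
  have comp: "x \<circ> y \<in> carrier (alt_group 5)" if "x \<in> carrier (alt_group 5)" "y \<in> carrier (alt_group 5)" for x y
    using m_closed[OF that] by (simp only: alt_group_mult)
  show ?thesis
  proof (rule A5_induct[OF assms])
    show "A5_elt 0 \<in> carrier (alt_group 5)" using one_closed by (simp only: A5_elt_0 alt_group_one)
  qed (simp_all only: A5_left comp A5_gens)
qed

text \<open>Injective since the words are distinct, into the group by induction over words, and onto
  since the group has 5!/2 = 60 elements.\<close>

lemma A5_elt_bij: "bij_betw A5_elt {..<60} (carrier (alt_group 5))"
proof -
  have "inj_on A5_elt {..<60}"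
  proof (rule inj_onI)
    fix u v :: nat assume uv: "u \<in> {..<60}" "v \<in> {..<60}" "A5_elt u = A5_elt v"
    have "A5_elements ! u = A5_elements ! v"
    proof (rule nth_equalityI)
      fix i assume "i < length (A5_elements ! u)"
      then have "i < 5" using A5_elt_facts uv by simp
      then show "A5_elements ! u ! i = A5_elements ! v ! i"
        using fun_cong[OF uv(3), of "Suc i"] A5_elt_facts uv by (simp add: A5_elt_def word_perm_def)
    qed (use A5_elt_facts uv in simp)
    then show "u = v" using uv A5_elements_computation by (simp add: nth_eq_iff_index_eq)
  qed
  moreover have "A5_elt ` {..<60} \<subseteq> carrier (alt_group 5)" using A5_elt_in by auto
  moreover have "card (carrier (alt_group 5)) = 60"
    using alt_group_card_carrier[of 5] by (simp add: fact_numeral)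
  moreover have "finite (carrier (alt_group 5))" by (rule card_ge_0_finite) (use calculation(3) in simp)
  ultimately show ?thesis
    by (metis bij_betw_def card_image card_lessThan card_subset_eq)
qed

text \<open>Vertices are numbered by \<open>{..<60}\<close>; \<open>co\<close> gives representatives of the nonzero vectors of the
  plane over the field with \<open>p\<close> elements modulo the scalars \<open>s\<close> with \<open>s ^ r = 1\<close>.\<close>

definition unit_residue :: "nat \<Rightarrow> nat \<Rightarrow> int \<Rightarrow> bool" where
  "unit_residue p r d \<longleftrightarrow> d ^ r mod int p = 1"

definition vdet :: "int \<times> int \<Rightarrow> int \<times> int \<Rightarrow> int" where
  "vdet = (\<lambda>(x, y) (x', y'). x * y' - y * x')"

definition det_edges :: "nat \<Rightarrow> nat \<Rightarrow> (int \<times> int) list \<Rightarrow> (nat \<times> nat) set" where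
  "det_edges p r co = {(u, v). u < 60 \<and> v < 60 \<and> unit_residue p r (vdet (co ! u) (co ! v))}"

text \<open>A certificate: the scalars in \<open>ss\<close> bring the image vectors back to the
  chosen representatives. With \<open>A5_left1\<close> and \<open>A5_left2\<close> for P, the
  matrices act on vectors exactly as the generators act on A5, position by position, which replaces
  an explicit homomorphism into PSL(2,p).\<close>

definition matrix_action :: "nat \<Rightarrow> nat \<Rightarrow> (int \<times> int) list \<Rightarrow> int \<times> int \<times> int \<times> int \<Rightarrow> int list \<Rightarrow> nat list \<Rightarrow> bool" where
  "matrix_action p r co M ss P \<longleftrightarrow> length P = 60 \<and> distinct P \<and>
     (case M of (a, b, c, d) \<Rightarrow> (a * d - b * c) mod int p = 1 \<and>
       (\<forall>v \<in> set [0..<60]. P ! v < 60 \<and> unit_residue p r (ss ! v) \<and>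
         (case co ! v of (x, y) \<Rightarrow>
           co ! (P ! v) = (ss ! v * (a * x + b * y) mod int p, ss ! v * (c * x + d * y) mod int p))))"

lemma unit_residue_cong: "i mod int p = j mod int p \<Longrightarrow> unit_residue p r i \<longleftrightarrow> unit_residue p r j"
  unfolding unit_residue_def by (metis power_mod)

lemma unit_residue_mult: "unit_residue p r s \<Longrightarrow> unit_residue p r (s * d) \<longleftrightarrow> unit_residue p r d"
  unfolding unit_residue_def power_mult_distrib by (metis mod_mult_left_eq mult_1)

text \<open>A matrix of determinant 1 preserves \<open>vdet\<close>, and the two scalars multiply it
  by elements whose r-th power is 1.\<close>

lemma matrix_action_aut:
  assumes "matrix_action p r co M ss P"
  shows "rel_aut {..<60} (det_edges p r co) (\<lambda>v. P ! v)"
proof -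
  obtain a b c d where M: "M = (a, b, c, d)" by (cases M)
  have P: "length P = 60" "distinct P" and det: "(a * d - b * c) mod int p = 1"
    and act: "\<And>v. v < 60 \<Longrightarrow> P ! v < 60 \<and> unit_residue p r (ss ! v) \<and>
         (case co ! v of (x, y) \<Rightarrow>
           co ! (P ! v) = (ss ! v * (a * x + b * y) mod int p, ss ! v * (c * x + d * y) mod int p))"
    using assms by (auto simp: matrix_action_def M)
  have "inj_on (\<lambda>v. P ! v) {..<60}" using P by (auto simp: inj_on_def nth_eq_iff_index_eq)
  moreover have "(\<lambda>v. P ! v) ` {..<60} \<subseteq> {..<60}" using act by auto
  ultimately have "bij_betw (\<lambda>v. P ! v) {..<60} {..<60}" by (simp add: bij_betw_def endo_inj_surj)
  moreover have "unit_residue p r (vdet (co ! (P ! u)) (co ! (P ! v))) \<longleftrightarrow> unit_residue p r (vdet (co ! u) (co ! v))"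
    if "u < 60" "v < 60" for u v
  proof -
    obtain x y where u: "co ! u = (x, y)" by fastforce
    obtain x' y' where v: "co ! v = (x', y')" by fastforce
    define s t where st: "s = ss ! u" "t = ss ! v"
    have res: "unit_residue p r s" "unit_residue p r t" using act that by (auto simp: st)
    have "vdet (co ! (P ! u)) (co ! (P ! v)) mod int p =
        (s * (a * x + b * y) * (t * (c * x' + d * y')) - s * (c * x + d * y) * (t * (a * x' + b * y'))) mod int p"
    proof -
      have "co ! (P ! u) = (s * (a * x + b * y) mod int p, s * (c * x + d * y) mod int p)"
        "co ! (P ! v) = (t * (a * x' + b * y') mod int p, t * (c * x' + d * y') mod int p)"
        using act[OF that(1)] act[OF that(2)] by (simp_all add: u v st)
      then show ?thesis
        unfolding vdet_def by (simp only: prod.case) (intro mod_diff_cong mod_mult_cong mod_mod_trivial)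
    qed
    also have "\<dots> = ((a * d - b * c) * (s * (t * (x * y' - y * x')))) mod int p"
      by (rule arg_cong[of _ _ "\<lambda>z. z mod int p"]) (simp add: algebra_simps)
    also have "\<dots> = (s * (t * (x * y' - y * x'))) mod int p"
      using det by (metis mod_mult_left_eq mult_1)
    finally have "unit_residue p r (vdet (co ! (P ! u)) (co ! (P ! v))) \<longleftrightarrow> unit_residue p r (s * (t * (x * y' - y * x')))"
      by (rule unit_residue_cong)
    then show ?thesis using res by (simp add: unit_residue_mult u v vdet_def)
  qed
  ultimately show ?thesis using act by (simp add: rel_aut_def det_edges_def)
qed

text \<open>The tables \<open>lab\<close> and \<open>par\<close> list the neighbours of the vertex \<open>0 = (1, 0)\<close> and the parents in a
  spanning tree of depth at most three.\<close>

definition valid_tables :: "nat \<Rightarrow> nat \<Rightarrow> (int \<times> int) list \<Rightarrow> nat list \<Rightarrow> nat list \<Rightarrow> nat list \<Rightarrow> bool" where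
  "valid_tables p r co rot lab par \<longleftrightarrow>
     length lab = p \<and> co ! 0 = (1, 0) \<and> rot ! 0 = 0 \<and>
     (\<forall>i \<in> set [0..<p]. co ! (lab ! i) = (int i, 1) \<and> lab ! i < 60 \<and> rot ! (lab ! i) = lab ! (Suc i mod p)) \<and>
     (\<forall>v \<in> set [0..<60]. unit_residue p r (snd (co ! v)) \<longrightarrow> List.member lab v) \<and>
     (\<forall>v \<in> set [0..<60]. par ! (par ! (par ! v)) = 0 \<and>
        (v = 0 \<or> par ! v < 60 \<and> unit_residue p r (vdet (co ! (par ! v)) (co ! v))))"

text \<open>A position stands for an element of A5 and for a vector at once, position 0 for the
  identity and for (1, 0). As \<open>vdet\<close> is antisymmetric, even r makes adjacency
  symmetric, and r > 0 makes it irreflexive.\<close>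

proposition A5_ex_cayley_graph:
  fixes G :: "('g, 'm) monoid_scheme"
  assumes "group G" "G \<cong> alt_group 5" and p: "Factorial_Ring.prime p" and r: "r > 0" "even r"
    and X: "matrix_action p r co MX sx A5_left1" and Y: "matrix_action p r co MY sy A5_left2"
    and rot: "matrix_action p r co MR sr rot" and tabs: "valid_tables p r co rot lab par"
    and rigid: "difference_rigid p (unit_residue p r)"
  shows "\<exists>\<Gamma> :: 'g pair_pre_digraph.
           pair_graph \<Gamma> \<and> Digraph_Component.connected (with_proj \<Gamma>) \<and>
           (\<forall>v \<in> pverts \<Gamma>. out_degree (with_proj \<Gamma>) v = p) \<and>
           arc_transitive \<Gamma> \<and> is_cayley_graph_of \<Gamma> G \<and>
           (\<exists>v \<in> pverts \<Gamma>. solvable (point_stabilizer (graph_aut \<Gamma>) v))"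
proof -
  interpret G: group G by fact
  interpret A: group "alt_group 5" by (rule alt_group_is_group)
  have p1: "p > 1" using p prime_gt_1_nat by blast
  define E where "E = det_edges p r co"
  define l where "l i = lab ! nat (i mod int p)" for i
  have E_iff: "(u, v) \<in> E \<longleftrightarrow> u < 60 \<and> v < 60 \<and> unit_residue p r (vdet (co ! u) (co ! v))" for u v
    by (simp add: E_def det_edges_def)
  have co0: "co ! 0 = (1, 0)" using tabs by (simp add: valid_tables_def)
  have lab: "co ! (lab ! i) = (int i, 1)" "lab ! i < 60" "rot ! (lab ! i) = lab ! (Suc i mod p)" if "i < p" for i
    using tabs that by (simp_all add: valid_tables_def)
  have co_l: "co ! (l i) = (i mod int p, 1)" and l60: "l i < 60" for i
    using lab[of "nat (i mod int p)"] p1 by (simp_all add: l_def nat_less_iff)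
  have unit1: "unit_residue p r 1" using p1 by (simp add: unit_residue_def)
  have unit_minus: "unit_residue p r (- d) \<longleftrightarrow> unit_residue p r d" for d
    using r by (simp add: unit_residue_def)
  have vdet_swap: "vdet v u = - vdet u v" for u v by (cases u; cases v) (simp add: vdet_def)

  obtain \<phi> where phi: "\<phi> \<in> iso G (alt_group 5)" using assms(2) by (auto simp: is_iso_def)
  have hom: "\<phi> (x \<otimes>\<^bsub>G\<^esub> y) = \<phi> x \<circ> \<phi> y" if "x \<in> carrier G" "y \<in> carrier G" for x y
    using phi that by (auto simp: iso_def hom_def alt_group_mult)
  have phi_bij: "bij_betw \<phi> (carrier G) (carrier (alt_group 5))" using phi by (simp add: iso_def)
  have phi_in: "\<phi> x \<in> carrier (alt_group 5)" if "x \<in> carrier G" for x using phi_bij that by (auto simp: bij_betw_def)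
  have phi1: "\<phi> \<one>\<^bsub>G\<^esub> = id"
  proof -
    have "\<phi> \<one>\<^bsub>G\<^esub> = \<one>\<^bsub>alt_group 5\<^esub>" using phi G.group_axioms A.group_axioms by (intro hom_one) (auto simp: iso_def)
    then show ?thesis by (simp only: alt_group_one)
  qed
  define \<theta> where "\<theta> = inv_into {..<60} A5_elt"
  have theta_bij: "bij_betw \<theta> (carrier (alt_group 5)) {..<60}" unfolding \<theta>_def by (rule bij_betw_inv_into[OF A5_elt_bij])
  have theta_elt: "\<theta> (A5_elt v) = v" if "v < 60" for v
    unfolding \<theta>_def using A5_elt_bij that by (simp add: bij_betw_def)
  have elt_theta: "\<exists>v < 60. f = A5_elt v \<and> \<theta> f = v" if "f \<in> carrier (alt_group 5)" for f
  proof -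
    have "f \<in> A5_elt ` {..<60}" using that A5_elt_bij by (simp add: bij_betw_def)
    then obtain v where "v < 60" "f = A5_elt v" by auto
    then show ?thesis using theta_elt by blast
  qed
  have elt_comp: "A5_elt v \<circ> f \<in> carrier (alt_group 5)" if "v < 60" "f \<in> carrier (alt_group 5)" for v f
    using A.m_closed[OF A5_elt_in[OF that(1)] that(2)] by (simp only: alt_group_mult)
  have aut: "(P ! u, P ! v) \<in> E \<longleftrightarrow> (u, v) \<in> E" if "matrix_action p r co M ss P" "u < 60" "v < 60" for M ss P u v
    using matrix_action_aut[OF that(1)] that(2,3) by (simp add: rel_aut_def E_def)
  \<comment> \<open>Only two left translations come with a certificate; the others are reached by
    induction over words for t.\<close>
  have left: "\<forall>f \<in> carrier (alt_group 5). \<forall>f' \<in> carrier (alt_group 5).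
      (\<theta> (A5_elt t \<circ> f), \<theta> (A5_elt t \<circ> f')) \<in> E \<longleftrightarrow> (\<theta> f, \<theta> f') \<in> E" if "t < 60" for t
  proof (rule A5_induct[OF that])
    show "\<forall>f \<in> carrier (alt_group 5). \<forall>f' \<in> carrier (alt_group 5).
      (\<theta> (A5_elt 0 \<circ> f), \<theta> (A5_elt 0 \<circ> f')) \<in> E \<longleftrightarrow> (\<theta> f, \<theta> f') \<in> E" by (intro ballI) (simp only: A5_elt_0 id_comp)
    have step: "\<forall>f \<in> carrier (alt_group 5). \<forall>f' \<in> carrier (alt_group 5).
        (\<theta> (A5_elt (P ! t) \<circ> f), \<theta> (A5_elt (P ! t) \<circ> f')) \<in> E \<longleftrightarrow> (\<theta> f, \<theta> f') \<in> E"
      if act: "matrix_action p r co M ss P" and P: "\<And>v. v < 60 \<Longrightarrow> P ! v < 60 \<and> A5_elt (P ! v) = w \<circ> A5_elt v"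
        and t: "t < 60" and IH: "\<forall>f \<in> carrier (alt_group 5). \<forall>f' \<in> carrier (alt_group 5).
        (\<theta> (A5_elt t \<circ> f), \<theta> (A5_elt t \<circ> f')) \<in> E \<longleftrightarrow> (\<theta> f, \<theta> f') \<in> E" for M ss P w t
    proof (intro ballI)
      fix f f' assume f: "f \<in> carrier (alt_group 5)" "f' \<in> carrier (alt_group 5)"
      obtain u where u: "u < 60" "A5_elt t \<circ> f = A5_elt u" "\<theta> (A5_elt t \<circ> f) = u"
        using elt_theta[OF elt_comp[OF t f(1)]] by blast
      obtain u' where u': "u' < 60" "A5_elt t \<circ> f' = A5_elt u'" "\<theta> (A5_elt t \<circ> f') = u'"
        using elt_theta[OF elt_comp[OF t f(2)]] by blast
      have "A5_elt (P ! t) \<circ> f = A5_elt (P ! u)" "A5_elt (P ! t) \<circ> f' = A5_elt (P ! u')"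
        using P[OF t] P[OF u(1)] P[OF u'(1)] u(2) u'(2) by (metis comp_assoc)+
      then have "\<theta> (A5_elt (P ! t) \<circ> f) = P ! u" "\<theta> (A5_elt (P ! t) \<circ> f') = P ! u'"
        using theta_elt P u(1) u'(1) by metis+
      then have "(\<theta> (A5_elt (P ! t) \<circ> f), \<theta> (A5_elt (P ! t) \<circ> f')) \<in> E \<longleftrightarrow> (u, u') \<in> E"
        using aut[OF act u(1) u'(1)] by metis
      then show "(\<theta> (A5_elt (P ! t) \<circ> f), \<theta> (A5_elt (P ! t) \<circ> f')) \<in> E \<longleftrightarrow> (\<theta> f, \<theta> f') \<in> E"
        using IH f u(3) u'(3) by metis
    qed
    fix v :: nat assume v: "v < 60" and IH: "\<forall>f \<in> carrier (alt_group 5). \<forall>f' \<in> carrier (alt_group 5).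
        (\<theta> (A5_elt v \<circ> f), \<theta> (A5_elt v \<circ> f')) \<in> E \<longleftrightarrow> (\<theta> f, \<theta> f') \<in> E"
    show "\<forall>f \<in> carrier (alt_group 5). \<forall>f' \<in> carrier (alt_group 5).
        (\<theta> (A5_elt (A5_left1 ! v) \<circ> f), \<theta> (A5_elt (A5_left1 ! v) \<circ> f')) \<in> E \<longleftrightarrow> (\<theta> f, \<theta> f') \<in> E"
      by (rule step[OF X _ v IH]) (use A5_left in blast)
    show "\<forall>f \<in> carrier (alt_group 5). \<forall>f' \<in> carrier (alt_group 5).
        (\<theta> (A5_elt (A5_left2 ! v) \<circ> f), \<theta> (A5_elt (A5_left2 ! v) \<circ> f')) \<in> E \<longleftrightarrow> (\<theta> f, \<theta> f') \<in> E"
      by (rule step[OF Y _ v IH]) (use A5_left in blast)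
  qed
  have base: "(\<theta> \<circ> \<phi>) \<one>\<^bsub>G\<^esub> = 0"
    using theta_elt[of 0] by (simp only: comp_apply phi1 A5_elt_0 zero_less_numeral)
  have nbrs: "range l = E `` {0}"
  proof (intro equalityI subsetI)
    fix v assume "v \<in> range l"
    then show "v \<in> E `` {0}" using co0 co_l l60 unit1 by (auto simp: E_iff vdet_def)
  next
    fix v assume "v \<in> E `` {0}"
    \<comment> \<open>The determinant of (1, 0) and (x, y) is y.\<close>
    then have v: "v < 60" "unit_residue p r (snd (co ! v))" using co0 by (cases "co ! v"; simp add: E_iff vdet_def)+
    then have "v \<in> set lab" using tabs by (simp add: valid_tables_def)
    then obtain i where "i < p" "v = lab ! i" using tabs by (auto simp: valid_tables_def in_set_conv_nth)
    then have "v = l (int i)" by (simp add: l_def)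
    then show "v \<in> range l" by blast
  qed
  have labelling: "cyclic_labelling p l (E `` {0})"
    unfolding cyclic_labelling_def
  proof (intro conjI allI nbrs)
    fix i j
    have "l i = l j \<longleftrightarrow> i mod int p = j mod int p"
    proof
      assume "l i = l j"
      then show "i mod int p = j mod int p" using co_l[of i] co_l[of j] by (metis prod.inject)
    next
      assume "i mod int p = j mod int p"
      then show "l i = l j" by (simp only: l_def)
    qed
    then show "l i = l j \<longleftrightarrow> int p dvd i - j" by (simp only: mod_eq_dvd_iff)
  qed
  \<comment> \<open>The determinant of (i, 1) and (j, 1) is i - j, so adjacency within the
    neighbourhood is circulant.\<close>
  have tri: "(l i, l j) \<in> E \<longleftrightarrow> unit_residue p r (i - j)" for i j
  proof -
    have "(l i, l j) \<in> E \<longleftrightarrow> unit_residue p r (i mod int p - j mod int p)"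
      using co_l l60 by (simp add: E_iff vdet_def)
    also have "\<dots> \<longleftrightarrow> unit_residue p r (i - j)" by (rule unit_residue_cong) (rule mod_diff_eq)
    finally show ?thesis .
  qed
  have conn: "(0, v) \<in> E\<^sup>*" if "v < 60" for v
  proof -
    have par: "par ! (par ! (par ! v)) = 0" "v = 0 \<or> (par ! v, v) \<in> E" if "v < 60" for v
      using tabs that by (simp_all add: valid_tables_def E_iff)
    have par60: "par ! v < 60" if "v < 60" "v \<noteq> 0" for v using par(2)[OF that(1)] that(2) by (simp add: E_iff)
    have "(0, v) \<in> E\<^sup>*" if "v < 60" "(0, par ! v) \<in> E\<^sup>*" for v
      using par(2)[OF that(1)] that(2) by auto
    then show ?thesis using par par60 that by (metis rtrancl.rtrancl_refl)
  qed
  show ?thesis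
  proof (rule ex_cayley_graph_with_solvable_stabilizer[where \<psi> = "\<theta> \<circ> \<phi>" and V = "{..<60}" and E = E
        and l = l and \<rho> = "\<lambda>v. rot ! v"], unfold base)
    show "bij_betw (\<theta> \<circ> \<phi>) (carrier G) {..<60}" by (rule bij_betw_trans[OF phi_bij theta_bij])
    show "E \<subseteq> {..<60} \<times> {..<60}" by (auto simp: E_iff)
    show "sym E"
    proof (rule symI)
      fix u v assume "(u, v) \<in> E"
      then show "(v, u) \<in> E" using vdet_swap[of "co ! v" "co ! u"] unit_minus by (simp add: E_iff)
    qed
    show "irrefl E"
    proof (rule irreflI, rule notI)
      fix u assume "(u, u) \<in> E"
      moreover have "vdet (co ! u) (co ! u) = 0" by (cases "co ! u") (simp add: vdet_def)
      ultimately show False using r p1 by (simp add: E_iff unit_residue_def zero_power)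
    qed
    fix x y z assume xyz: "x \<in> carrier G" "y \<in> carrier G" "z \<in> carrier G"
    obtain t where t: "t < 60" "\<phi> x = A5_elt t" using elt_theta[OF phi_in[OF xyz(1)]] by blast
    show "((\<theta> \<circ> \<phi>) (x \<otimes>\<^bsub>G\<^esub> y), (\<theta> \<circ> \<phi>) (x \<otimes>\<^bsub>G\<^esub> z)) \<in> E \<longleftrightarrow> ((\<theta> \<circ> \<phi>) y, (\<theta> \<circ> \<phi>) z) \<in> E"
      using left[OF t(1)] phi_in xyz by (simp only: comp_apply[of \<theta>] hom t(2))
  next
    show "rel_aut {..<60} E (\<lambda>v. rot ! v)" unfolding E_def by (rule matrix_action_aut[OF rot])
    show "rot ! 0 = 0" using tabs by (simp add: valid_tables_def)
    fix i
    let ?n = "nat (i mod int p)"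
    have "?n < p" using p1 by (simp add: nat_less_iff)
    moreover have "Suc ?n mod p = nat ((i + 1) mod int p)"
    proof -
      have "int (Suc ?n mod p) = (i mod int p + 1) mod int p" using p1 by (simp add: zmod_int add.commute)
      also have "\<dots> = (i + 1) mod int p" by (rule mod_add_left_eq)
      finally show ?thesis by (metis nat_int)
    qed
    ultimately show "rot ! l i = l (i + 1)" using lab(3) by (simp add: l_def)
  next
    fix f assume f: "rel_aut {..<60} E f" "f 0 = 0"
    have N60: "E `` {0} \<subseteq> {..<60}" by (auto simp: E_iff)
    have inj: "inj_on f {..<60}" and E_pres: "\<And>u v. u < 60 \<Longrightarrow> v < 60 \<Longrightarrow> (f u, f v) \<in> E \<longleftrightarrow> (u, v) \<in> E"
      using f(1) by (auto simp: rel_aut_def bij_betw_def)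
    show "affine_on_labels l f"
    proof (rule affine_on_labels_if_rigid[OF labelling rigid _ _ _ tri])
      fix u assume "u \<in> E `` {0}"
      then show "f u \<in> E `` {0}" using E_pres[of 0 u] f(2) by (auto simp: E_iff)
    next
      fix u w assume "u \<in> E `` {0}" "w \<in> E `` {0}"
      then show "(f u, f w) \<in> E \<longleftrightarrow> (u, w) \<in> E" using N60 by (intro E_pres) auto
    qed (rule inj_on_subset[OF inj N60])
  qed (use labelling conn p \<open>group G\<close> in auto)
qed

section \<open>Tables for the planes over the fields with 11 and 29 elements\<close>

definition vectors11 :: "(int \<times> int) list" where
  "vectors11 =
    [(1, 0), (0, 1), (0, 5), (2, 1), (5, 0), (10, 5), (10, 2), (2, 0),
     (0, 3), (5, 1), (7, 3), (0, 2), (3, 0), (6, 3), (2, 4), (3, 4),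
     (6, 5), (4, 2), (0, 4), (3, 5), (7, 2), (8, 3), (3, 3), (5, 5),
     (9, 4), (4, 0), (8, 4), (1, 2), (4, 4), (5, 4), (1, 3), (8, 5),
     (4, 3), (9, 1), (7, 4), (8, 2), (7, 5), (8, 1), (5, 3), (10, 1),
     (6, 1), (2, 2), (2, 3), (1, 4), (9, 3), (1, 1), (1, 5), (9, 2),
     (4, 1), (6, 2), (7, 1), (3, 2), (6, 4), (9, 5), (10, 4), (2, 5),
     (4, 5), (5, 2), (3, 1), (10, 3)]"

definition rotation11 :: "nat list" where
  "rotation11 =
    [0, 45, 23, 58, 4, 56, 27, 7, 22, 40, 59, 41, 12, 44, 52,
     34, 2, 49, 28, 31, 47, 8, 13, 5, 14, 25, 43, 51, 26, 24,
     32, 55, 10, 39, 18, 6, 46, 33, 21, 1, 50, 17, 38, 29, 30,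
     3, 16, 11, 9, 35, 37, 57, 54, 19, 15, 36, 53, 20, 48, 42]"

text \<open>The last list is constant because representatives are normalised to have second
  coordinate 1, ..., 5, or 0 and then first coordinate 1, ..., 5; the transvection with rows (1, 1)
  and (0, 1) respects this.\<close>

definition scalars11 :: "int list \<times> int list \<times> int list" where
  "scalars11 =
    ([1, 10, 10, 1, 1, 10, 10, 1, 10, 1, 10, 10, 1, 10, 1,
     1, 10, 1, 10, 1, 10, 10, 1, 1, 10, 1, 10, 1, 1, 1,
     1, 10, 1, 10, 10, 10, 10, 10, 1, 10, 10, 1, 1, 1, 10,
     1, 1, 10, 1, 10, 10, 1, 10, 10, 10, 1, 1, 1, 1, 10],
     [1, 1, 1, 1, 1, 10, 10, 10, 1, 1, 1, 1, 1, 10, 1,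
     10, 1, 1, 1, 10, 1, 10, 10, 10, 1, 10, 10, 10, 1, 10,
     10, 1, 1, 1, 10, 10, 10, 10, 10, 10, 10, 1, 1, 10, 1,
     10, 10, 1, 10, 10, 1, 10, 1, 10, 10, 1, 1, 1, 1, 10],
     [1, 1, 1, 1, 1, 1, 1, 1, 1, 1, 1, 1, 1, 1, 1,
     1, 1, 1, 1, 1, 1, 1, 1, 1, 1, 1, 1, 1, 1, 1,
     1, 1, 1, 1, 1, 1, 1, 1, 1, 1, 1, 1, 1, 1, 1,
     1, 1, 1, 1, 1, 1, 1, 1, 1, 1, 1, 1, 1, 1, 1])"

definition labels11 :: "nat list" where
  "labels11 =
    [1, 45, 3, 58, 48, 9, 40, 50, 37, 33, 39]"

definition parents11 :: "nat list" where
  "parents11 =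
    [0, 0, 3, 0, 6, 1, 1, 5, 48, 0, 3, 9, 43, 33, 33,
     40, 37, 37, 37, 50, 48, 40, 9, 39, 3, 30, 9, 1, 33, 45,
     1, 37, 33, 0, 3, 33, 39, 0, 3, 0, 0, 40, 45, 1, 39,
     0, 1, 9, 0, 33, 0, 3, 39, 3, 1, 9, 9, 3, 0, 1]"

text \<open>The first two matrices have traces 0 and 1, their product has trace 8; modulo
  \<plusminus>1 the orders are 2, 3 and 5, as for (1 2)(3 4), (1 3 5) and their product. They
  generate the binary icosahedral group. The third matrix rotates the neighbourhood of (1,
  0).\<close>

lemma matrix_actions11:
  "case scalars11 of (sx, sy, sr) \<Rightarrow>
     matrix_action 11 2 vectors11 (0, 10, 1, 0) sx A5_left1 \<and>
     matrix_action 11 2 vectors11 (0, 2, 5, 1) sy A5_left2 \<and>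
     matrix_action 11 2 vectors11 (1, 1, 0, 1) sr rotation11"
  by code_simp

lemma valid_tables11: "valid_tables 11 2 vectors11 rotation11 labels11 parents11"
  by code_simp

text \<open>2 is not a square modulo 29, so 1 and 2 represent the units modulo squares; the last
  nonzero coordinate is normalised to one of them.\<close>

definition vectors29 :: "(int \<times> int) list" where
  "vectors29 =
    [(1, 0), (0, 1), (3, 2), (24, 1), (18, 2), (16, 2), (6, 1), (24, 2),
     (10, 1), (18, 1), (19, 1), (12, 1), (23, 2), (13, 1), (27, 1), (6, 2),
     (26, 1), (0, 2), (12, 2), (20, 1), (1, 2), (5, 1), (23, 1), (20, 2),
     (2, 0), (19, 2), (9, 2), (1, 1), (11, 1), (4, 1), (26, 2), (16, 1),
     (3, 1), (28, 1), (13, 2), (14, 1), (7, 1), (11, 2), (9, 1), (8, 1),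
     (17, 2), (14, 2), (4, 2), (15, 2), (2, 2), (7, 2), (10, 2), (8, 2),
     (22, 1), (17, 1), (21, 2), (27, 2), (21, 1), (25, 2), (25, 1), (5, 2),
     (22, 2), (15, 1), (2, 1), (28, 2)]"

definition rotation29 :: "nat list" where
  "rotation29 =
    [0, 27, 55, 54, 23, 4, 36, 30, 28, 10, 19, 13, 53, 35, 33,
     47, 14, 44, 41, 52, 2, 6, 3, 56, 24, 50, 37, 58, 11, 21,
     59, 49, 29, 1, 43, 57, 39, 34, 8, 38, 25, 5, 15, 40, 42,
     26, 18, 46, 22, 9, 12, 17, 48, 51, 16, 45, 7, 31, 32, 20]"

definition scalars29 :: "int list \<times> int list \<times> int list" where
  "scalars29 =
    ([1, 28, 20, 23, 13, 20, 5, 23, 6, 13, 23, 5, 24, 9, 28,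
     5, 9, 28, 5, 16, 1, 6, 24, 16, 1, 23, 13, 1, 16, 22,
     9, 20, 20, 28, 9, 25, 25, 16, 13, 22, 24, 25, 22, 4, 1,
     25, 6, 22, 4, 24, 7, 28, 7, 7, 7, 6, 4, 4, 1, 28],
     [16, 28, 1, 1, 4, 9, 25, 1, 4, 24, 6, 4, 23, 9, 5,
     5, 23, 28, 25, 20, 13, 7, 16, 4, 4, 22, 6, 6, 22, 25,
     24, 1, 20, 24, 7, 22, 13, 20, 16, 7, 16, 25, 9, 13, 16,
     24, 7, 28, 13, 5, 9, 6, 28, 5, 9, 23, 22, 23, 7, 20],
     [1, 1, 1, 1, 1, 1, 1, 1, 1, 1, 1, 1, 1, 1, 1,
     1, 1, 1, 1, 1, 1, 1, 1, 1, 1, 1, 1, 1, 1, 1,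
     1, 1, 1, 1, 1, 1, 1, 1, 1, 1, 1, 1, 1, 1, 1,
     1, 1, 1, 1, 1, 1, 1, 1, 1, 1, 1, 1, 1, 1, 1])"

definition labels29 :: "nat list" where
  "labels29 =
    [1, 27, 58, 32, 29, 21, 6, 36, 39, 38, 8, 28, 11, 13, 35,
     57, 31, 49, 9, 10, 19, 52, 48, 22, 3, 54, 16, 14, 33]"

definition parents29 :: "nat list" where
  "parents29 =
    [0, 0, 3, 0, 3, 1, 0, 1, 0, 0, 0, 0, 1, 0, 0,
     1, 0, 8, 3, 0, 1, 0, 0, 1, 5, 6, 1, 0, 0, 0,
     3, 0, 0, 0, 1, 0, 0, 6, 0, 0, 6, 3, 1, 3, 9,
     1, 3, 6, 0, 0, 6, 8, 0, 1, 0, 1, 1, 0, 0, 1]"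

text \<open>Traces 0, 1 and, for the product of the first two matrices, -6 again give orders 2, 3
  and 5 modulo \<plusminus>1.\<close>

lemma matrix_actions29:
  "case scalars29 of (sx, sy, sr) \<Rightarrow>
     matrix_action 29 14 vectors29 (0, 28, 1, 0) sx A5_left1 \<and>
     matrix_action 29 14 vectors29 (2, 5, 11, 28) sy A5_left2 \<and>
     matrix_action 29 14 vectors29 (1, 1, 0, 1) sr rotation29"
  by code_simp

lemma valid_tables29: "valid_tables 29 14 vectors29 rotation29 labels29 parents29"
  by code_simp

lemma difference_rigid_11: "difference_rigid 11 (unit_residue 11 2)"
proof (rule difference_rigid_cycle[where b = 1])
  fix d :: int
  have "11 dvd d * d - 1 \<longleftrightarrow> 11 dvd (d - 1) * (d + 1)" by (simp add: algebra_simps)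
  also have "\<dots> \<longleftrightarrow> 11 dvd d - 1 \<or> 11 dvd d + 1" by (rule prime_dvd_mult_iff) simp
  finally have "d * d mod 11 = 1 mod 11 \<longleftrightarrow> 11 dvd d - 1 \<or> 11 dvd d + 1" by (simp only: mod_eq_dvd_iff)
  then show "unit_residue 11 2 d \<longleftrightarrow> int 11 dvd d - 1 \<or> int 11 dvd d + 1"
    by (simp add: unit_residue_def power2_eq_square)
qed simp_all

lemma difference_rigid_29: "difference_rigid 29 (unit_residue 29 14)"
proof -
  have "unit_residue 29 14 = square29" by (rule ext) (simp add: unit_residue_def square29_def)
  then show ?thesis using difference_rigid_square29 by simp
qed

theorem theorem1p2:
  fixes G :: "('a, 'm) monoid_scheme" and T :: "('b, 'n) monoid_scheme" and p :: nat
  assumes "Factorial_Ring.prime p" and "p \<ge> 11" and "group G" and "group T"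
    and "(G \<cong> alt_group 5 \<and> T \<cong> PSL2 (residue_ring 11) \<and> p = 11) \<or>
         (G \<cong> alt_group 5 \<and> T \<cong> PSL2 (residue_ring 29) \<and> p = 29) \<or>
         (G \<cong> M22 \<and> T \<cong> M23 \<and> p = 23) \<or>
         (G \<cong> alt_group (p - 1) \<and> T \<cong> alt_group p)"
  shows "\<exists>\<Gamma> :: 'a pair_pre_digraph.
           pair_graph \<Gamma> \<and> Digraph_Component.connected (with_proj \<Gamma>) \<and>
           (\<forall>v \<in> pverts \<Gamma>. out_degree (with_proj \<Gamma>) v = p) \<and>
           arc_transitive \<Gamma> \<and> is_cayley_graph_of \<Gamma> G \<and>
           (\<exists>v \<in> pverts \<Gamma>. solvable (point_stabilizer (graph_aut \<Gamma>) v))"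
proof -
  consider (a) "G \<cong> alt_group 5" "p = 11" | (b) "G \<cong> alt_group 5" "p = 29"
    | (c) "G \<cong> M22" "p = 23" | (d) "G \<cong> alt_group (p - 1)" using assms(5) by blast
  then show ?thesis
  proof cases
    case a
    obtain sx sy sr where s: "scalars11 = (sx, sy, sr)" by (cases scalars11)
    note m = matrix_actions11[unfolded s prod.case]
    show ?thesis unfolding a(2)
      by (rule A5_ex_cayley_graph[OF \<open>group G\<close> a(1) _ _ _ m[THEN conjunct1]
          m[THEN conjunct2, THEN conjunct1] m[THEN conjunct2, THEN conjunct2] valid_tables11 difference_rigid_11])
        simp_all
  next
    case b
    obtain sx sy sr where s: "scalars29 = (sx, sy, sr)" by (cases scalars29)
    note m = matrix_actions29[unfolded s prod.case]
    show ?thesis unfolding b(2)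
      by (rule A5_ex_cayley_graph[OF \<open>group G\<close> b(1) _ _ _ m[THEN conjunct1]
          m[THEN conjunct2, THEN conjunct1] m[THEN conjunct2, THEN conjunct2] valid_tables29 difference_rigid_29])
        simp_all
  next
    case c
    have "G \<cong> M23\<lparr>carrier := {t \<in> carrier M23. t 23 = 23}\<rparr>"
      using c(1) by (simp only: M22_def point_stabilizer_def)
    from M23.ex_cayley_graph_of_stabilizer[OF \<open>group G\<close> this M23_rigid] show ?thesis by (simp only: c(2))
  next
    case d
    interpret alternating_rotation p by standard (use assms in auto)
    show ?thesis
      using ex_cayley_graph_of_stabilizer[OF \<open>group G\<close> _ rigid] d
      unfolding alt_group_pred_eq_stabilizer by blast
  qed
qed

end
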